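(* Let $\psi\in(0,\pi)$. Then $\mathcal{H}_{\psi,0}$ equals the closure in $\mathcal{H}_{\psi,0}$ of the linear span of $\{(\lambda+z)^{-1}:\lambda\in\Sigma_{\pi-\psi}\}$ (functions of $z\in\Sigma_\psi$).
   Context: $\Sigma_\psi=\{z\ne0:|\arg z|<\psi\}$. $H^1(\Sigma_\psi)$: holomorphic $g$ on $\Sigma_\psi$ with $\|g\|_{H^1(\Sigma_\psi)}=\sup_{|\varphi|<\psi}\int_0^\infty(|g(te^{i\varphi})|+|g(te^{-i\varphi})|)dt<\infty$. $\mathcal{H}_\psi=\{f\in\mathrm{Hol}(\Sigma_\psi):f'\in H^1(\Sigma_\psi)\}$; each such $f$ has a limit $f(\infty)=\lim_{|z|\to\infty,z\in\Sigma_\psi}f(z)$. $\mathcal{H}_{\psi,0}=\{f\in\mathcal{H}_\psi:f(\infty)=0\}$ with the norm $\|f\|_{\mathcal{H}_{\psi,0}}=\|f'\|_{H^1(\Sigma_\psi)}$. *)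

theory Defs
  imports "HOL-Analysis.Analysis"
begin

text \<open>The open sector of half-angle psi (Arg takes values in (-pi, pi]).\<close>
definition sector :: "real \<Rightarrow> complex set" where
  "sector \<psi> = {z. z \<noteq> 0 \<and> \<bar>Arg z\<bar> < \<psi>}"

definition H1norm :: "real \<Rightarrow> (complex \<Rightarrow> complex) \<Rightarrow> ennreal" where
  "H1norm \<psi> g = (SUP \<phi>\<in>{-\<psi><..<\<psi>}.
      \<integral>\<^sup>+ t. ennreal ((cmod (g (of_real t * cis \<phi>)) + cmod (g (of_real t * cis (- \<phi>))))
                  * indicator {0<..} t) \<partial>lborel)"

definition H1 :: "real \<Rightarrow> (complex \<Rightarrow> complex) \<Rightarrow> bool" where
  "H1 \<psi> g \<longleftrightarrow> g holomorphic_on sector \<psi> \<and> H1norm \<psi> g < \<infinity>"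

definition Hpsi :: "real \<Rightarrow> (complex \<Rightarrow> complex) \<Rightarrow> bool" where
  "Hpsi \<psi> f \<longleftrightarrow> f holomorphic_on sector \<psi> \<and> H1 \<psi> (deriv f)"

definition Hpsi0 :: "real \<Rightarrow> (complex \<Rightarrow> complex) \<Rightarrow> bool" where
  "Hpsi0 \<psi> f \<longleftrightarrow> Hpsi \<psi> f \<and> (f \<longlongrightarrow> 0) (inf at_infinity (principal (sector \<psi>)))"

definition Hpsi0norm :: "real \<Rightarrow> (complex \<Rightarrow> complex) \<Rightarrow> ennreal" where
  "Hpsi0norm \<psi> f = H1norm \<psi> (deriv f)"

definition resolvent_span :: "real \<Rightarrow> (complex \<Rightarrow> complex) set" where
  "resolvent_span \<psi> = {g. \<exists>(n::nat) (c::nat \<Rightarrow> complex) (lam::nat \<Rightarrow> complex).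
      (\<forall>i<n. lam i \<in> sector (pi - \<psi>)) \<and> g = (\<lambda>z. \<Sum>i<n. c i / (lam i + z))}"

end

theory Submission
  imports Defs "HOL-Complex_Analysis.Complex_Analysis"
begin

text \<open>
  In the coordinate $z = e^w$ the function $f'$ becomes $h(w) = e^w f'(e^w)$ on the strip $|\mathrm{Im}\, w| < \psi$,
  with $L^1$ norms bounded on horizontal lines, and resolvents become translates of a fixed kernel.

  The core is that $y \mapsto h(\cdot + iy) \in L^1$ is uniformly continuous up to the boundary. Between two lines
  $y_1 < y_2$ write $h = FG$ with $|F|^2 \approx |G|^2 \approx |h|$ on both lines. For functions with
  square-integrable traces and $N(y) = \|F(\cdot + iy)\|_2^2$, a contour shift gives
  $\|F(\cdot + iy_1) - F(\cdot + iy_2)\|_2^2 = N(y_1) + N(y_2) - 2 N((y_1 + y_2)/2)$.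
  The Cauchy--Schwarz inequality turns this into
  $\|h(\cdot + iy_1) - h(\cdot + iy_2)\|_1^2 \le 32\, A\, (A - M((y_1 + y_2)/2))$ with
  $M(y) = \|h(\cdot + iy)\|_1$ and $A = (M(y_1) + M(y_2))/2$. In particular $M$ is midpoint convex, hence uniformly
  continuous because it is bounded.

  Therefore $a\, h(aw) e^{-\delta w^2}$ tends to $h$ uniformly in $y$ as $a \uparrow 1$ and $\delta \downarrow 0$. These functions are
  holomorphic and rapidly decreasing on a larger strip. After subtracting a multiple of one kernel they have a
  decaying primitive, and Cauchy's formula for the derivative of that primitive on the larger strip is a superposition of
  admissible kernels. Its Riemann sums converge in the weight $e^{-|\mathrm{Re}\, w|/2}$.
\<close>

section \<open>Holomorphic functions on horizontal strips\<close>

text \<open>The norm is a supremum over all heights of an open strip, and dilation by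
  \<open>a\<close> replaces the trace at height \<open>y\<close> by the one at height
  \<open>ay\<close>. Convergence at each fixed height is therefore not enough, and no boundary trace
  is available for a compactness argument: continuity has to be uniform up to lines on which
  \<open>h\<close> is not defined. L^1 has no identity that controls a difference of two traces,
  whereas L^2 has the parallelogram law; this is what the factors \<open>F\<close> and
  \<open>G\<close> are for. Since no trace of them is left in the final inequality, they may depend
  on an error parameter, and polynomials can replace exact outer functions. Of the two
  regularisations, the dilation makes room outside the strip for the poles of the kernels, and the
  Gaussian makes integrals over whole lines converge. The kernel has a double pole because it comes
  from the derivative of a resolvent; it reproduces the derivative of its density, so the density
  must be a primitive. A primitive decays at both ends only if its derivative has integral 0 along a
  line, whence the correction by one kernel. The final weight has the same finite integral on every
  line, so a pointwise bound is uniform in the height.\<close>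

definition hstrip :: "real \<Rightarrow> real \<Rightarrow> complex set" where
  "hstrip a b = {w. a < Im w \<and> Im w < b}"

lemma open_hstrip: "open (hstrip a b)"
  unfolding hstrip_def
  by (intro open_Collect_conj open_halfspace_Im_gt open_halfspace_Im_lt)

lemma convex_hstrip: "convex (hstrip a b)"
proof -
  have "hstrip a b = {w. Im w > a} \<inter> {w. Im w < b}"
    by (auto simp: hstrip_def)
  then show ?thesis
    by (simp add: convex_Int convex_halfspace_Im_gt convex_halfspace_Im_lt)
qed

lemma Complex_in_hstrip [simp]: "Complex x y \<in> hstrip a b \<longleftrightarrow> a < y \<and> y < b"
  by (simp add: hstrip_def)

lemma continuous_on_hline:
  assumes "continuous_on (hstrip a b) h" "a < y" "y < b"
  shows "continuous_on A (\<lambda>x. h (Complex x y))"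
  by (rule continuous_on_compose2[OF assms(1)])
     (use assms in \<open>auto intro!: continuous_intros simp: Complex_eq hstrip_def\<close>)

lemma measurable_hline [measurable (raw)]:
  assumes "continuous_on (hstrip a b) h" "a < y" "y < b"
  shows "(\<lambda>x. h (Complex x y)) \<in> borel_measurable borel"
  using continuous_on_hline[OF assms] by (rule borel_measurable_continuous_onI)

section \<open>Integrals over horizontal lines and shifts of the line\<close>

lemma integrable_exp_abs:
  fixes c :: real assumes "c > 0"
  shows "integrable lborel (\<lambda>x::real. exp (- (c * \<bar>x\<bar>)))"
proof (rule integrableI_bounded)
  have lim: "((\<lambda>x. - exp (- (c * x)) / c) \<longlongrightarrow> 0) at_top"
  proof -
    have "filterlim (\<lambda>x. - (c * x)) at_bot at_top"
      using assms by (simp add: filterlim_uminus_at_bot filterlim_tendsto_pos_mult_at_top[OF tendsto_const _ filterlim_ident])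
    then have "((\<lambda>x. exp (- (c * x))) \<longlongrightarrow> 0) at_top"
      by (rule filterlim_compose[OF exp_at_bot])
    from tendsto_divide[OF tendsto_minus[OF this] tendsto_const[of c]] assms show ?thesis by simp
  qed
  have half: "(\<integral>\<^sup>+ x. ennreal (exp (- (c * x))) * indicator {0..} x \<partial>lborel) = 0 - (- exp (- (c * 0)) / c)"
    using assms by (intro nn_integral_FTC_atLeast lim) (auto intro!: derivative_eq_intros)
  have "(\<integral>\<^sup>+ x. ennreal (exp (- (c * \<bar>x\<bar>))) \<partial>lborel)
      \<le> (\<integral>\<^sup>+ x. ennreal (exp (- (c * x))) * indicator {0..} x + ennreal (exp (- (c * (-x)))) * indicator {0..} (-x) \<partial>lborel)"
    by (intro nn_integral_mono) (auto split: split_indicator)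
  also have "\<dots> = (\<integral>\<^sup>+ x. ennreal (exp (- (c * x))) * indicator {0..} x \<partial>lborel)
       + (\<integral>\<^sup>+ x. ennreal (exp (- (c * (-x)))) * indicator {0..} (-x) \<partial>lborel)"
    by (intro nn_integral_add) auto
  also have "(\<integral>\<^sup>+ x. ennreal (exp (- (c * (-x)))) * indicator {0..} (-x) \<partial>lborel)
       = (\<integral>\<^sup>+ x. ennreal (exp (- (c * x))) * indicator {0..} x \<partial>lborel)"
    using nn_integral_real_affine[of "\<lambda>x. ennreal (exp (- (c * x))) * indicator {0..} x" "-1" 0]
    by simp
  finally have "(\<integral>\<^sup>+ x. ennreal (exp (- (c * \<bar>x\<bar>))) \<partial>lborel) < \<infinity>"
    unfolding half by (rule le_less_trans) (auto simp: ennreal_add_eq_top less_top)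
  then show "(\<integral>\<^sup>+ x. ennreal (norm (exp (- (c * \<bar>x\<bar>)))) \<partial>lborel) < \<infinity>" by simp
qed simp

lemma integrable_of_exp_bound:
  fixes f :: "real \<Rightarrow> 'a::{banach, second_countable_topology}"
  assumes "f \<in> borel_measurable borel" "\<And>x. norm (f x) \<le> C * exp (- \<bar>x\<bar>)"
  shows "integrable lborel f"
proof (rule Bochner_Integration.integrable_bound)
  show "integrable lborel (\<lambda>x. C * exp (- \<bar>x\<bar>))"
    using integrable_exp_abs[of 1] by simp
  have "C \<ge> 0"
    using assms(2)[of 0] norm_ge_zero[of "f 0"] by (simp add: order_trans[OF norm_ge_zero])
  then show "AE x in lborel. norm (f x) \<le> norm (C * exp (- \<bar>x\<bar>))"
    using assms(2) by (simp add: abs_mult)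
qed (use assms in simp)

lemma tendsto_integral_symmetric_interval:
  fixes f :: "real \<Rightarrow> complex"
  assumes "integrable lborel f"
  shows "(\<lambda>n. \<integral>x. indicator {- real n..real n} x *\<^sub>R f x \<partial>lborel) \<longlonglongrightarrow> (\<integral>x. f x \<partial>lborel)"
proof (rule integral_dominated_convergence[where w = "\<lambda>x. norm (f x)"])
  show "AE x in lborel. (\<lambda>n. indicator {- real n..real n} x *\<^sub>R f x) \<longlonglongrightarrow> f x"
  proof (rule AE_I2)
    fix x :: real
    obtain N where "\<bar>x\<bar> \<le> real N" using real_arch_simple by blast
    then have "eventually (\<lambda>n. indicator {- real n..real n} x *\<^sub>R f x = f x) sequentially"
      by (intro eventually_sequentiallyI[of N]) (auto split: split_indicator)
    then show "(\<lambda>n. indicator {- real n..real n} x *\<^sub>R f x) \<longlonglongrightarrow> f x"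
      by (simp add: tendsto_eventually)
  qed
qed (use assms in \<open>auto split: split_indicator\<close>)

lemma tendsto_primitive_diff_integral:
  fixes F f :: "real \<Rightarrow> complex"
  assumes "\<And>x. (F has_vector_derivative f x) (at x)" "continuous_on UNIV f" "integrable lborel f"
  shows "(\<lambda>n. F (real n) - F (- real n)) \<longlonglongrightarrow> (\<integral>x. f x \<partial>lborel)"
proof -
  have "(\<integral>x. indicator {- real n..real n} x *\<^sub>R f x \<partial>lborel) = F (real n) - F (- real n)" for n
    by (rule integral_FTC_atLeastAtMost)
       (use assms in \<open>auto intro: has_vector_derivative_at_within continuous_on_subset\<close>)
  then show ?thesis using tendsto_integral_symmetric_interval[OF assms(3)] by simp
qed

lemma has_vector_derivative_hline:
  assumes "\<And>w. w \<in> hstrip a b \<Longrightarrow> (P has_field_derivative f w) (at w)" "a < y" "y < b"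
  shows "((\<lambda>x. P (Complex x y)) has_vector_derivative f (Complex x y)) (at x)"
proof -
  have "((\<lambda>x. Complex x y) has_vector_derivative 1) (at x)"
    unfolding Complex_eq by (auto intro!: derivative_eq_intros)
  from field_vector_diff_chain_at[OF this assms(1)[of "Complex x y"]] assms
  show ?thesis by (simp add: o_def)
qed

lemma hstrip_primitive:
  assumes "f holomorphic_on hstrip a b"
  obtains P where "\<And>w. w \<in> hstrip a b \<Longrightarrow> (P has_field_derivative f w) (at w)"
  using holomorphic_convex_primitive'[OF convex_hstrip open_hstrip assms]
  by (metis at_within_open open_hstrip)

lemma vertical_difference_bound:
  assumes "\<And>w. w \<in> hstrip a b \<Longrightarrow> (P has_field_derivative f w) (at w)"
    and "a < y1" "y1 < b" "a < y2" "y2 < b"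
    and "\<And>y. y \<in> closed_segment y1 y2 \<Longrightarrow> cmod (f (Complex x y)) \<le> B"
  shows "cmod (P (Complex x y1) - P (Complex x y2)) \<le> B * \<bar>y1 - y2\<bar>"
proof -
  let ?S = "closed_segment (Complex x y1) (Complex x y2)"
  have S: "Re w = x \<and> Im w \<in> closed_segment y1 y2" if "w \<in> ?S" for w
  proof -
    from that obtain u where u: "0 \<le> u" "u \<le> 1"
      "w = (1 - u) *\<^sub>R Complex x y1 + u *\<^sub>R Complex x y2"
      by (auto simp: in_segment)
    then have "Re w = x" "Im w = (1 - u) *\<^sub>R y1 + u *\<^sub>R y2"
      by (simp, simp add: algebra_simps) (simp add: u(3))
    with u show ?thesis by (auto simp: in_segment)
  qed
  have seg: "y \<in> closed_segment y1 y2 \<Longrightarrow> a < y \<and> y < b" for y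
    using assms(2-5) by (auto simp: closed_segment_eq_real_ivl split: if_splits)
  have "cmod (P (Complex x y1) - P (Complex x y2)) \<le> B * cmod (Complex x y1 - Complex x y2)"
  proof (rule field_differentiable_bound[of ?S])
    fix w assume "w \<in> ?S"
    then have w: "Re w = x" "Im w \<in> closed_segment y1 y2" using S by auto
    then have "w \<in> hstrip a b" using seg by (simp add: hstrip_def)
    then show "(P has_field_derivative f w) (at w within ?S)"
      using assms(1) has_field_derivative_at_within by blast
    have "Complex x (Im w) = w" using w by (simp add: complex_eq_iff)
    then show "cmod (f w) \<le> B" using assms(6)[of "Im w"] w by simp
  qed auto
  also have "cmod (Complex x y1 - Complex x y2) = \<bar>y1 - y2\<bar>"
    by (simp add: cmod_def)
  finally show ?thesis .
qed

lemma tendsto_exp_minus_nat: "(\<lambda>n. exp (- real n)) \<longlonglongrightarrow> 0"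
  by (rule filterlim_compose[OF exp_at_bot])
     (simp add: filterlim_uminus_at_bot filterlim_real_sequentially)

text \<open>For a primitive \<open>P\<close>, the integral at height \<open>y\<close> is the limit
  of \<open>P (Complex n y) - P (Complex (- n) y)\<close>. Two heights differ only by the vertical
  increments of \<open>P\<close> at the abscissas \<open>n\<close> and \<open>- n\<close>, which are
  of order exp(-n).\<close>

lemma line_integral_shift:
  assumes holo: "f holomorphic_on hstrip a b" and y: "a < y1" "y1 \<le> y2" "y2 < b"
    and bd: "\<And>w. y1 \<le> Im w \<Longrightarrow> Im w \<le> y2 \<Longrightarrow> cmod (f w) \<le> C * exp (- \<bar>Re w\<bar>)"
  shows "(\<integral>x. f (Complex x y1) \<partial>lborel) = (\<integral>x. f (Complex x y2) \<partial>lborel)"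
proof -
  obtain P where P: "\<And>w. w \<in> hstrip a b \<Longrightarrow> (P has_field_derivative f w) (at w)"
    using hstrip_primitive[OF holo] by blast
  note cont = holomorphic_on_imp_continuous_on[OF holo]
  have int: "integrable lborel (\<lambda>x. f (Complex x y))" if "y1 \<le> y" "y \<le> y2" for y
    using measurable_hline[OF cont, of y] that y bd[of "Complex _ y"]
    by (intro integrable_of_exp_bound[where C = C]) auto
  have lim: "(\<lambda>n. P (Complex (real n) y) - P (Complex (- real n) y)) \<longlonglongrightarrow> (\<integral>x. f (Complex x y) \<partial>lborel)"
    if "y1 \<le> y" "y \<le> y2" for y
    by (rule tendsto_primitive_diff_integral)
       (use that y int in \<open>auto intro!: has_vector_derivative_hline[OF P] continuous_on_hline[OF cont]\<close>)
  have diff: "(\<lambda>n. (P (Complex (real n) y1) - P (Complex (- real n) y1)) - (P (Complex (real n) y2) - P (Complex (- real n) y2))) \<longlonglongrightarrow> 0"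
  proof (rule Lim_null_comparison)
    show "eventually (\<lambda>n. norm ((P (Complex (real n) y1) - P (Complex (- real n) y1)) - (P (Complex (real n) y2) - P (Complex (- real n) y2)))
       \<le> (2 * C * (y2 - y1)) * exp (- real n)) sequentially"
    proof (rule always_eventually, rule allI)
      fix n
      have 1: "cmod (P (Complex x y1) - P (Complex x y2)) \<le> (C * exp (- \<bar>x\<bar>)) * \<bar>y1 - y2\<bar>" for x
        by (rule vertical_difference_bound[OF P])
           (use y bd[of "Complex x _"] in \<open>auto simp: closed_segment_eq_real_ivl\<close>)
      have "norm ((P (Complex (real n) y1) - P (Complex (- real n) y1)) - (P (Complex (real n) y2) - P (Complex (- real n) y2)))
         = norm ((P (Complex (real n) y1) - P (Complex (real n) y2)) - (P (Complex (- real n) y1) - P (Complex (- real n) y2)))"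
        by (simp add: algebra_simps)
      also have "\<dots> \<le> (C * exp (- \<bar>real n\<bar>)) * \<bar>y1 - y2\<bar> + (C * exp (- \<bar>- real n\<bar>)) * \<bar>y1 - y2\<bar>"
        by (rule order_trans[OF norm_triangle_ineq4]) (intro add_mono 1)
      also have "\<dots> = (2 * C * (y2 - y1)) * exp (- real n)"
        using y by (simp add: algebra_simps)
      finally show "norm ((P (Complex (real n) y1) - P (Complex (- real n) y1)) - (P (Complex (real n) y2) - P (Complex (- real n) y2)))
       \<le> (2 * C * (y2 - y1)) * exp (- real n)" .
    qed
    show "(\<lambda>n. 2 * C * (y2 - y1) * exp (- real n)) \<longlonglongrightarrow> 0"
      using tendsto_mult_right_zero[OF tendsto_exp_minus_nat] by simp
  qed
  have "(\<lambda>n. (P (Complex (real n) y1) - P (Complex (- real n) y1)) - (P (Complex (real n) y2) - P (Complex (- real n) y2)))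
     \<longlonglongrightarrow> (\<integral>x. f (Complex x y1) \<partial>lborel) - (\<integral>x. f (Complex x y2) \<partial>lborel)"
    by (intro tendsto_diff lim) (use y in auto)
  from LIMSEQ_unique[OF this diff] show ?thesis by simp
qed

lemma cmod_diff_power2: "(cmod (a - b))\<^sup>2 = (cmod a)\<^sup>2 + (cmod b)\<^sup>2 - 2 * Re (a * cnj b)"
  by (simp add: cmod_power2) (simp add: power2_eq_square algebra_simps)

text \<open>
  With $m = (y_1 + y_2)/2$, the function $F(w + im) \overline{F(\bar w + im)}$ is holomorphic; moving its
  line integral to the real axis evaluates the inner product of the two boundary traces.
\<close>

lemma H2_parallelogram:
  assumes holo: "F holomorphic_on hstrip a b" and y: "a < y1" "y1 \<le> y2" "y2 < b"
    and bd: "\<And>w. y1 \<le> Im w \<Longrightarrow> Im w \<le> y2 \<Longrightarrow> cmod (F w) \<le> C * exp (- \<bar>Re w\<bar>)"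
  shows "(\<integral>x. (cmod (F (Complex x y1) - F (Complex x y2)))\<^sup>2 \<partial>lborel)
       = (\<integral>x. (cmod (F (Complex x y1)))\<^sup>2 \<partial>lborel) + (\<integral>x. (cmod (F (Complex x y2)))\<^sup>2 \<partial>lborel)
         - 2 * (\<integral>x. (cmod (F (Complex x ((y1 + y2) / 2))))\<^sup>2 \<partial>lborel)"
proof -
  define m where "m = (y1 + y2) / 2"
  define Y where "Y = (y2 - y1) / 2"
  \<comment> \<open>The half-width of the largest strip symmetric about height \<open>m\<close>
    inside the domain; symmetry is needed because \<open>\<Phi>\<close> also uses the reflected
    point \<open>cnj w\<close>.\<close>
  define d where "d = min (b - m) (m - a)"
  define \<Phi> where "\<Phi> = (\<lambda>w. F (w + Complex 0 m) * cnj (F (cnj w + Complex 0 m)))"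
  have dY: "0 \<le> Y" "Y < d" using y by (auto simp: d_def Y_def m_def field_simps)
  have y12: "y1 = m - Y" "y2 = m + Y" by (auto simp: m_def Y_def field_simps)
  note cont = holomorphic_on_imp_continuous_on[OF holo]
  have meas[measurable]: "(\<lambda>x. F (Complex x y)) \<in> borel_measurable borel" if "y1 \<le> y" "y \<le> y2" for y
    using measurable_hline[OF cont, of y] that y by simp
  have C0: "C \<ge> 0" using bd[of "Complex 0 y1"] y norm_ge_zero[of "F (Complex 0 y1)"] 
    by simp (meson norm_ge_zero order_trans)
  have prod_bd: "cmod (F v) * cmod (F w) \<le> C\<^sup>2 * exp (- \<bar>Re w\<bar>)"
    if "y1 \<le> Im w" "Im w \<le> y2" "y1 \<le> Im v" "Im v \<le> y2" for v w
  proof -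
    have "cmod (F v) \<le> C"
      using bd[of v] that C0 mult_left_mono[of "exp (- \<bar>Re v\<bar>)" 1 C] by auto
    then have "cmod (F v) * cmod (F w) \<le> C * (C * exp (- \<bar>Re w\<bar>))"
      using bd[of w] that C0 by (intro mult_mono) auto
    then show ?thesis by (simp add: power2_eq_square algebra_simps)
  qed
  have int2: "integrable lborel (\<lambda>x. F (Complex x y) * cnj (F (Complex x y')))"
    if "y1 \<le> y" "y \<le> y2" "y1 \<le> y'" "y' \<le> y2" for y y'
  proof (rule integrable_of_exp_bound[where C = "C\<^sup>2"])
    show "(\<lambda>x. F (Complex x y) * cnj (F (Complex x y'))) \<in> borel_measurable borel"
      by (intro borel_measurable_continuous_onI continuous_intros continuous_on_hline[OF cont])
         (use that y in auto)
    show "norm (F (Complex x y) * cnj (F (Complex x y'))) \<le> C\<^sup>2 * exp (- \<bar>x\<bar>)" for x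
      using that prod_bd[of "Complex x y'" "Complex x y"] by (simp add: norm_mult mult.commute)
  qed
  have cnj_eq: "F (Complex x y) * cnj (F (Complex x y)) = of_real ((cmod (F (Complex x y)))\<^sup>2)" for x y
    by (simp add: complex_norm_square[symmetric])
  have int1: "integrable lborel (\<lambda>x. (cmod (F (Complex x y)))\<^sup>2)" if "y1 \<le> y" "y \<le> y2" for y
    using int2[of y y] that unfolding cnj_eq by (simp only: complex_of_real_integrable_eq)
  have holo\<Phi>: "\<Phi> holomorphic_on hstrip (-d) d"
  proof -
    have 1: "(\<lambda>w. F (w + Complex 0 m)) holomorphic_on hstrip (-d) d"
    proof (rule holomorphic_on_compose_gen[OF _ holo, of "\<lambda>w. w + Complex 0 m", unfolded o_def])
      show "(\<lambda>w. w + Complex 0 m) ` hstrip (-d) d \<subseteq> hstrip a b"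
        by (auto simp: hstrip_def d_def)
    qed (intro holomorphic_intros)
    have "cnj ` hstrip (-d) d = hstrip (-d) d"
    proof (intro equalityI subsetI)
      fix w assume "w \<in> hstrip (-d) d"
      then have "cnj w \<in> hstrip (-d) d" "w = cnj (cnj w)" by (auto simp: hstrip_def)
      then show "w \<in> cnj ` hstrip (-d) d" by blast
    qed (auto simp: hstrip_def)
    then have "(cnj \<circ> (\<lambda>w. F (w + Complex 0 m)) \<circ> cnj) holomorphic_on hstrip (-d) d"
      using holomorphic_on_compose_cnj_cnj[of "\<lambda>w. F (w + Complex 0 m)" "hstrip (-d) d"] 1 open_hstrip
      by simp
    then show ?thesis unfolding \<Phi>_def by (intro holomorphic_intros 1) (simp add: o_def)
  qed
  have "(\<integral>x. \<Phi> (Complex x (-Y)) \<partial>lborel) = (\<integral>x. \<Phi> (Complex x 0) \<partial>lborel)"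
  proof (rule line_integral_shift[OF holo\<Phi>, of _ _ "C\<^sup>2"])
    fix w assume "- Y \<le> Im w" "Im w \<le> 0"
    then show "cmod (\<Phi> w) \<le> C\<^sup>2 * exp (- \<bar>Re w\<bar>)"
      using prod_bd[of "cnj w + Complex 0 m" "w + Complex 0 m"] dY
      by (simp add: \<Phi>_def norm_mult y12 mult.commute)
  qed (use dY in auto)
  also have "(\<lambda>x. \<Phi> (Complex x 0)) = (\<lambda>x. of_real ((cmod (F (Complex x m)))\<^sup>2))"
    by (simp add: \<Phi>_def complex_norm_square[symmetric] fun_eq_iff complex_cnj complex_add)
  also have "(\<lambda>x. \<Phi> (Complex x (-Y))) = (\<lambda>x. F (Complex x y1) * cnj (F (Complex x y2)))"
    by (simp add: \<Phi>_def y12 complex_cnj complex_add add.commute)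
  finally have "(\<integral>x. F (Complex x y1) * cnj (F (Complex x y2)) \<partial>lborel) = of_real (\<integral>x. (cmod (F (Complex x m)))\<^sup>2 \<partial>lborel)"
    by (simp only: integral_complex_of_real)
  then have shift: "(\<integral>x. Re (F (Complex x y1) * cnj (F (Complex x y2))) \<partial>lborel) = (\<integral>x. (cmod (F (Complex x m)))\<^sup>2 \<partial>lborel)"
    using integral_Re[OF int2[of y1 y2]] y by simp
  show ?thesis
    unfolding cmod_diff_power2 m_def[symmetric]
    using int1[of y1] int1[of y2] integrable_Re[OF int2[of y1 y2]] y shift
    by (simp del: times_complex.sel)
qed

text \<open>A Bochner integral, hence 0 for a trace that is not integrable. A bound on it says
  something only together with integrability, which is assumed separately wherever it
  matters.\<close>

definition hline_norm :: "(complex \<Rightarrow> complex) \<Rightarrow> real \<Rightarrow> real" where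
  "hline_norm h y = (\<integral>x. cmod (h (Complex x y)) \<partial>lborel)"

text \<open>
  If $P' = h$, then $P(v + s) - P(v)$ is bounded by $K$ for every real $s$, so Cauchy's estimate bounds
  $h(w + s) - h(w)$ by $K/r$; and $h$ comes arbitrarily close to $0$ on the line through $w$.
\<close>

lemma hardy_pointwise_bound:
  assumes holo: "h holomorphic_on hstrip a b"
    and int: "\<And>y. a < y \<Longrightarrow> y < b \<Longrightarrow> integrable lborel (\<lambda>x. h (Complex x y))"
    and K: "\<And>y. a < y \<Longrightarrow> y < b \<Longrightarrow> hline_norm h y \<le> K"
    and r: "r > 0" "a < Im w - r" "Im w + r < b"
  shows "cmod (h w) \<le> K / r"
proof (rule ccontr)
  assume neg: "\<not> cmod (h w) \<le> K / r"
  \<comment> \<open>The excess survives every shift to the right: by \<open>osc\<close> the modulus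
    stays at least \<open>e\<close> on the half-line starting at \<open>w\<close>, so the integral
    over a long enough interval exceeds \<open>hline_norm h (Im w)\<close>.\<close>
  define e where "e = cmod (h w) - K / r"
  have e: "e > 0" using neg by (simp add: e_def)
  obtain P where P: "\<And>w. w \<in> hstrip a b \<Longrightarrow> (P has_field_derivative h w) (at w)"
    using hstrip_primitive[OF holo] by blast
  note cont = holomorphic_on_imp_continuous_on[OF holo]
  have diff: "cmod (P (Complex (x + s) y) - P (Complex x y)) \<le> K" if y: "a < y" "y < b" and s: "s \<ge> 0" for x s y
  proof -
    have m[measurable]: "(\<lambda>x. h (Complex x y)) \<in> borel_measurable borel"
      using measurable_hline[OF cont] y by simp
    have "P (Complex (x + s) y) - P (Complex x y) = (\<integral>t. indicator {x..x+s} t *\<^sub>R h (Complex t y) \<partial>lborel)"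
      by (rule integral_FTC_atLeastAtMost[symmetric])
         (use s y in \<open>auto intro!: has_vector_derivative_at_within[OF has_vector_derivative_hline[OF P]] continuous_on_hline[OF cont]\<close>)
    also have "cmod \<dots> \<le> (\<integral>t. cmod (indicator {x..x+s} t *\<^sub>R h (Complex t y)) \<partial>lborel)"
      by (rule integral_norm_bound)
    also have "\<dots> \<le> hline_norm h y" unfolding hline_norm_def
      by (rule integral_mono')
         (use int[OF y] in \<open>auto split: split_indicator\<close>)
    finally show ?thesis using K[OF y] by simp
  qed
  have osc: "cmod (h (w + of_real s) - h w) \<le> K / r" if s: "s \<ge> 0" for s :: real
  proof -
    define D where "D = (\<lambda>v. P (v + of_real s) - P v)"
    have D: "(D has_field_derivative h (v + of_real s) - h v) (at v)" if "v \<in> hstrip a b" for v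
    proof -
      have "v + of_real s \<in> hstrip a b" using that by (simp add: hstrip_def)
      then have "((\<lambda>v. P (v + of_real s)) has_field_derivative h (v + of_real s)) (at v)"
        using P[of "v + of_real s"] by (simp add: DERIV_shift)
      then show ?thesis unfolding D_def using P[OF that] by (intro derivative_intros)
    qed
    have sub: "cball w r \<subseteq> hstrip a b"
    proof
      fix v assume "v \<in> cball w r"
      then have "\<bar>Im w - Im v\<bar> \<le> r" using abs_Im_le_cmod[of "w - v"] by (simp add: dist_norm)
      then show "v \<in> hstrip a b" using r by (auto simp: hstrip_def)
    qed
    have holD: "D holomorphic_on hstrip a b"
      using D by (auto simp: holomorphic_on_open[OF open_hstrip])
    have "cmod ((deriv ^^ 1) D w) \<le> fact 1 * K / r ^ 1"
    proof (rule Cauchy_inequality)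
      show "D holomorphic_on ball w r" "continuous_on (cball w r) D"
        using holD sub by (meson ball_subset_cball dual_order.trans holomorphic_on_subset)
          (use holD sub in \<open>meson holomorphic_on_imp_continuous_on holomorphic_on_subset\<close>)
      fix v assume "cmod (w - v) = r"
      then have "v \<in> hstrip a b" using sub by (auto simp: dist_norm)
      moreover have "v = Complex (Re v) (Im v)" "v + of_real s = Complex (Re v + s) (Im v)"
        by (auto simp: complex_eq_iff)
      ultimately show "cmod (D v) \<le> K"
        using diff[of "Im v" s "Re v"] s by (simp add: D_def hstrip_def)
    qed (use r in auto)
    moreover have "deriv D w = h (w + of_real s) - h w"
      using sub r by (intro DERIV_imp_deriv D) auto
    ultimately show ?thesis by simp
  qed
  have low: "cmod (h (Complex x (Im w))) \<ge> e" if "x \<ge> Re w" for x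
  proof -
    have "w + of_real (x - Re w) = Complex x (Im w)" by (simp add: complex_eq_iff)
    then have "cmod (h (Complex x (Im w)) - h w) \<le> K / r" using osc[of "x - Re w"] that by simp
    then show ?thesis unfolding e_def
      using norm_triangle_ineq2[of "h w" "h (Complex x (Im w))"] by (simp add: norm_minus_commute)
  qed
  have yw: "a < Im w" "Im w < b" using r by auto
  obtain n :: nat where n: "hline_norm h (Im w) / e < real n" using reals_Archimedean2 by blast
  have "real n * e = (\<integral>x. e * indicator {Re w..Re w + real n} x \<partial>lborel)"
    by simp
  also have "\<dots> \<le> hline_norm h (Im w)" unfolding hline_norm_def
    by (rule integral_mono') (use int[OF yw] low e in \<open>auto split: split_indicator\<close>)
  finally show False using n e by (simp add: field_simps)
qed

section \<open>Approximate outer functions\<close>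

text \<open>On the unit circle \<open>z * cnj z = 1\<close>, so splitting off both constant
  coefficients leaves the same problem for the two quotients; the cross terms are polynomials up to
  a conjugation, which the real part does not see. This closes the real parts of polynomials under
  multiplication.\<close>

lemma poly_times_cnj_poly_on_circle:
  fixes p q :: "complex poly"
  shows "\<exists>r. \<forall>z. cmod z = 1 \<longrightarrow> Re (poly p z * cnj (poly q z)) = Re (poly r z)"
proof (induction p arbitrary: q)
  case 0
  show ?case by (intro exI[of _ 0]) simp
next
  case (pCons a p)
  obtain b q' where q: "q = pCons b q'" by (cases q)
  obtain r where r: "\<And>z. cmod z = 1 \<Longrightarrow> Re (poly p z * cnj (poly q' z)) = Re (poly r z)"
    using pCons.IH by blast
  show ?case
  proof (intro exI allI impI)
    fix z :: complex assume z: "cmod z = 1"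
    then have zz: "z * cnj z = 1" using complex_norm_square[of z] by simp
    have "poly (pCons a p) z * cnj (poly q z) = a * cnj b + cnj (cnj a * (z * poly q' z))
        + cnj b * (z * poly p z) + (z * cnj z) * (poly p z * cnj (poly q' z))"
      unfolding q by (simp add: algebra_simps)
    then have "Re (poly (pCons a p) z * cnj (poly q z)) = Re (a * cnj b) + Re (cnj a * (z * poly q' z))
        + Re (cnj b * (z * poly p z)) + Re (poly p z * cnj (poly q' z))"
      unfolding zz by (simp only: plus_complex.sel complex_cnj(1) mult_1_left) (simp add: algebra_simps)
    also have "\<dots> = Re (poly ([:a * cnj b:] + smult (cnj a) (pCons 0 q') + smult (cnj b) (pCons 0 p) + r) z)"
      unfolding r[OF z] by (simp add: algebra_simps)
    finally show "Re (poly (pCons a p) z * cnj (poly q z))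
        = Re (poly ([:a * cnj b:] + smult (cnj a) (pCons 0 q') + smult (cnj b) (pCons 0 p) + r) z)" .
  qed
qed

text \<open>Real parts of polynomials on the circle are the real trigonometric polynomials, and
  Stone-Weierstrass applies. The form \<open>Re (poly p z)\<close> is kept because the polynomial is
  defined and bounded on the whole disc, which stands in for a harmonic extension and its
  conjugate.\<close>

lemma Weierstrass_circle:
  fixes b :: "complex \<Rightarrow> real"
  assumes b: "continuous_on (sphere 0 1) b" and e: "e > 0"
  obtains p :: "complex poly" where "\<And>z. cmod z = 1 \<Longrightarrow> \<bar>b z - Re (poly p z)\<bar> < e"
proof -
  define R where "R = {u::complex \<Rightarrow> real. \<exists>p. \<forall>z. cmod z = 1 \<longrightarrow> u z = Re (poly p z)}"
  interpret function_ring_on R "sphere 0 1"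
  proof
    fix f assume "f \<in> R"
    then obtain p where p: "\<And>z. cmod z = 1 \<Longrightarrow> f z = Re (poly p z)" by (auto simp: R_def)
    show "continuous_on (sphere 0 1) f"
      by (subst continuous_on_cong[OF refl, of _ _ "\<lambda>z. Re (poly p z)"])
         (auto simp: p intro!: continuous_intros)
  next
    fix f g assume "f \<in> R" "g \<in> R"
    then obtain p q where p: "\<And>z. cmod z = 1 \<Longrightarrow> f z = Re (poly p z)"
      and q: "\<And>z. cmod z = 1 \<Longrightarrow> g z = Re (poly q z)" by (auto simp: R_def)
    show "(\<lambda>x. f x + g x) \<in> R" unfolding R_def
      by (rule CollectI, rule exI[of _ "p + q"]) (simp add: p q)
    obtain r where r: "\<And>z. cmod z = 1 \<Longrightarrow> Re (poly p z * cnj (poly q z)) = Re (poly r z)"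
      using poly_times_cnj_poly_on_circle by blast
    \<comment> \<open>The first term is a product of polynomials, the second is covered by the
      circle identity.\<close>
    have "Re u * Re v = Re (1/2 * (u * v + u * cnj v))" for u v by simp
    then show "(\<lambda>x. f x * g x) \<in> R" unfolding R_def
      by (intro CollectI exI[of _ "smult (1/2) (p * q + r)"]) (simp add: p q r[symmetric])
  next
    show "(\<lambda>_. c) \<in> R" for c unfolding R_def
      by (intro CollectI exI[of _ "[:of_real c:]"]) simp
  next
    fix x y :: complex assume "x \<noteq> y"
    moreover have "Re \<in> R" unfolding R_def by (intro CollectI exI[of _ "[:0, 1:]"]) simp
    moreover have "Im \<in> R" unfolding R_def by (intro CollectI exI[of _ "[:0, -\<i>:]"]) simp
    ultimately show "\<exists>f\<in>R. f x \<noteq> f y" by (auto simp: complex_eq_iff)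
  qed simp
  from Stone_Weierstrass_basic[OF b e] obtain g where g: "g \<in> R" "\<And>x. x \<in> sphere 0 1 \<Longrightarrow> \<bar>b x - g x\<bar> < e"
    by blast
  from g(1) obtain p where p: "\<And>z. cmod z = 1 \<Longrightarrow> g z = Re (poly p z)" by (auto simp: R_def)
  show ?thesis using g(2) p by (intro that[of p]) auto
qed

text \<open>
  The map $T = \tanh(\pi (w - im)/(4Y))$ takes the closed strip, with its two ends added, to the closed
  unit disc. The approximant is a polynomial in $T$.
\<close>

lemma approximate_harmonic_on_strip:
  fixes u :: "complex \<Rightarrow> real"
  assumes y: "y1 < y2" and u: "continuous_on {w. Im w = y1 \<or> Im w = y2} u"
    and lim: "\<And>e. e > 0 \<Longrightarrow> \<exists>R. \<forall>w. (Im w = y1 \<or> Im w = y2) \<and> \<bar>Re w\<bar> > R \<longrightarrow> \<bar>u w - l\<bar> < e"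
    and e: "e > 0"
  obtains A a b B where "a < y1" "y2 < b" "A holomorphic_on hstrip a b"
    "\<And>w. y1 \<le> Im w \<Longrightarrow> Im w \<le> y2 \<Longrightarrow> cmod (A w) \<le> B"
    "\<And>w. Im w = y1 \<or> Im w = y2 \<Longrightarrow> \<bar>u w - Re (A w)\<bar> < e"
proof -
  define m where "m = (y1 + y2) / 2"
  define Y where "Y = (y2 - y1) / 2"
  have Y: "Y > 0" and y12: "y1 = m - Y" "y2 = m + Y" using y by (auto simp: m_def Y_def field_simps)
  \<comment> \<open>The scaling sends the two lines to imaginary parts -pi/2 and pi/2. Then
    \<open>E\<close> maps the strip to the right half-plane, the Cayley transform \<open>T\<close>
    takes it to the disc, \<open>Q\<close> inverts the Cayley transform, and \<open>S\<close> undoes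
    \<open>T\<close> on the two lines.\<close>
  define \<theta> where "\<theta> = (\<lambda>w. of_real (pi / (2 * Y)) * (w - Complex 0 m))"
  define E where "E = (\<lambda>w. exp (\<theta> w))"
  define T where "T = (\<lambda>w. (E w - 1) / (E w + 1))"
  define Q where "Q = (\<lambda>z::complex. (1 + z) / (1 - z))"
  define S where "S = (\<lambda>z. Complex 0 m + of_real (2 * Y / pi) * Ln (Q z))"
  \<comment> \<open>The points 1 and -1 are the images of the two ends of the strip. Giving
    \<open>b\<close> the common limit \<open>l\<close> there is what makes it continuous on the
    whole circle.\<close>
  define b where "b = (\<lambda>z. if z = 1 \<or> z = -1 then l else u (S z))"
  have Im\<theta>: "Im (\<theta> w) = pi / (2 * Y) * (Im w - m)" for w
    by (simp add: \<theta>_def)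
  have ReE: "Re (E w) = exp (Re (\<theta> w)) * cos (Im (\<theta> w))" for w
    by (simp add: E_def Re_exp)
  have Epos: "Re (E w) > 0" if "\<bar>Im w - m\<bar> < Y" for w
  proof -
    have "\<bar>Im (\<theta> w)\<bar> < pi / (2 * Y) * Y"
      using mult_strict_left_mono[OF that, of "pi / (2 * Y)"] Y by (simp add: Im\<theta> abs_mult)
    then have "\<bar>Im (\<theta> w)\<bar> < pi / 2" using Y by simp
    then show ?thesis unfolding ReE using cos_gt_zero_pi[of "Im (\<theta> w)"] by (simp add: abs_less_iff)
  qed
  have Im\<theta>_line: "Im (\<theta> w) = pi/2 \<or> Im (\<theta> w) = -(pi/2)" if "Im w = y1 \<or> Im w = y2" for w
    unfolding Im\<theta> using that Y by (auto simp: y12)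
  have E0: "Re (E w) = 0" if "Im w = y1 \<or> Im w = y2" for w
    unfolding ReE using Im\<theta>_line[OF that] by (metis cos_minus cos_pi_half mult_zero_right)
  have Ege: "Re (E w) \<ge> 0" if "y1 \<le> Im w" "Im w \<le> y2" for w
    using Epos[of w] E0[of w] that by (cases "\<bar>Im w - m\<bar> < Y") (force simp: y12)+
  have cmodT: "cmod (E w - 1) \<le> cmod (E w + 1)" if "Re (E w) \<ge> 0" for w
    using that by (simp add: cmod_def power2_eq_square algebra_simps)
  have T_le: "cmod (T w) \<le> 1" if "y1 \<le> Im w" "Im w \<le> y2" for w
    unfolding T_def norm_divide using cmodT[OF Ege[OF that]]
    by (simp add: divide_le_eq)
  have T_line: "cmod (T w) = 1" if "Im w = y1 \<or> Im w = y2" for w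
  proof -
    have "Im (E w) \<noteq> 0"
      using E0[OF that] exp_not_eq_zero[of "\<theta> w"] by (auto simp: E_def complex_eq_iff)
    then have "E w + 1 \<noteq> 0" by (auto simp: complex_eq_iff)
    moreover have "cmod (E w - 1) = cmod (E w + 1)"
      using E0[OF that] by (simp add: cmod_def)
    ultimately show ?thesis by (simp add: T_def norm_divide)
  qed
  \<comment> \<open>A zero needs \<open>Im (\<theta> w)\<close> to be an odd multiple of pi, but it
    is below pi in modulus on the strip of doubled width. So \<open>T\<close> is holomorphic beyond
    the two lines.\<close>
  have E1: "E w + 1 \<noteq> 0" if "w \<in> hstrip (m - 2 * Y) (m + 2 * Y)" for w
  proof
    assume "E w + 1 = 0"
    then have "exp (\<theta> w) = -1" by (simp add: E_def add_eq_0_iff2)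
    then have "exp (\<theta> w - \<i> * of_real pi) = 1" by (simp add: exp_diff)
    then obtain n :: int where n: "Im (\<theta> w - \<i> * of_real pi) = of_int (2 * n) * pi"
      unfolding exp_eq_1 by blast
    have "\<bar>Im w - m\<bar> < 2 * Y" using that by (auto simp: hstrip_def)
    then have "\<bar>Im (\<theta> w)\<bar> < pi / (2 * Y) * (2 * Y)"
      using mult_strict_left_mono[of "\<bar>Im w - m\<bar>" "2 * Y" "pi / (2 * Y)"] Y by (simp add: Im\<theta> abs_mult)
    then have I: "\<bar>Im (\<theta> w)\<bar> < pi" using Y by simp
    have I2: "Im (\<theta> w) = of_int (2 * n + 1) * pi" using n by (simp add: algebra_simps)
    have "\<bar>real_of_int (2 * n + 1)\<bar> * pi < 1 * pi" using I unfolding I2 abs_mult by simp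
    then have "\<bar>real_of_int (2 * n + 1)\<bar> < 1" using pi_gt_zero mult_less_cancel_right_pos by blast
    then have "\<bar>2 * n + 1\<bar> < 1" by (metis of_int_abs of_int_less_1_iff)
    then show False by presburger
  qed
  have TS: "S (T w) = w \<and> T w \<noteq> 1 \<and> T w \<noteq> -1" if "Im w = y1 \<or> Im w = y2" for w
  proof -
    have 1: "E w + 1 \<noteq> 0" using E1[of w] that Y by (auto simp: hstrip_def y12)
    have Ene: "E w \<noteq> 0" by (simp add: E_def)
    have T1: "T w \<noteq> 1" using 1 by (simp add: T_def divide_eq_eq)
    have T2: "T w \<noteq> -1"
    proof
      assume "T w = -1"
      then have "E w - 1 = - (E w + 1)" using 1 by (simp add: T_def divide_eq_eq)
      then have "2 * E w = 0" by algebra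
      then show False using Ene by simp
    qed
    have "Q (T w) = E w"
    proof -
      have "1 + T w = 2 * E w / (E w + 1)" "1 - T w = 2 / (E w + 1)"
        using 1 by (auto simp: T_def field_simps)
      then show ?thesis using 1 by (simp add: Q_def)
    qed
    moreover have "Ln (E w) = \<theta> w" unfolding E_def
      by (rule Ln_exp) (use Im\<theta>_line[OF that] pi_gt_zero in linarith)+
    ultimately have "Ln (Q (T w)) = \<theta> w" by simp
    then have "S (T w) = w" using Y by (simp add: S_def \<theta>_def)
    with T1 T2 show ?thesis by simp
  qed
  have Qcirc: "Re (Q z) = 0 \<and> Im (Q z) \<noteq> 0" if "cmod z = 1" "z \<noteq> 1" "z \<noteq> -1" for z
  proof -
    have "Re z * Re z + Im z * Im z = 1" using that(1)
      by (metis cmod_power2 one_power2 power2_eq_square)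
    then have "Re (Q z) = 0" by (simp add: Q_def Re_divide algebra_simps)
    moreover have "Q z \<noteq> 0" using that by (simp add: Q_def add_eq_0_iff)
    ultimately show ?thesis by (auto simp: complex_eq_iff)
  qed
  have Q0: "Q z \<noteq> 0" if "cmod z = 1" "z \<noteq> 1" "z \<noteq> -1" for z using Qcirc[OF that] by auto
  have ReS: "Re (S z) = 2 * Y / pi * ln (cmod (Q z))" if "cmod z = 1" "z \<noteq> 1" "z \<noteq> -1" for z
    using Q0[OF that] by (simp add: S_def)
  have ImS: "Im (S z) = y1 \<or> Im (S z) = y2" if "cmod z = 1" "z \<noteq> 1" "z \<noteq> -1" for z
  proof -
    have "\<bar>Im (Ln (Q z))\<bar> = pi / 2" using Qcirc[OF that] Re_Ln_pos_lt[OF Q0[OF that]]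
      by (metis Re_Ln_pos_le Im_Ln_pos_le Q0[OF that] abs_of_nonneg abs_minus_cancel order_refl less_irrefl le_less)
    then have "Im (Ln (Q z)) = pi/2 \<or> Im (Ln (Q z)) = -(pi/2)" by linarith
    moreover have "Im (S z) = m + 2 * Y / pi * Im (Ln (Q z))" by (simp add: S_def)
    ultimately have "Im (S z) = m + 2 * Y / pi * (pi / 2) \<or> Im (S z) = m + 2 * Y / pi * (- (pi / 2))"
      by metis
    then show ?thesis by (auto simp: y12)
  qed
  have cont_b: "continuous_on (sphere 0 1) b"
  proof -
    have lim1: "(b \<longlongrightarrow> l) (at s within sphere 0 1)" if s: "s = 1 \<or> s = -1" for s
    proof (rule tendstoI)
      fix e :: real assume "e > 0"
      then obtain R where R: "\<And>w. (Im w = y1 \<or> Im w = y2) \<Longrightarrow> \<bar>Re w\<bar> > R \<Longrightarrow> \<bar>u w - l\<bar> < e" using lim by blast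
      \<comment> \<open>The value of \<open>cmod (Q z)\<close> at which \<open>Re (S z) = R\<close>.
        The condition \<open>B * cmod (1 - s * z) < cmod (1 + s * z)\<close> means
        \<open>cmod (Q z) > B\<close> for \<open>s = 1\<close> and \<open>cmod (Q z) < 1 / B\<close>
        for \<open>s = -1\<close>, so one sign parameter treats both ends.\<close>
      define B where "B = exp (pi / (2 * Y) * R)"
      have B: "B > 0" by (simp add: B_def)
      have "((\<lambda>z. cmod (1 + s * z) - B * cmod (1 - s * z)) \<longlongrightarrow> cmod (1 + s * s) - B * cmod (1 - s * s)) (at s within sphere 0 1)"
        by (intro tendsto_intros)
      moreover have "cmod (1 + s * s) - B * cmod (1 - s * s) > 0" using s by auto
      ultimately have "eventually (\<lambda>z. cmod (1 + s * z) - B * cmod (1 - s * z) > 0) (at s within sphere 0 1)"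
        by (rule order_tendstoD)
      moreover have "eventually (\<lambda>z. z \<in> sphere 0 1) (at s within sphere 0 1)"
        by (simp add: eventually_at_filter)
      ultimately show "eventually (\<lambda>z. dist (b z) l < e) (at s within sphere 0 1)"
      proof eventually_elim
        fix z assume z: "cmod (1 + s * z) - B * cmod (1 - s * z) > 0" "z \<in> sphere 0 1"
        show "dist (b z) l < e"
        proof (cases "z = 1 \<or> z = -1")
          case True then show ?thesis using \<open>e > 0\<close> by (simp add: b_def)
        next
          case False
          then have c: "cmod z = 1" "z \<noteq> 1" "z \<noteq> -1" using z by auto
          have pos: "cmod (1 - z) > 0" "cmod (1 + z) > 0" using c by (auto simp: add_eq_0_iff)
          have lnQ: "ln (cmod (Q z)) = ln (cmod (1 + z)) - ln (cmod (1 - z))"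
            using pos by (simp add: Q_def norm_divide ln_div)
          have "\<bar>ln (cmod (Q z))\<bar> > ln B"
          proof (cases "s = 1")
            case True
            then have "B * cmod (1 - z) < cmod (1 + z)" using z by simp
            then have "ln (B * cmod (1 - z)) < ln (cmod (1 + z))" using B pos by (subst ln_less_cancel_iff) auto
            then show ?thesis unfolding lnQ using B pos by (simp add: ln_mult)
          next
            case False
            then have "B * cmod (1 + z) < cmod (1 - z)" using z s by simp
            then have "ln (B * cmod (1 + z)) < ln (cmod (1 - z))" using B pos by (subst ln_less_cancel_iff) auto
            then show ?thesis unfolding lnQ using B pos by (simp add: ln_mult)
          qed
          then have "2 * Y / pi * \<bar>ln (cmod (Q z))\<bar> > 2 * Y / pi * (pi / (2 * Y) * R)"
            using Y by (intro mult_strict_left_mono) (auto simp: B_def)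
          moreover have "2 * Y / pi * (pi / (2 * Y) * R) = R" using Y by simp
          moreover have "\<bar>Re (S z)\<bar> = 2 * Y / pi * \<bar>ln (cmod (Q z))\<bar>"
            unfolding ReS[OF c] abs_mult using Y by simp
          ultimately have "\<bar>Re (S z)\<bar> > R" by simp
          then show ?thesis using R[OF ImS[OF c]] c by (simp add: b_def dist_real_def)
        qed
      qed
    qed
    have "continuous (at s within sphere 0 1) b" if s: "s \<in> sphere 0 1" for s
    proof (cases "s = 1 \<or> s = -1")
      case True
      then show ?thesis using lim1[of s] by (auto simp: continuous_within b_def)
    next
      case False
      let ?U = "sphere 0 1 - {1, -1} :: complex set"
      have "continuous_on ?U (\<lambda>z. u (S z))"
      proof (rule continuous_on_compose2[OF u])
        show "continuous_on ?U S" unfolding S_def Q_def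
        proof (intro continuous_intros)
          show "\<forall>x\<in>?U. 1 - x \<noteq> 0" by auto
          fix z assume "z \<in> ?U"
          then have "cmod z = 1" "z \<noteq> 1" "z \<noteq> -1" by auto
          from Qcirc[OF this] show "(1 + z) / (1 - z) \<notin> \<real>\<^sub>\<le>\<^sub>0"
            by (auto simp: Q_def complex_nonpos_Reals_iff)
        qed
        show "S ` ?U \<subseteq> {w. Im w = y1 \<or> Im w = y2}"
        proof (rule image_subsetI)
          fix z assume "z \<in> ?U"
          then show "S z \<in> {w. Im w = y1 \<or> Im w = y2}" using ImS[of z] by simp
        qed
      qed
      then have "continuous_on ?U b"
        by (rule continuous_on_cong[THEN iffD1, rotated 2]) (auto simp: b_def)
      then have "continuous (at s within ?U) b" using False s by (auto simp: continuous_on_eq_continuous_within)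
      moreover have "at s within ?U = at s within sphere 0 1"
        by (rule at_within_nhd[of _ "- {1,-1}"]) (use False in \<open>auto intro!: open_Compl finite_imp_closed\<close>)
      ultimately show ?thesis by simp
    qed
    then show ?thesis by (simp add: continuous_on_eq_continuous_within)
  qed
  obtain p where p: "\<And>z. cmod z = 1 \<Longrightarrow> \<bar>b z - Re (poly p z)\<bar> < e"
    using Weierstrass_circle[OF cont_b e] by blast
  have "compact (poly p ` cball 0 1)"
    by (intro compact_continuous_image continuous_intros) auto
  then have "bounded (poly p ` cball 0 1)" by (rule compact_imp_bounded)
  then obtain B where B: "\<And>z. cmod z \<le> 1 \<Longrightarrow> cmod (poly p z) \<le> B"
    unfolding bounded_iff by (metis image_eqI mem_cball_0)
  show ?thesis
  proof (rule that[of "m - 2 * Y" "m + 2 * Y" "\<lambda>w. poly p (T w)" B])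
    have "T holomorphic_on hstrip (m - 2 * Y) (m + 2 * Y)"
      unfolding T_def using E1 by (intro holomorphic_intros) (auto simp: E_def \<theta>_def intro!: holomorphic_intros)
    moreover have "poly p holomorphic_on UNIV" by (intro holomorphic_intros)
    ultimately show "(\<lambda>w. poly p (T w)) holomorphic_on hstrip (m - 2 * Y) (m + 2 * Y)"
      using holomorphic_on_compose_gen[of T _ "poly p" UNIV] by (auto simp: o_def)
    show "\<bar>u w - Re (poly p (T w))\<bar> < e" if "Im w = y1 \<or> Im w = y2" for w
      using p[OF T_line[OF that]] TS[OF that] by (simp add: b_def)
  qed (use Y B T_le in \<open>auto simp: y12\<close>)
qed

text \<open>Completing the square: the maximum of \<open>\<bar>x\<bar> - \<alpha> * x^2\<close> is
  \<open>1 / (4 * \<alpha>)\<close>. It converts Gaussian damping into the decay exp(-|Re w|) in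
  which the line lemmas are stated.\<close>

lemma gauss_le_exp_abs:
  fixes \<alpha> x :: real assumes "\<alpha> > 0"
  shows "exp (- (\<alpha> * x\<^sup>2)) \<le> exp (1 / (4 * \<alpha>)) * exp (- \<bar>x\<bar>)"
proof -
  have "\<alpha> * x\<^sup>2 - \<bar>x\<bar> + 1 / (4 * \<alpha>) = \<alpha> * (\<bar>x\<bar> - 1 / (2 * \<alpha>))\<^sup>2"
    using assms by (simp add: power2_diff power2_eq_square algebra_simps)
  also have "\<dots> \<ge> 0" using assms by simp
  finally have "- (\<alpha> * x\<^sup>2) \<le> 1 / (4 * \<alpha>) + - \<bar>x\<bar>" by simp
  then show ?thesis unfolding exp_add[symmetric] by simp
qed

lemma cmod_exp_gauss: "cmod (exp (- (of_real c * w\<^sup>2))) = exp (c * (Im w)\<^sup>2) * exp (- (c * (Re w)\<^sup>2))"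
  by (simp add: power2_eq_square algebra_simps flip: exp_add)

text \<open>
  $G$ is an approximate outer function with $|G|^2 \approx |h| + \eta\, |e^{-\delta w^2}|$ on the boundary
  lines; it has no zeros, so that no Blaschke products are needed.
\<close>

lemma hardy_factorization:
  assumes holo: "k holomorphic_on hstrip a b" and y: "a < y1" "y1 < y2" "y2 < b"
    and B: "\<And>w. y1 \<le> Im w \<Longrightarrow> Im w \<le> y2 \<Longrightarrow> cmod (k w) \<le> B"
    and d: "\<delta> > 0" and \<eta>: "\<eta> > 0"
    and h: "\<And>w. h w = k w * exp (- (of_real (2 * \<delta>) * w\<^sup>2))"
  obtains F G a' b' C where "a' < y1" "y2 < b'" "F holomorphic_on hstrip a' b'" "G holomorphic_on hstrip a' b'"
    "\<And>w. w \<in> hstrip a' b' \<Longrightarrow> h w = F w * G w"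
    "\<And>w. y1 \<le> Im w \<Longrightarrow> Im w \<le> y2 \<Longrightarrow> cmod (F w) \<le> C * exp (- \<bar>Re w\<bar>)"
    "\<And>w. y1 \<le> Im w \<Longrightarrow> Im w \<le> y2 \<Longrightarrow> cmod (G w) \<le> C * exp (- \<bar>Re w\<bar>)"
    "\<And>w. Im w = y1 \<or> Im w = y2 \<Longrightarrow> (cmod (F w))\<^sup>2 \<le> cmod (h w)"
    "\<And>w. Im w = y1 \<or> Im w = y2 \<Longrightarrow> (cmod (G w))\<^sup>2 \<le> (1 + \<eta>) * (cmod (h w) + \<eta> * cmod (exp (- (of_real \<delta> * w\<^sup>2))))"
proof -
  define q where "q = (\<lambda>w::complex. exp (- (of_real \<delta> * w\<^sup>2)))"
  \<comment> \<open>Chosen so that \<open>exp (2 * \<epsilon>) = 1 + \<eta>\<close>, the factor lost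
    between \<open>(cmod (G w))^2\<close> and its target.\<close>
  define \<epsilon> where "\<epsilon> = ln (1 + \<eta>) / 2"
  \<comment> \<open>Adding \<open>\<eta>\<close> keeps the logarithm finite at zeros of
    \<open>k\<close> and gives it the limit \<open>ln \<eta>\<close> at both ends of each line. One
    of the two factors \<open>q\<close> of \<open>h\<close> is held back: its logarithm tends to
    minus infinity at the ends, and it is supplied exactly, not approximately, in
    \<open>G\<close>.\<close>
  define u where "u = (\<lambda>w. ln (cmod (k w * q w) + \<eta>))"
  define Q where "Q = y1\<^sup>2 + y2\<^sup>2"
  have \<epsilon>: "\<epsilon> > 0" using \<eta> by (simp add: \<epsilon>_def)
  have hq: "h w = k w * q w * q w" for w
    by (simp add: h q_def mult.assoc flip: exp_add)
  have q0: "q w \<noteq> 0" for w by (simp add: q_def)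
  have cmodq: "cmod (q w) = exp (\<delta> * (Im w)\<^sup>2) * exp (- (\<delta> * (Re w)\<^sup>2))" for w
    unfolding q_def by (rule cmod_exp_gauss)
  have ImQ: "(Im w)\<^sup>2 \<le> Q" if "y1 \<le> Im w" "Im w \<le> y2" for w
  proof -
    have "\<bar>Im w\<bar> \<le> \<bar>y1\<bar> \<or> \<bar>Im w\<bar> \<le> \<bar>y2\<bar>" using that by linarith
    then have "(Im w)\<^sup>2 \<le> y1\<^sup>2 \<or> (Im w)\<^sup>2 \<le> y2\<^sup>2" by (simp add: abs_le_square_iff)
    then show ?thesis unfolding Q_def using zero_le_power2[of y1] zero_le_power2[of y2] by linarith
  qed
  have dQ: "\<delta> * (Im w)\<^sup>2 \<le> \<delta> * Q" if "y1 \<le> Im w" "Im w \<le> y2" for w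
    using mult_left_mono[OF ImQ[OF that], of \<delta>] d by simp
  have B0: "B \<ge> 0" using order_trans[OF norm_ge_zero B[of "Complex 0 y1"]] y by simp
  have q_le: "cmod (q w) \<le> exp (\<delta> * Q) * exp (- (\<delta> * (Re w)\<^sup>2))" if "y1 \<le> Im w" "Im w \<le> y2" for w
    unfolding cmodq using ImQ[OF that] d by (intro mult_right_mono) auto
  have cont_u: "continuous_on {w. Im w = y1 \<or> Im w = y2} u"
  proof -
    have "continuous_on {w. Im w = y1 \<or> Im w = y2} k"
      using holomorphic_on_imp_continuous_on[OF holo]
      by (rule continuous_on_subset) (use y in \<open>auto simp: hstrip_def\<close>)
    moreover have "cmod x + \<eta> \<noteq> 0" for x :: complex
      using norm_ge_zero[of x] \<eta> by linarith
    ultimately show ?thesis unfolding u_def q_def by (intro continuous_intros) auto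
  qed
  have lim_u: "\<exists>R. \<forall>w. (Im w = y1 \<or> Im w = y2) \<and> \<bar>Re w\<bar> > R \<longrightarrow> \<bar>u w - ln \<eta>\<bar> < e" if e: "e > 0" for e
  proof -
    have "((\<lambda>t. ln (t + \<eta>)) \<longlongrightarrow> ln (0 + \<eta>)) (nhds 0)"
      using \<eta> by (intro tendsto_intros) (auto simp: filterlim_ident)
    then have "eventually (\<lambda>t. dist (ln (t + \<eta>)) (ln \<eta>) < e) (nhds 0)"
      using e by (simp add: tendsto_iff)
    then obtain r where r: "r > 0" "\<And>t. \<bar>t\<bar> < r \<Longrightarrow> \<bar>ln (t + \<eta>) - ln \<eta>\<bar> < e"
      unfolding eventually_nhds_metric by (auto simp: dist_real_def)
    define D where "D = B * exp (\<delta> * Q) * exp (1 / (4 * \<delta>))"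
    have D0: "D \<ge> 0" using B0 by (simp add: D_def)
    have small: "cmod (k w * q w) < r" if w: "Im w = y1 \<or> Im w = y2" and R: "\<bar>Re w\<bar> > ln ((D + 1) / r)" for w
    proof -
      have w': "y1 \<le> Im w" "Im w \<le> y2" using w y by auto
      have "cmod (k w * q w) \<le> B * (exp (\<delta> * Q) * exp (- (\<delta> * (Re w)\<^sup>2)))"
        unfolding norm_mult by (intro mult_mono B[OF w'] q_le[OF w'] B0) auto
      also have "\<dots> \<le> B * (exp (\<delta> * Q) * (exp (1 / (4 * \<delta>)) * exp (- \<bar>Re w\<bar>)))"
        using gauss_le_exp_abs[OF d] B0 by (intro mult_left_mono) auto
      also have "\<dots> = D * exp (- \<bar>Re w\<bar>)" by (simp add: D_def)
      also have "\<dots> < (D + 1) * exp (- \<bar>Re w\<bar>)" by simp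
      also have "\<dots> \<le> (D + 1) * exp (- ln ((D + 1) / r))" using R D0 by (intro mult_left_mono) auto
      also have "\<dots> = r" using D0 r(1) by (simp add: exp_minus)
      finally show ?thesis .
    qed
    show ?thesis
    proof (intro exI allI impI)
      fix w assume "(Im w = y1 \<or> Im w = y2) \<and> \<bar>Re w\<bar> > ln ((D + 1) / r)"
      then have "cmod (k w * q w) < r" using small by blast
      then show "\<bar>u w - ln \<eta>\<bar> < e" using r(2)[of "cmod (k w * q w)"] by (simp add: u_def)
    qed
  qed
  from approximate_harmonic_on_strip[OF y(2) cont_u lim_u \<epsilon>]
  obtain A a1 b1 B1 where A: "a1 < y1" "y2 < b1" "A holomorphic_on hstrip a1 b1"
    and AB: "\<And>w. y1 \<le> Im w \<Longrightarrow> Im w \<le> y2 \<Longrightarrow> cmod (A w) \<le> B1"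
    and Au: "\<And>w. Im w = y1 \<or> Im w = y2 \<Longrightarrow> \<bar>u w - Re (A w)\<bar> < \<epsilon>" by metis
  define a' where "a' = max a a1"
  define b' where "b' = min b b1"
  \<comment> \<open>The shift by \<open>\<epsilon>\<close> makes the error one-sided:
    \<open>Re (A w) + \<epsilon>\<close> lies between \<open>u w\<close> and
    \<open>u w + 2 * \<epsilon>\<close>, hence \<open>cmod (h w) \<le> (cmod (G w))^2\<close> on the
    two lines. This yields the bound on \<open>F = h / G\<close> without any loss.\<close>
  define G where "G = (\<lambda>w. exp ((A w + of_real \<epsilon> - of_real \<delta> * w\<^sup>2) / 2))"
  define F where "F = (\<lambda>w. h w / G w)"
  have sub: "hstrip a' b' \<subseteq> hstrip a b" "hstrip a' b' \<subseteq> hstrip a1 b1"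
    by (auto simp: hstrip_def a'_def b'_def)
  have G0: "G w \<noteq> 0" for w by (simp add: G_def)
  have G_holo: "G holomorphic_on hstrip a' b'"
    unfolding G_def using A(3) sub(2) by (intro holomorphic_intros) (auto intro: holomorphic_on_subset)
  have "h holomorphic_on hstrip a' b'"
    unfolding h using holo sub(1) by (intro holomorphic_intros) (auto intro: holomorphic_on_subset)
  then have F_holo: "F holomorphic_on hstrip a' b'"
    unfolding F_def using G_holo G0 by (intro holomorphic_intros) auto
  have G2: "(cmod (G w))\<^sup>2 = exp (Re (A w) + \<epsilon>) * cmod (q w)" for w
  proof -
    have "(G w)\<^sup>2 = exp (A w + of_real \<epsilon>) * q w"
      by (simp add: G_def q_def power2_eq_square flip: exp_add)
    then show ?thesis by (metis norm_power norm_mult norm_exp_eq_Re plus_complex.sel(1) Re_complex_of_real)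
  qed
  have Gabs: "cmod (G w) = exp ((Re (A w) + \<epsilon> + \<delta> * (Im w)\<^sup>2 - \<delta> * (Re w)\<^sup>2) / 2)" for w
    by (simp add: G_def power2_eq_square algebra_simps)
  have ReA: "\<bar>Re (A w)\<bar> \<le> B1" if "y1 \<le> Im w" "Im w \<le> y2" for w
    using AB[OF that] abs_Re_le_cmod[of "A w"] by linarith
  define CG where "CG = exp ((B1 + \<epsilon> + \<delta> * Q) / 2) * exp (1 / (4 * (\<delta> / 2)))"
  define CF where "CF = B * exp (2 * \<delta> * Q + B1 / 2) * exp (1 / (4 * \<delta>))"
  have Gbd: "cmod (G w) \<le> CG * exp (- \<bar>Re w\<bar>)" if w: "y1 \<le> Im w" "Im w \<le> y2" for w
  proof -
    have "cmod (G w) \<le> exp ((B1 + \<epsilon> + \<delta> * Q) / 2 + - (\<delta> / 2 * (Re w)\<^sup>2))"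
    proof -
      have "(Re (A w) + \<epsilon> + X - Z) / 2 \<le> (B1 + \<epsilon> + J) / 2 + - (Z / 2)" if "X \<le> J" for X J Z
        using abs_le_D1[OF ReA[OF w]] that by (simp add: field_simps)
      from this[OF dQ[OF w]] show ?thesis
        unfolding Gabs exp_le_cancel_iff times_divide_eq_left .
    qed
    also have "\<dots> \<le> CG * exp (- \<bar>Re w\<bar>)"
      unfolding exp_add CG_def mult.assoc using gauss_le_exp_abs[of "\<delta> / 2" "Re w"] d
      by (intro mult_left_mono) auto
    finally show ?thesis .
  qed
  have Fbd: "cmod (F w) \<le> CF * exp (- \<bar>Re w\<bar>)" if w: "y1 \<le> Im w" "Im w \<le> y2" for w
  proof -
    have dR: "0 \<le> \<delta> * (Re w)\<^sup>2" and dI: "0 \<le> \<delta> * (Im w)\<^sup>2" using d by auto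
    \<comment> \<open>\<open>h\<close> carries two Gaussian factors and \<open>G\<close> only the
      square root of one. The quotient keeps the power 3/2 of the Gaussian, and the power 1 is
      retained in the estimate.\<close>
    define s where "s = \<delta> * (Im w)\<^sup>2 - \<delta> * (Re w)\<^sup>2"
    define t where "t = (Re (A w) + \<epsilon> + \<delta> * (Im w)\<^sup>2 - \<delta> * (Re w)\<^sup>2) / 2"
    have "cmod (q w) = exp s" by (simp add: cmodq s_def exp_diff exp_minus field_simps)
    then have "cmod (F w) = cmod (k w) * exp (s + s - t)"
      unfolding F_def norm_divide Gabs hq norm_mult exp_diff exp_add t_def[symmetric] by simp
    also have "\<dots> \<le> B * exp ((2 * \<delta> * Q + B1 / 2) + - (\<delta> * (Re w)\<^sup>2))"
    proof (intro mult_mono B[OF w] B0)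
      have "s + s - t \<le> (2 * \<delta> * Q + B1 / 2) + - (\<delta> * (Re w)\<^sup>2)"
      proof -
        have "X - Z + (X - Z) - (Re (A w) + \<epsilon> + X - Z) / 2 \<le> 2 * J + B1 / 2 + - Z"
          if "X \<le> J" "0 \<le> X" "0 \<le> Z" for X J Z
          using abs_le_D2[OF ReA[OF w]] \<epsilon> that by (simp add: field_simps)
        from this[OF dQ[OF w] dI dR] show ?thesis unfolding s_def t_def mult.assoc .
      qed
      then show "exp (s + s - t) \<le> exp ((2 * \<delta> * Q + B1 / 2) + - (\<delta> * (Re w)\<^sup>2))" by simp
    qed auto
    also have "\<dots> = B * exp (2 * \<delta> * Q + B1 / 2) * exp (- (\<delta> * (Re w)\<^sup>2))" by (simp only: exp_add mult.assoc)
    also have "\<dots> \<le> CF * exp (- \<bar>Re w\<bar>)"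
      unfolding CF_def mult.assoc using gauss_le_exp_abs[OF d] B0
      by (intro mult_left_mono) auto
    finally show ?thesis .
  qed
  have C0: "CG \<ge> 0" "CF \<ge> 0" using B0 by (auto simp: CG_def CF_def)
  have line: "(cmod (k w * q w) + \<eta>) * cmod (q w) \<le> (cmod (G w))\<^sup>2 \<and>
      (cmod (G w))\<^sup>2 \<le> (1 + \<eta>) * ((cmod (k w * q w) + \<eta>) * cmod (q w))" if w: "Im w = y1 \<or> Im w = y2" for w
  proof -
    have pos: "cmod (k w * q w) + \<eta> > 0" using \<eta> norm_ge_zero[of "k w * q w"] by linarith
    have eu: "exp (u w) = cmod (k w * q w) + \<eta>" using pos by (simp add: u_def)
    have e2: "exp (2 * \<epsilon>) = 1 + \<eta>" using \<eta> by (simp add: \<epsilon>_def)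
    have "exp (u w) \<le> exp (Re (A w) + \<epsilon>)" using Au[OF w] by simp
    moreover have "exp (Re (A w) + \<epsilon>) \<le> exp (2 * \<epsilon> + u w)" using Au[OF w] by simp
    ultimately show ?thesis unfolding G2 eu exp_add e2 using \<eta>
      by (auto simp: mult_right_mono simp flip: mult.assoc)
  qed
  show ?thesis
  proof (rule that[of a' b' F G "max CF CG"])
    show "a' < y1" "y2 < b'" using y A by (auto simp: a'_def b'_def)
    show "h w = F w * G w" for w using G0 by (simp add: F_def)
    show "cmod (F w) \<le> max CF CG * exp (- \<bar>Re w\<bar>)" if "y1 \<le> Im w" "Im w \<le> y2" for w
      by (rule order_trans[OF Fbd[OF that]]) simp
    show "cmod (G w) \<le> max CF CG * exp (- \<bar>Re w\<bar>)" if "y1 \<le> Im w" "Im w \<le> y2" for w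
      by (rule order_trans[OF Gbd[OF that]]) simp
    fix w assume w: "Im w = y1 \<or> Im w = y2"
    have hkq: "cmod (h w) = cmod (k w * q w) * cmod (q w)" by (simp add: hq norm_mult)
    have low: "cmod (h w) \<le> (cmod (G w))\<^sup>2"
    proof -
      have "cmod (h w) \<le> (cmod (k w * q w) + \<eta>) * cmod (q w)"
        unfolding hkq using \<eta> by (intro mult_right_mono) auto
      then show ?thesis using line[OF w] by linarith
    qed
    have "(cmod (F w))\<^sup>2 = (cmod (h w))\<^sup>2 / (cmod (G w))\<^sup>2"
      by (simp add: F_def norm_divide power_divide)
    also have "\<dots> \<le> cmod (h w)"
      using low G0[of w] by (simp add: divide_le_eq power2_eq_square mult_left_mono)
    finally show "(cmod (F w))\<^sup>2 \<le> cmod (h w)" .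
    show "(cmod (G w))\<^sup>2 \<le> (1 + \<eta>) * (cmod (h w) + \<eta> * cmod (exp (- (of_real \<delta> * w\<^sup>2))))"
      using line[OF w] unfolding hkq q_def by (simp add: algebra_simps)
  qed (fact F_holo G_holo)+
qed

section \<open>A midpoint estimate for Hardy functions\<close>

lemma integral_Cauchy_Schwarz:
  fixes f g :: "'a \<Rightarrow> real"
  assumes [measurable]: "f \<in> borel_measurable M" "g \<in> borel_measurable M"
    and f2: "integrable M (\<lambda>x. (f x)\<^sup>2)" and g2: "integrable M (\<lambda>x. (g x)\<^sup>2)"
  shows "integrable M (\<lambda>x. \<bar>f x * g x\<bar>)"
    and "(\<integral>x. \<bar>f x * g x\<bar> \<partial>M)\<^sup>2 \<le> (\<integral>x. (f x)\<^sup>2 \<partial>M) * (\<integral>x. (g x)\<^sup>2 \<partial>M)"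
proof -
  show int: "integrable M (\<lambda>x. \<bar>f x * g x\<bar>)"
  proof (rule Bochner_Integration.integrable_bound[OF Bochner_Integration.integrable_add[OF f2 g2]])
    show "AE x in M. norm \<bar>f x * g x\<bar> \<le> norm ((f x)\<^sup>2 + (g x)\<^sup>2)"
    proof (rule AE_I2)
      fix x
      have "2 * (\<bar>f x\<bar> * \<bar>g x\<bar>) \<le> (f x)\<^sup>2 + (g x)\<^sup>2"
        using sum_squares_bound[of "\<bar>f x\<bar>" "\<bar>g x\<bar>"] by simp
      moreover have "0 \<le> \<bar>f x\<bar> * \<bar>g x\<bar>" by simp
      ultimately show "norm \<bar>f x * g x\<bar> \<le> norm ((f x)\<^sup>2 + (g x)\<^sup>2)"
        unfolding real_norm_def abs_mult abs_idempotent by linarith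
    qed
  qed simp
  define a where "a = (\<integral>x. (f x)\<^sup>2 \<partial>M)"
  define b where "b = (\<integral>x. (g x)\<^sup>2 \<partial>M)"
  define c where "c = (\<integral>x. \<bar>f x * g x\<bar> \<partial>M)"
  have quad: "0 \<le> a - 2 * t * c + t\<^sup>2 * b" for t
  proof -
    have "0 \<le> (\<integral>x. (\<bar>f x\<bar> - t * \<bar>g x\<bar>)\<^sup>2 \<partial>M)" by simp
    also have "(\<lambda>x. (\<bar>f x\<bar> - t * \<bar>g x\<bar>)\<^sup>2) = (\<lambda>x. (f x)\<^sup>2 - (2 * t) * \<bar>f x * g x\<bar> + t\<^sup>2 * (g x)\<^sup>2)"
      by (simp add: power2_diff power_mult_distrib abs_mult algebra_simps)
    also have "(\<integral>x. (f x)\<^sup>2 - (2 * t) * \<bar>f x * g x\<bar> + t\<^sup>2 * (g x)\<^sup>2 \<partial>M) = a - 2 * t * c + t\<^sup>2 * b"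
      using f2 g2 int by (simp add: a_def b_def c_def)
    finally show ?thesis .
  qed
  have ab: "a \<ge> 0" "b \<ge> 0" "c \<ge> 0" by (auto simp: a_def b_def c_def)
  have "c\<^sup>2 \<le> a * b"
  proof (cases "b = 0")
    case True
    have "c = 0"
    proof (rule ccontr)
      assume "c \<noteq> 0"
      have "2 * ((a + 1) / c) * c = 2 * (a + 1)" using \<open>c \<noteq> 0\<close> by simp
      then show False using quad[of "(a + 1) / c"] True ab by simp
    qed
    then show ?thesis using ab by simp
  next
    case False
    then have "b > 0" using ab by simp
    then show ?thesis using quad[of "c / b"] by (simp add: field_simps power2_eq_square)
  qed
  then show "(\<integral>x. \<bar>f x * g x\<bar> \<partial>M)\<^sup>2 \<le> (\<integral>x. (f x)\<^sup>2 \<partial>M) * (\<integral>x. (g x)\<^sup>2 \<partial>M)"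
    by (simp add: a_def b_def c_def)
qed

text \<open>\<open>NF\<close>, \<open>NG\<close> stand for squared L^2 norms on the two outer lines
  and on the middle one, \<open>DF\<close>, \<open>DG\<close> for those of the differences, and
  \<open>M\<close>, \<open>X\<close> for the L^1 norms of the middle trace and of the difference of
  the outer traces of \<open>h\<close>. From \<open>M^2 \<le> (A - DF / 2) * (A - DG / 2)\<close>
  both \<open>DF\<close> and \<open>DG\<close> are at most \<open>4 * (A - M)\<close>. Then
  \<open>p^2\<close> and \<open>q^2\<close> are at most \<open>8 * A * (A - M)\<close>, and
  \<open>X^2 \<le> 2 * p^2 + 2 * q^2\<close> gives the factor 32. The splitting
  \<open>(F1 - F2) * G1 + F2 * (G1 - G2)\<close> explains why only \<open>NG1\<close> and
  \<open>NF2\<close> are bounded on their own.\<close>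

lemma factor_difference_estimate:
  fixes A :: real
  assumes nn: "0 \<le> NF2" "0 \<le> NFm" "0 \<le> NGm" "0 \<le> NG1" "0 \<le> DF" "0 \<le> DG" "0 \<le> M" "0 \<le> X"
    and F: "NF1 + NF2 \<le> 2 * A" "DF = NF1 + NF2 - 2 * NFm" "NF2 \<le> 2 * A"
    and G: "NG1 + NG2 \<le> 2 * A" "DG = NG1 + NG2 - 2 * NGm" "NG1 \<le> 2 * A"
    and M: "M\<^sup>2 \<le> NFm * NGm" and X: "X \<le> p + q" "p\<^sup>2 \<le> DF * NG1" "q\<^sup>2 \<le> NF2 * DG"
  shows "M \<le> A \<and> X\<^sup>2 \<le> 32 * A * (A - M)"
proof -
  have A0: "A \<ge> 0" using nn G(3) by linarith
  have 1: "NFm \<le> A - DF / 2" "NGm \<le> A - DG / 2" using F G by (auto simp: field_simps)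
  have MA: "M\<^sup>2 \<le> (A - DF / 2) * A" "M\<^sup>2 \<le> A * (A - DG / 2)"
  proof -
    have "NFm * NGm \<le> (A - DF / 2) * A" by (intro mult_mono) (use 1 nn in linarith)+
    then show "M\<^sup>2 \<le> (A - DF / 2) * A" using M by simp
    have "NFm * NGm \<le> A * (A - DG / 2)" by (intro mult_mono) (use 1 nn in linarith)+
    then show "M\<^sup>2 \<le> A * (A - DG / 2)" using M by simp
  qed
  have "M\<^sup>2 \<le> A\<^sup>2" using MA(1) mult_nonneg_nonneg[OF nn(5) A0] by (simp add: power2_eq_square algebra_simps)
  then have le: "M \<le> A" using A0 power2_le_imp_le by blast
  have D: "D \<le> 4 * (A - M)" if D: "M\<^sup>2 \<le> (A - D / 2) * A" "D / 2 \<le> A" for D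
  proof (cases "A = 0")
    case True then show ?thesis using D(2) le nn by simp
  next
    case False
    then have Ap: "A > 0" using A0 by simp
    have "D * A \<le> 2 * (A\<^sup>2 - M\<^sup>2)" using D(1) by (simp add: power2_eq_square algebra_simps)
    also have "\<dots> = 2 * ((A - M) * (A + M))" by (simp add: power2_eq_square algebra_simps)
    also have "\<dots> \<le> 2 * ((A - M) * (2 * A))" using le by (intro mult_left_mono) auto
    finally have "D * A \<le> (4 * (A - M)) * A" by (simp add: algebra_simps)
    then show ?thesis using Ap by (simp add: mult_le_cancel_right)
  qed
  have DF: "DF \<le> 4 * (A - M)" by (rule D) (use MA 1 nn in auto)
  have DG: "DG \<le> 4 * (A - M)" by (rule D) (use MA 1 nn in \<open>auto simp: mult.commute\<close>)
  have "p\<^sup>2 \<le> (4 * (A - M)) * (2 * A)"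
    by (rule order_trans[OF X(2)]) (intro mult_mono; use DF G nn le in linarith)
  moreover have "q\<^sup>2 \<le> (2 * A) * (4 * (A - M))"
    by (rule order_trans[OF X(3)]) (intro mult_mono; use DG F nn le A0 in linarith)
  moreover have "X\<^sup>2 \<le> (p + q)\<^sup>2" using X(1) nn(8) by (intro power_mono)
  moreover have "(p + q)\<^sup>2 \<le> 2 * p\<^sup>2 + 2 * q\<^sup>2"
    using sum_squares_bound[of p q] by (simp add: power2_sum)
  ultimately show ?thesis using le by (simp add: algebra_simps)
qed

text \<open>The factors depend on \<open>\<eta>\<close>, but the resulting inequality mentions only
  \<open>h\<close> and the number \<open>A' \<eta>\<close>, so \<open>\<eta>\<close> can tend to 0
  although the factors need not converge.\<close>

lemma hardy_midpoint_gauss: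
  assumes holo: "k holomorphic_on hstrip a b" and y: "a < y1" "y1 < y2" "y2 < b"
    and B: "\<And>w. y1 \<le> Im w \<Longrightarrow> Im w \<le> y2 \<Longrightarrow> cmod (k w) \<le> B"
    and d: "\<delta> > 0"
    and h: "\<And>w. h w = k w * exp (- (of_real (2 * \<delta>) * w\<^sup>2))"
    and A: "A = (hline_norm h y1 + hline_norm h y2) / 2"
  shows "hline_norm h ((y1 + y2) / 2) \<le> A \<and>
    (\<integral>x. cmod (h (Complex x y1) - h (Complex x y2)) \<partial>lborel)\<^sup>2 \<le> 32 * A * (A - hline_norm h ((y1 + y2) / 2))"
proof -
  define m where "m = (y1 + y2) / 2"
  define q where "q = (\<lambda>w::complex. exp (- (of_real \<delta> * w\<^sup>2)))"
  define J where "J = (\<lambda>y. \<integral>x. cmod (q (Complex x y)) \<partial>lborel)"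
  \<comment> \<open>Twice this number bounds the sum of the squared norms on the two lines, both for
    \<open>F\<close> and for \<open>G\<close>; the term with \<open>J\<close> is the price of the
    added \<open>\<eta>\<close> under the logarithm.\<close>
  define A' where "A' = (\<lambda>\<eta>. ((1 + \<eta>) * (hline_norm h y1 + \<eta> * J y1) + (1 + \<eta>) * (hline_norm h y2 + \<eta> * J y2)) / 2)"
  define X where "X = (\<integral>x. cmod (h (Complex x y1) - h (Complex x y2)) \<partial>lborel)"
  have m: "y1 \<le> m" "m \<le> y2" using y by (auto simp: m_def)
  have hn: "hline_norm h y \<ge> 0" for y by (simp add: hline_norm_def)
  have Jn: "J y \<ge> 0" for y by (simp add: J_def)
  have int_q: "integrable lborel (\<lambda>x. cmod (q (Complex x y)))" for y
  proof (rule integrable_of_exp_bound)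
    show "(\<lambda>x. cmod (q (Complex x y))) \<in> borel_measurable borel" unfolding q_def Complex_eq
      by (intro borel_measurable_continuous_onI continuous_intros)
    show "norm (cmod (q (Complex x y))) \<le> exp (\<delta> * y\<^sup>2) * exp (1 / (4 * \<delta>)) * exp (- \<bar>x\<bar>)" for x
      using gauss_le_exp_abs[OF d, of x] unfolding q_def cmod_exp_gauss
      by (simp add: mult.assoc)
  qed
  have main: "hline_norm h m \<le> A' \<eta> \<and> X\<^sup>2 \<le> 32 * A' \<eta> * (A' \<eta> - hline_norm h m)" if \<eta>: "\<eta> > 0" for \<eta>
  proof -
    obtain F G a' b' C where ab: "a' < y1" "y2 < b'" and Fh: "F holomorphic_on hstrip a' b'"
      and Gh: "G holomorphic_on hstrip a' b'" and FG: "\<And>w. w \<in> hstrip a' b' \<Longrightarrow> h w = F w * G w"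
      and FC: "\<And>w. y1 \<le> Im w \<Longrightarrow> Im w \<le> y2 \<Longrightarrow> cmod (F w) \<le> C * exp (- \<bar>Re w\<bar>)"
      and GC: "\<And>w. y1 \<le> Im w \<Longrightarrow> Im w \<le> y2 \<Longrightarrow> cmod (G w) \<le> C * exp (- \<bar>Re w\<bar>)"
      and F2: "\<And>w. Im w = y1 \<or> Im w = y2 \<Longrightarrow> (cmod (F w))\<^sup>2 \<le> cmod (h w)"
      and G2: "\<And>w. Im w = y1 \<or> Im w = y2 \<Longrightarrow> (cmod (G w))\<^sup>2 \<le> (1 + \<eta>) * (cmod (h w) + \<eta> * cmod (q w))"
      by (rule hardy_factorization[OF holo y B d \<eta> h]; (assumption | rule that[unfolded q_def]))
    note Fc = holomorphic_on_imp_continuous_on[OF Fh] and Gc = holomorphic_on_imp_continuous_on[OF Gh]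
    have C0: "C \<ge> 0" using order_trans[OF norm_ge_zero FC[of "Complex 0 y1"]] y by simp
    have Fm: "(\<lambda>x. F (Complex x y)) \<in> borel_measurable borel" if "y1 \<le> y" "y \<le> y2" for y
      using measurable_hline[OF Fc, of y] that ab by simp
    have Gm: "(\<lambda>x. G (Complex x y)) \<in> borel_measurable borel" if "y1 \<le> y" "y \<le> y2" for y
      using measurable_hline[OF Gc, of y] that ab by simp
    have sq: "integrable lborel (\<lambda>x. (cmod (f x))\<^sup>2)"
      if [measurable]: "f \<in> borel_measurable borel" and bd: "\<And>x. cmod (f x) \<le> D * exp (- \<bar>x\<bar>)"
      for f :: "real \<Rightarrow> complex" and D
    proof (rule integrable_of_exp_bound[where C = "D\<^sup>2"])
      fix x
      have "D \<ge> 0" using order_trans[OF norm_ge_zero bd[of 0]] by simp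
      then have "cmod (f x) * cmod (f x) \<le> (D * 1) * (D * exp (- \<bar>x\<bar>))"
        using bd[of x] by (intro mult_mono order_trans[OF bd[of x]] mult_left_mono) auto
      then show "norm ((cmod (f x))\<^sup>2) \<le> D\<^sup>2 * exp (- \<bar>x\<bar>)" by (simp add: power2_eq_square mult.assoc)
    qed simp
    have F2i: "integrable lborel (\<lambda>x. (cmod (F (Complex x y)))\<^sup>2)" if "y1 \<le> y" "y \<le> y2" for y
      using FC[of "Complex _ y"] that by (intro sq[where D = C] Fm) auto
    have G2i: "integrable lborel (\<lambda>x. (cmod (G (Complex x y)))\<^sup>2)" if "y1 \<le> y" "y \<le> y2" for y
      using GC[of "Complex _ y"] that by (intro sq[where D = C] Gm) auto
    have diff_bd: "cmod (u - v) \<le> (2 * C) * exp (- \<bar>x\<bar>)" if "cmod u \<le> C * exp (- \<bar>x\<bar>)" "cmod v \<le> C * exp (- \<bar>x\<bar>)" for u v x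
      using norm_triangle_ineq4[of u v] that by linarith
    have FDm: "(\<lambda>x. F (Complex x y1) - F (Complex x y2)) \<in> borel_measurable borel"
      by (intro borel_measurable_diff Fm) (use y in auto)
    have GDm: "(\<lambda>x. G (Complex x y1) - G (Complex x y2)) \<in> borel_measurable borel"
      by (intro borel_measurable_diff Gm) (use y in auto)
    have FDi: "integrable lborel (\<lambda>x. (cmod (F (Complex x y1) - F (Complex x y2)))\<^sup>2)"
      using FC[of "Complex _ y1"] FC[of "Complex _ y2"] y by (intro sq[OF FDm, where D = "2 * C"] diff_bd) auto
    have GDi: "integrable lborel (\<lambda>x. (cmod (G (Complex x y1) - G (Complex x y2)))\<^sup>2)"
      using GC[of "Complex _ y1"] GC[of "Complex _ y2"] y by (intro sq[OF GDm, where D = "2 * C"] diff_bd) auto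
    have cmodm: "(\<lambda>x. cmod (f x)) \<in> borel_measurable lborel" if "f \<in> borel_measurable borel" for f :: "real \<Rightarrow> complex"
      using that by simp
    have line: "Complex x y \<in> hstrip a' b'" if "y1 \<le> y" "y \<le> y2" for x y using that ab by simp
    have hi: "integrable lborel (\<lambda>x. cmod (h (Complex x y)))" if "y1 \<le> y" "y \<le> y2" for y
      using integral_Cauchy_Schwarz(1)[OF cmodm[OF Fm[OF that]] cmodm[OF Gm[OF that]] F2i[OF that] G2i[OF that]]
      by (simp add: FG[OF line[OF that]] norm_mult)
    have NF: "(\<integral>x. (cmod (F (Complex x y)))\<^sup>2 \<partial>lborel) \<le> hline_norm h y" if "y = y1 \<or> y = y2" for y
      unfolding hline_norm_def using that y F2[of "Complex _ y"]
      by (intro integral_mono F2i hi) auto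
    have NG: "(\<integral>x. (cmod (G (Complex x y)))\<^sup>2 \<partial>lborel) \<le> (1 + \<eta>) * (hline_norm h y + \<eta> * J y)" if yy: "y = y1 \<or> y = y2" for y
    proof -
      have hiy: "integrable lborel (\<lambda>x. cmod (h (Complex x y)))" using hi yy y by auto
      have "(\<integral>x. (cmod (G (Complex x y)))\<^sup>2 \<partial>lborel) \<le> (\<integral>x. (1 + \<eta>) * (cmod (h (Complex x y)) + \<eta> * cmod (q (Complex x y))) \<partial>lborel)"
        using yy y G2[of "Complex _ y"] hiy int_q[of y]
        by (intro integral_mono G2i) auto
      also have "\<dots> = (1 + \<eta>) * (hline_norm h y + \<eta> * J y)"
        using hiy int_q[of y] by (simp add: hline_norm_def J_def)
      finally show ?thesis .
    qed
    have up: "hline_norm h y \<le> (1 + \<eta>) * (hline_norm h y + \<eta> * J y)" for y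
    proof -
      have "1 * hline_norm h y \<le> (1 + \<eta>) * (hline_norm h y + \<eta> * J y)"
        using \<eta> hn[of y] Jn[of y] by (intro mult_mono) auto
      then show ?thesis by simp
    qed
    define I where "I = (\<lambda>f::real \<Rightarrow> complex. \<integral>x. (cmod (f x))\<^sup>2 \<partial>lborel)"
    have In: "I f \<ge> 0" for f by (simp add: I_def)
    define p where "p = (\<integral>x. \<bar>cmod (F (Complex x y1) - F (Complex x y2)) * cmod (G (Complex x y1))\<bar> \<partial>lborel)"
    define r where "r = (\<integral>x. \<bar>cmod (F (Complex x y2)) * cmod (G (Complex x y1) - G (Complex x y2))\<bar> \<partial>lborel)"
    have y1: "y1 \<le> y1" "y1 \<le> y2" and y2: "y1 \<le> y2" "y2 \<le> y2" using y by auto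
    note CS1 = integral_Cauchy_Schwarz[OF cmodm[OF FDm] cmodm[OF Gm[OF y1]] FDi G2i[OF y1]]
    note CS2 = integral_Cauchy_Schwarz[OF cmodm[OF Fm[OF y2]] cmodm[OF GDm] F2i[OF y2] GDi]
    note CSm = integral_Cauchy_Schwarz[OF cmodm[OF Fm[OF m]] cmodm[OF Gm[OF m]] F2i[OF m] G2i[OF m]]
    have "hline_norm h m \<le> A' \<eta> \<and> X\<^sup>2 \<le> 32 * A' \<eta> * (A' \<eta> - hline_norm h m)"
    proof (rule factor_difference_estimate[where ?NF1.0 = "I (\<lambda>x. F (Complex x y1))" and ?NF2.0 = "I (\<lambda>x. F (Complex x y2))"
          and ?NG1.0 = "I (\<lambda>x. G (Complex x y1))" and ?NG2.0 = "I (\<lambda>x. G (Complex x y2))"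
          and NFm = "I (\<lambda>x. F (Complex x m))" and NGm = "I (\<lambda>x. G (Complex x m))"
          and DF = "I (\<lambda>x. F (Complex x y1) - F (Complex x y2))" and DG = "I (\<lambda>x. G (Complex x y1) - G (Complex x y2))"
          and p = p and q = r])
      show "I (\<lambda>x. F (Complex x y1) - F (Complex x y2)) = I (\<lambda>x. F (Complex x y1)) + I (\<lambda>x. F (Complex x y2)) - 2 * I (\<lambda>x. F (Complex x m))"
        unfolding I_def m_def using H2_parallelogram[OF Fh _ _ _ FC] ab y by simp
      show "I (\<lambda>x. G (Complex x y1) - G (Complex x y2)) = I (\<lambda>x. G (Complex x y1)) + I (\<lambda>x. G (Complex x y2)) - 2 * I (\<lambda>x. G (Complex x m))"
        unfolding I_def m_def using H2_parallelogram[OF Gh _ _ _ GC] ab y by simp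
      show "I (\<lambda>x. F (Complex x y1)) + I (\<lambda>x. F (Complex x y2)) \<le> 2 * A' \<eta>"
        using NF[of y1] NF[of y2] up[of y1] up[of y2] by (simp add: I_def A'_def)
      show "I (\<lambda>x. F (Complex x y2)) \<le> 2 * A' \<eta>"
        using NF[of y2] up[of y1] up[of y2] hn[of y1] by (simp add: I_def A'_def)
      show "I (\<lambda>x. G (Complex x y1)) + I (\<lambda>x. G (Complex x y2)) \<le> 2 * A' \<eta>"
        using NG[of y1] NG[of y2] by (simp add: I_def A'_def)
      show "I (\<lambda>x. G (Complex x y1)) \<le> 2 * A' \<eta>"
        using NG[of y1] up[of y2] hn[of y2] by (simp add: I_def A'_def)
      show "(hline_norm h m)\<^sup>2 \<le> I (\<lambda>x. F (Complex x m)) * I (\<lambda>x. G (Complex x m))"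
        using CSm(2) by (simp add: hline_norm_def I_def FG[OF line[OF m]] norm_mult)
      show "p\<^sup>2 \<le> I (\<lambda>x. F (Complex x y1) - F (Complex x y2)) * I (\<lambda>x. G (Complex x y1))"
        using CS1(2) by (simp add: p_def I_def)
      show "r\<^sup>2 \<le> I (\<lambda>x. F (Complex x y2)) * I (\<lambda>x. G (Complex x y1) - G (Complex x y2))"
        using CS2(2) by (simp add: r_def I_def)
      have "X \<le> (\<integral>x. \<bar>cmod (F (Complex x y1) - F (Complex x y2)) * cmod (G (Complex x y1))\<bar>
           + \<bar>cmod (F (Complex x y2)) * cmod (G (Complex x y1) - G (Complex x y2))\<bar> \<partial>lborel)"
        unfolding X_def
      proof (rule integral_mono')
        fix x
        have "h (Complex x y1) - h (Complex x y2) = (F (Complex x y1) - F (Complex x y2)) * G (Complex x y1)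
            + F (Complex x y2) * (G (Complex x y1) - G (Complex x y2))"
          unfolding FG[OF line[OF y1]] FG[OF line[OF y2]] by (simp add: algebra_simps)
        then show "cmod (h (Complex x y1) - h (Complex x y2)) \<le> \<bar>cmod (F (Complex x y1) - F (Complex x y2)) * cmod (G (Complex x y1))\<bar>
           + \<bar>cmod (F (Complex x y2)) * cmod (G (Complex x y1) - G (Complex x y2))\<bar>"
          by (simp add: norm_triangle_le norm_mult)
      qed (intro Bochner_Integration.integrable_add CS1(1) CS2(1), simp)
      also have "\<dots> = p + r" unfolding p_def r_def
        by (intro Bochner_Integration.integral_add CS1(1) CS2(1))
      finally show "X \<le> p + r" .
    qed (auto simp: In hn X_def)
    then show ?thesis by simp
  qed
  have lim: "(\<lambda>n. A' (1 / real (Suc n))) \<longlonglongrightarrow> A' 0"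
    unfolding A'_def
    by (intro tendsto_intros LIMSEQ_inverse_real_of_nat[unfolded inverse_eq_divide]) simp
  have A0: "A' 0 = A" by (simp add: A'_def A)
  have "hline_norm h m \<le> A' 0"
    by (rule LIMSEQ_le_const[OF lim]) (intro exI allI impI main[THEN conjunct1], simp)
  moreover have "X\<^sup>2 \<le> 32 * A' 0 * (A' 0 - hline_norm h m)"
    by (rule LIMSEQ_le_const[OF tendsto_mult[OF tendsto_mult[OF tendsto_const lim] tendsto_diff[OF lim tendsto_const]]])
       (intro exI allI impI main[THEN conjunct2], simp)
  ultimately show ?thesis by (simp add: A0 m_def X_def)
qed

text \<open>The Hardy class H^1 of the strip of half-width \<open>p\<close>, with \<open>K\<close>
  bounding the L^1 norms of all traces. Boundary values do not enter.\<close>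

definition hardy_strip :: "real \<Rightarrow> (complex \<Rightarrow> complex) \<Rightarrow> real \<Rightarrow> bool" where
  "hardy_strip p h K \<longleftrightarrow> h holomorphic_on hstrip (- p) p \<and>
     (\<forall>y. \<bar>y\<bar> < p \<longrightarrow> integrable lborel (\<lambda>x. h (Complex x y)) \<and> hline_norm h y \<le> K)"

text \<open>On the closed substrip \<open>h\<close> is bounded by the pointwise estimate, so
  Gaussian damping brings it into the form already treated. Every norm in the inequality passes to
  the limit by dominated convergence.\<close>

lemma hardy_midpoint:
  assumes h: "hardy_strip p h K" and y: "- p < y1" "y1 < y2" "y2 < p"
    and A: "A = (hline_norm h y1 + hline_norm h y2) / 2"
  shows "hline_norm h ((y1 + y2) / 2) \<le> A \<and>
    (\<integral>x. cmod (h (Complex x y1) - h (Complex x y2)) \<partial>lborel)\<^sup>2 \<le> 32 * A * (A - hline_norm h ((y1 + y2) / 2))"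
proof -
  have holo: "h holomorphic_on hstrip (- p) p" using h by (simp add: hardy_strip_def)
  have int: "integrable lborel (\<lambda>x. h (Complex x y))" and K: "hline_norm h y \<le> K" if "- p < y" "y < p" for y
    using h that by (auto simp: hardy_strip_def abs_less_iff)
  note cont = holomorphic_on_imp_continuous_on[OF holo]
  define r where "r = min (p - y2) (p + y1) / 2"
  have r: "r > 0" "- p < y1 - r" "y2 + r < p" using y by (auto simp: r_def min_def field_simps)
  have B: "cmod (h w) \<le> K / r" if "y1 \<le> Im w" "Im w \<le> y2" for w
    by (rule hardy_pointwise_bound[OF holo int K r(1)]) (use r that in auto)
  \<comment> \<open>The damping strength is at most 2, so \<open>exp (2 * y^2)\<close> bounds all
    these factors on the line at height \<open>y\<close> and gives one dominating function for all
    \<open>n\<close>.\<close>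
  define e where "e = (\<lambda>n w::complex. exp (- (of_real (2 * (1 / real (Suc n))) * w\<^sup>2)))"
  define hn where "hn = (\<lambda>n w. h w * e n w)"
  have e_le: "cmod (e n (Complex x y)) \<le> exp (2 * y\<^sup>2)" for n x y
  proof -
    have "cmod (e n (Complex x y)) = exp (2 * (1 / real (Suc n)) * y\<^sup>2) * exp (- (2 * (1 / real (Suc n)) * x\<^sup>2))"
      unfolding e_def cmod_exp_gauss by simp
    also have "\<dots> \<le> exp (2 * 1 * y\<^sup>2) * 1"
      by (intro mult_mono exp_le_cancel_iff[THEN iffD2] mult_right_mono mult_left_mono) auto
    finally show ?thesis by simp
  qed
  have e_lim: "(\<lambda>n. e n w) \<longlonglongrightarrow> 1" for w
  proof -
    have "(\<lambda>n. exp (- (of_real (2 * (1 / real (Suc n))) * w\<^sup>2))) \<longlonglongrightarrow> exp (- (of_real (2 * 0) * w\<^sup>2))"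
      by (intro tendsto_intros LIMSEQ_inverse_real_of_nat[unfolded inverse_eq_divide])
    then show ?thesis by (simp add: e_def)
  qed
  have hn_lim: "(\<lambda>n. hn n w) \<longlonglongrightarrow> h w" for w
    using tendsto_mult[OF tendsto_const e_lim, of "h w" w] by (simp add: hn_def)
  have hn_le: "cmod (hn n (Complex x y)) \<le> exp (2 * y\<^sup>2) * cmod (h (Complex x y))" for n x y
    using mult_left_mono[OF e_le[of n x y], of "cmod (h (Complex x y))"] by (simp add: hn_def norm_mult mult.commute)
  have e_cont: "continuous_on S (e n)" for S n unfolding e_def by (intro continuous_intros)
  have hnm: "(\<lambda>x. hn n (Complex x y)) \<in> borel_measurable borel" if "- p < y" "y < p" for n y
    using measurable_hline[of "- p" p "hn n" y] that cont e_cont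
    by (simp add: hn_def continuous_on_mult)
  have hm: "(\<lambda>x. h (Complex x y)) \<in> borel_measurable borel" if "- p < y" "y < p" for y
    using measurable_hline[OF cont] that by simp
  have lim: "(\<lambda>n. hline_norm (hn n) y) \<longlonglongrightarrow> hline_norm h y" if y: "- p < y" "y < p" for y
    unfolding hline_norm_def
  proof (rule integral_dominated_convergence[where w = "\<lambda>x. exp (2 * y\<^sup>2) * cmod (h (Complex x y))"])
    show "integrable lborel (\<lambda>x. exp (2 * y\<^sup>2) * cmod (h (Complex x y)))" using int[OF y] by simp
  qed (use hnm[OF y] hm[OF y] hn_le in \<open>auto intro!: tendsto_norm hn_lim\<close>)
  have limD: "(\<lambda>n. \<integral>x. cmod (hn n (Complex x y1) - hn n (Complex x y2)) \<partial>lborel)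
      \<longlonglongrightarrow> (\<integral>x. cmod (h (Complex x y1) - h (Complex x y2)) \<partial>lborel)"
  proof (rule integral_dominated_convergence[where w = "\<lambda>x. exp (2 * y1\<^sup>2) * cmod (h (Complex x y1)) + exp (2 * y2\<^sup>2) * cmod (h (Complex x y2))"])
    show "integrable lborel (\<lambda>x. exp (2 * y1\<^sup>2) * cmod (h (Complex x y1)) + exp (2 * y2\<^sup>2) * cmod (h (Complex x y2)))"
      using int[of y1] int[of y2] y by simp
    show "AE x in lborel. norm (cmod (hn n (Complex x y1) - hn n (Complex x y2)))
        \<le> exp (2 * y1\<^sup>2) * cmod (h (Complex x y1)) + exp (2 * y2\<^sup>2) * cmod (h (Complex x y2))" for n
      using hn_le[of n _ y1] hn_le[of n _ y2]
      by (intro AE_I2) (auto intro!: order_trans[OF norm_triangle_ineq4] add_mono)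
    show "(\<lambda>x. cmod (h (Complex x y1) - h (Complex x y2))) \<in> borel_measurable lborel"
      using hm[of y1] hm[of y2] y by simp
    show "(\<lambda>x. cmod (hn n (Complex x y1) - hn n (Complex x y2))) \<in> borel_measurable lborel" for n
      using hnm[of y1] hnm[of y2] y by simp
  qed (auto intro!: tendsto_norm tendsto_diff hn_lim)
  have main: "hline_norm (hn n) ((y1 + y2) / 2) \<le> (hline_norm (hn n) y1 + hline_norm (hn n) y2) / 2 \<and>
    (\<integral>x. cmod (hn n (Complex x y1) - hn n (Complex x y2)) \<partial>lborel)\<^sup>2 \<le>
      32 * ((hline_norm (hn n) y1 + hline_norm (hn n) y2) / 2) * ((hline_norm (hn n) y1 + hline_norm (hn n) y2) / 2 - hline_norm (hn n) ((y1 + y2) / 2))" for n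
    by (rule hardy_midpoint_gauss[OF holo y B, where \<delta> = "1 / real (Suc n)"])
       (simp_all only: hn_def e_def of_nat_0_less_iff zero_less_divide_1_iff zero_less_Suc)
  have l1: "(\<lambda>n. hline_norm (hn n) y1) \<longlonglongrightarrow> hline_norm h y1"
    and l2: "(\<lambda>n. hline_norm (hn n) y2) \<longlonglongrightarrow> hline_norm h y2"
    and lm: "(\<lambda>n. hline_norm (hn n) ((y1 + y2) / 2)) \<longlonglongrightarrow> hline_norm h ((y1 + y2) / 2)"
    by (rule lim; use y in auto)+
  have lA: "(\<lambda>n. (hline_norm (hn n) y1 + hline_norm (hn n) y2) / 2) \<longlonglongrightarrow> A"
    unfolding A by (intro tendsto_intros l1 l2) simp
  show ?thesis
  proof
    show "hline_norm h ((y1 + y2) / 2) \<le> A"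
      by (rule LIMSEQ_le[OF lm lA]) (intro exI allI impI main[THEN conjunct1])
    show "(\<integral>x. cmod (h (Complex x y1) - h (Complex x y2)) \<partial>lborel)\<^sup>2 \<le> 32 * A * (A - hline_norm h ((y1 + y2) / 2))"
      by (rule LIMSEQ_le[OF tendsto_power[OF limD] tendsto_mult[OF tendsto_mult[OF tendsto_const lA] tendsto_diff[OF lA lm]]])
         (intro exI allI impI main[THEN conjunct2])
  qed
qed

section \<open>Continuity of horizontal traces up to the boundary\<close>

text \<open>Midpoint convexity at three consecutive points of an arithmetic progression says that
  increments do not decrease, so \<open>Suc n\<close> of them add up to at least
  \<open>Suc n\<close> times the first. For a bounded function this makes the first increment
  small.\<close>

lemma midpoint_convex_increment:
  fixes f :: "real \<Rightarrow> real"
  assumes mid: "\<And>x y. a < x \<Longrightarrow> x < y \<Longrightarrow> y < b \<Longrightarrow> f ((x + y) / 2) \<le> (f x + f y) / 2"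
    and x: "a < x" and d: "d > 0" and n: "x + real (Suc n) * d < b"
  shows "f (x + d) - f x \<le> f (x + real (Suc n) * d) - f (x + real n * d) \<and>
         real (Suc n) * (f (x + d) - f x) \<le> f (x + real (Suc n) * d) - f x"
  using n
proof (induction n)
  case 0
  then show ?case by simp
next
  case (Suc n)
  have "x + real (Suc n) * d < x + real (Suc (Suc n)) * d" using d by (simp add: algebra_simps)
  then have lt: "x + real (Suc n) * d < b" using Suc.prems by linarith
  note IH = Suc.IH[OF lt]
  have "f (((x + real n * d) + (x + real (Suc (Suc n)) * d)) / 2) \<le> (f (x + real n * d) + f (x + real (Suc (Suc n)) * d)) / 2"
    by (rule mid[OF less_le_trans[OF x]]) (use d Suc.prems in \<open>auto simp: algebra_simps\<close>)
  moreover have "((x + real n * d) + (x + real (Suc (Suc n)) * d)) / 2 = x + real (Suc n) * d"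
    by (simp add: field_simps)
  ultimately have "f (x + real (Suc n) * d) * 2 \<le> f (x + real n * d) + f (x + real (Suc (Suc n)) * d)"
    by (simp only: le_divide_eq_numeral1)
  then have 1: "f (x + d) - f x \<le> f (x + real (Suc (Suc n)) * d) - f (x + real (Suc n) * d)"
    using IH by linarith
  have "real (Suc (Suc n)) * (f (x + d) - f x) = real (Suc n) * (f (x + d) - f x) + (f (x + d) - f x)"
    by (simp add: algebra_simps)
  also have "\<dots> \<le> f (x + real (Suc (Suc n)) * d) - f x" using IH 1 by linarith
  finally show ?case using 1 by blast
qed

text \<open>Meant for \<open>f = hline_norm h\<close>. A locale, because each argument at the right
  end is needed at the left end too and is obtained by interpreting the locale for
  \<open>\<lambda>x. f (- x)\<close>.\<close>

locale midpoint_convex_bounded =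
  fixes f :: "real \<Rightarrow> real" and p K :: real
  assumes p: "p > 0"
    and mid: "\<And>x y. - p < x \<Longrightarrow> x < y \<Longrightarrow> y < p \<Longrightarrow> f ((x + y) / 2) \<le> (f x + f y) / 2"
    and bounds: "\<And>x. - p < x \<Longrightarrow> x < p \<Longrightarrow> 0 \<le> f x \<and> f x \<le> K"
begin

lemma reflect: "midpoint_convex_bounded (\<lambda>x. f (- x)) p K"
proof
  fix x y assume "- p < x" "x < y" "y < p"
  then have "f ((- y + - x) / 2) \<le> (f (- y) + f (- x)) / 2" by (intro mid) auto
  moreover have "(- y + - x) / 2 = - ((x + y) / 2)" by (simp add: field_simps)
  ultimately show "f (- ((x + y) / 2)) \<le> (f (- x) + f (- y)) / 2"
    by (simp only: add.commute[of "f (- y)"])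
qed (use p bounds in auto)

lemma increment_right:
  assumes "- p < x" "d > 0" "x + real (Suc n) * d < p"
  shows "f (x + d) - f x \<le> K / real (Suc n)"
proof -
  have "real (Suc n) * (f (x + d) - f x) \<le> f (x + real (Suc n) * d) - f x"
    using midpoint_convex_increment[OF mid assms] by blast
  also have "\<dots> \<le> K"
  proof -
    have "real (Suc n) * d \<ge> 0" using assms by simp
    then show ?thesis using bounds[of "x + real (Suc n) * d"] bounds[of x] assms by linarith
  qed
  finally show ?thesis by (simp add: field_simps)
qed

lemma increment:
  assumes "- p < x" "x < p" "\<bar>x\<bar> + real (Suc n) * \<bar>d\<bar> < p"
  shows "f (x + d) - f x \<le> K / real (Suc n)"
proof -
  interpret r: midpoint_convex_bounded "\<lambda>x. f (- x)" p K by (rule reflect)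
  have K: "K \<ge> 0" using bounds[of 0] p by auto
  consider "d = 0" | "d > 0" | "d < 0" by linarith
  then show ?thesis
  proof cases
    case 2 with assms show ?thesis by (intro increment_right) auto
  next
    case 3 then show ?thesis using r.increment_right[of "- x" "- d" n] assms by (auto simp: add.commute[of d])
  qed (use K in auto)
qed

lemma continuous: "continuous_on {- p<..<p} f"
  unfolding continuous_on_iff
proof (intro ballI allI impI)
  fix x e :: real assume x: "x \<in> {- p<..<p}" and e: "e > 0"
  define r where "r = p - \<bar>x\<bar>"
  have r: "r > 0" using x by (auto simp: r_def)
  obtain n where n: "K / e < real n" using reals_Archimedean2 by blast
  have K: "K \<ge> 0" using bounds[of 0] p by auto
  have n': "K / real (Suc n) < e"
  proof -
    have "K < real n * e" using n e by (simp add: field_simps)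
    also have "\<dots> \<le> real (Suc n) * e" using e by simp
    finally show ?thesis by (simp add: divide_less_eq mult.commute)
  qed
  \<comment> \<open>Room for \<open>Suc n\<close> steps of length below \<open>d\<close> starting at
    \<open>x\<close> or at \<open>y\<close>; one of the two spare lengths absorbs the difference
    between \<open>\<bar>x\<bar>\<close> and \<open>\<bar>y\<bar>\<close>. Both starting points are
    used since the increment estimate is one-sided.\<close>
  define d where "d = r / (real (Suc n) + 2)"
  have d: "d > 0" using r by (simp add: d_def)
  have dr: "(real (Suc n) + 2) * d = r" by (simp add: d_def)
  show "\<exists>d>0. \<forall>x'\<in>{- p<..<p}. dist x' x < d \<longrightarrow> dist (f x') (f x) < e"
  proof (intro exI[of _ d] conjI ballI impI d)
    fix y assume y: "y \<in> {- p<..<p}" and "dist y x < d"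
    then have yx: "\<bar>y - x\<bar> < d" by (simp add: dist_real_def)
    have m: "real (Suc n) * \<bar>y - x\<bar> \<le> real (Suc n) * d" using yx by (intro mult_left_mono) auto
    have dr': "real (Suc n) * d + 2 * d = r" using dr by (simp add: algebra_simps)
    define P where "P = real (Suc n) * \<bar>y - x\<bar>"
    have "P < p - \<bar>x\<bar>" "P < p - \<bar>y\<bar>"
      using m dr' d r_def yx unfolding P_def[symmetric] by linarith+
    then have P: "\<bar>x\<bar> + real (Suc n) * \<bar>y - x\<bar> < p" "\<bar>y\<bar> + real (Suc n) * \<bar>x - y\<bar> < p"
      unfolding P_def abs_minus_commute[of x y] by linarith+
    have "f (x + (y - x)) - f x \<le> K / real (Suc n)"
      by (rule increment[OF _ _ P(1)]) (use x in auto)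
    moreover have "f (y + (x - y)) - f y \<le> K / real (Suc n)"
      by (rule increment[OF _ _ P(2)]) (use y in auto)
    ultimately show "dist (f y) (f x) < e" using n' by (simp add: dist_real_def)
  qed
qed

text \<open>This is all the convexity that the behaviour near the ends requires: it forces
  monotonicity there.\<close>

lemma quasiconvex:
  assumes "- p < a" "a \<le> y" "y \<le> b" "b < p"
  shows "f y \<le> max (f a) (f b)"
proof (rule ccontr)
  assume neg: "\<not> f y \<le> max (f a) (f b)"
  define m where "m = max (f a) (f b)"
  \<comment> \<open>On the interval the perturbation adds at most
    \<open>\<epsilon> * p^2 = (f y - m) / 2\<close>. The values of \<open>g\<close> at
    \<open>a\<close> and \<open>b\<close> thus stay below \<open>f y\<close>, and the maximum is
    interior.\<close>
  define \<epsilon> where "\<epsilon> = (f y - m) / (2 * p\<^sup>2)"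
  have my: "m < f y" using neg by (simp add: m_def not_le)
  then have \<epsilon>: "\<epsilon> > 0" using p by (simp add: \<epsilon>_def)
  \<comment> \<open>The perturbation is strictly midpoint convex, so it has no interior maximum.\<close>
  define g where "g = (\<lambda>x. f x + \<epsilon> * x\<^sup>2)"
  have "continuous_on {a..b} g" unfolding g_def
    by (intro continuous_intros continuous_on_subset[OF continuous]) (use assms in auto)
  then obtain c where c: "c \<in> {a..b}" "\<And>x. x \<in> {a..b} \<Longrightarrow> g x \<le> g c"
    using continuous_attains_sup[of "{a..b}" g] assms by auto
  have gy: "f y \<le> g c" using c(2)[of y] assms \<epsilon> by (auto simp: g_def intro: order_trans[rotated])
  have end_lt: "g x < f y" if "x = a \<or> x = b" for x
  proof -
    have "\<bar>x\<bar> \<le> p" using that assms by auto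
    then have "x\<^sup>2 \<le> p\<^sup>2" by (metis abs_ge_zero power2_abs power_mono)
    then have "\<epsilon> * x\<^sup>2 \<le> \<epsilon> * p\<^sup>2" using \<epsilon> by (intro mult_left_mono) auto
    also have "\<dots> = (f y - m) / 2" using p by (simp add: \<epsilon>_def)
    finally have "\<epsilon> * x\<^sup>2 \<le> (f y - m) / 2" .
    moreover have "f x \<le> m" using that by (auto simp: m_def)
    ultimately show ?thesis unfolding g_def using my by (simp add: field_simps)
  qed
  then have ne: "c \<noteq> a" "c \<noteq> b" using gy by force+
  define d where "d = min (c - a) (b - c)"
  have d: "d > 0" "c - d \<in> {a..b}" "c + d \<in> {a..b}" using c ne by (auto simp: d_def)
  have "f (((c - d) + (c + d)) / 2) \<le> (f (c - d) + f (c + d)) / 2"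
    by (rule mid) (use d assms in auto)
  then have "2 * f c \<le> f (c - d) + f (c + d)" by simp
  moreover have "\<epsilon> * (c - d)\<^sup>2 + \<epsilon> * (c + d)\<^sup>2 = 2 * (\<epsilon> * c\<^sup>2) + 2 * (\<epsilon> * d\<^sup>2)"
    by (simp add: power2_eq_square algebra_simps)
  moreover have "\<epsilon> * d\<^sup>2 > 0" using \<epsilon> d by simp
  moreover have "2 * (F + v) < F1 + a + (F2 + b)"
    if "2 * F \<le> F1 + F2" "a + b = 2 * v + 2 * w" "0 < w" for F F1 F2 a b v w :: real
    using that by (simp add: algebra_simps)
  ultimately have "2 * g c < g (c - d) + g (c + d)" unfolding g_def by blast
  then show False using c(2)[OF d(2)] c(2)[OF d(3)] by linarith
qed

text \<open>A Cauchy criterion at \<open>p\<close>, where \<open>f\<close> is not controlled. If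
  \<open>f\<close> increases somewhere, quasiconvexity makes it nondecreasing from then on;
  otherwise it is nonincreasing throughout. Either way it is bounded and monotone near
  \<open>p\<close>.\<close>

lemma cauchy_right:
  assumes e: "e > 0"
  shows "\<exists>s. - p < s \<and> s < p \<and> (\<forall>x y. s < x \<and> x < p \<and> s < y \<and> y < p \<longrightarrow> \<bar>f x - f y\<bar> < e)"
proof (cases "\<exists>u v. - p < u \<and> u < v \<and> v < p \<and> f u < f v")
  case True
  then obtain u v where uv: "- p < u" "u < v" "v < p" "f u < f v" by blast
  have up: "f v \<le> f x" if "v \<le> x" "x < p" for x using quasiconvex[of u v x] uv that by auto
  have mono: "f x \<le> f y" if "v \<le> x" "x \<le> y" "y < p" for x y
    using quasiconvex[of u x y] up[of x] uv that by auto
  let ?S = "f ` {v..<p}"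
  have bdd: "bdd_above ?S" using bounds uv by (intro bdd_aboveI[of _ K]) auto
  have "Sup ?S - e < Sup ?S" using e by simp
  then obtain t where t: "t \<in> {v..<p}" "Sup ?S - e < f t"
    using less_cSup_iff[OF _ bdd, of "Sup ?S - e"] uv by auto
  have b: "f t \<le> f x \<and> f x \<le> Sup ?S" if "t < x" "x < p" for x
    using mono[of t x] that t cSup_upper[OF _ bdd, of "f x"] by auto
  show ?thesis
  proof (intro exI[of _ t] conjI allI impI)
    fix x y assume "t < x \<and> x < p \<and> t < y \<and> y < p"
    then show "\<bar>f x - f y\<bar> < e" using b[of x] b[of y] t(2) by linarith
  qed (use t uv in auto)
next
  case False
  then have anti: "f y \<le> f x" if "- p < x" "x \<le> y" "y < p" for x y
    using that by (metis le_less not_less order_refl)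
  let ?S = "f ` {- p<..<p}"
  have bdd: "bdd_below ?S" using bounds by (intro bdd_belowI[of _ 0]) auto
  have "Inf ?S < Inf ?S + e" using e by simp
  then obtain t where t: "t \<in> {- p<..<p}" "f t < Inf ?S + e"
    using cInf_less_iff[OF _ bdd, of "Inf ?S + e"] p by auto
  have b: "Inf ?S \<le> f x \<and> f x \<le> f t" if "t < x" "x < p" for x
    using anti[of t x] that t cInf_lower[OF _ bdd, of "f x"] by auto
  show ?thesis
  proof (intro exI[of _ t] conjI allI impI)
    fix x y assume "t < x \<and> x < p \<and> t < y \<and> y < p"
    then show "\<bar>f x - f y\<bar> < e" using b[of x] b[of y] t(2) by linarith
  qed (use t in auto)
qed

lemma uniformly_continuous: "uniformly_continuous_on {- p<..<p} f"
  unfolding uniformly_continuous_on_def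
proof (intro allI impI)
  fix e :: real assume e: "e > 0"
  interpret r: midpoint_convex_bounded "\<lambda>x. f (- x)" p K by (rule reflect)
  obtain s where s: "- p < s" "s < p" "\<And>x y. s < x \<Longrightarrow> x < p \<Longrightarrow> s < y \<Longrightarrow> y < p \<Longrightarrow> \<bar>f x - f y\<bar> < e"
    using cauchy_right[OF e] by blast
  obtain l where l: "- p < l" "l < p" "\<And>x y. l < x \<Longrightarrow> x < p \<Longrightarrow> l < y \<Longrightarrow> y < p \<Longrightarrow> \<bar>f (- x) - f (- y)\<bar> < e"
    using r.cauchy_right[OF e] by blast
  have l': "\<bar>f x - f y\<bar> < e" if "- p < x" "x < - l" "- p < y" "y < - l" for x y
    using l(3)[of "- x" "- y"] that by auto
  \<comment> \<open>\<open>\<alpha>\<close> and \<open>\<beta>\<close> lie halfway between the ends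
    and the thresholds \<open>- l\<close> and \<open>s\<close>, so the compact middle part overlaps
    both end zones. Points closer than the overlaps share one of the three regions.\<close>
  define \<alpha> where "\<alpha> = (- p - l) / 2"
  define \<beta> where "\<beta> = (p + s) / 2"
  have ab: "- p < \<alpha>" "\<alpha> < - l" "s < \<beta>" "\<beta> < p" using l s by (auto simp: \<alpha>_def \<beta>_def)
  have "uniformly_continuous_on {\<alpha>..\<beta>} f"
    by (intro compact_uniformly_continuous continuous_on_subset[OF continuous]) (use ab in auto)
  then obtain d0 where d0: "d0 > 0" "\<And>x y. x \<in> {\<alpha>..\<beta>} \<Longrightarrow> y \<in> {\<alpha>..\<beta>} \<Longrightarrow> dist y x < d0 \<Longrightarrow> dist (f y) (f x) < e"
    unfolding uniformly_continuous_on_def using e by blast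
  define d where "d = min d0 (min (- l - \<alpha>) (\<beta> - s))"
  have d: "d > 0" "d \<le> d0" "d \<le> - l - \<alpha>" "d \<le> \<beta> - s" using d0 ab by (auto simp: d_def)
  show "\<exists>d>0. \<forall>x\<in>{- p<..<p}. \<forall>x'\<in>{- p<..<p}. dist x' x < d \<longrightarrow> dist (f x') (f x) < e"
  proof (intro exI[of _ d] conjI ballI impI d(1))
    fix x y assume xy: "x \<in> {- p<..<p}" "y \<in> {- p<..<p}" "dist y x < d"
    then have "\<bar>y - x\<bar> < d" by (simp add: dist_real_def)
    then consider "x \<in> {\<alpha>..\<beta>}" "y \<in> {\<alpha>..\<beta>}" | "s < x" "s < y" | "x < - l" "y < - l"
      using d by force
    then show "dist (f y) (f x) < e"
    proof cases
      case 1 then show ?thesis using d0(2) xy d by auto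
    next
      case 2 then show ?thesis using s(3)[of y x] xy by (simp add: dist_real_def)
    next
      case 3 then show ?thesis using l'[of y x] xy by (simp add: dist_real_def)
    qed
  qed
qed

end

text \<open>In the midpoint estimate the factor \<open>A - hline_norm h m\<close> is small once
  \<open>hline_norm h\<close> varies little between the heights. Uniform continuity of this one real
  function thus gives uniform continuity of the trace with values in L^1.\<close>

lemma hardy_uniform_continuity:
  assumes h: "hardy_strip p h K" and p: "p > 0" and e: "e > 0"
  obtains d where "d > 0" "\<And>y z. \<bar>y\<bar> < p \<Longrightarrow> \<bar>z\<bar> < p \<Longrightarrow> \<bar>y - z\<bar> < d \<Longrightarrow>
    (\<integral>x. cmod (h (Complex x y) - h (Complex x z)) \<partial>lborel) < e"
proof -
  interpret M: midpoint_convex_bounded "hline_norm h" p K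
  proof
    show "hline_norm h ((x + y) / 2) \<le> (hline_norm h x + hline_norm h y) / 2" if "- p < x" "x < y" "y < p" for x y
      using hardy_midpoint[OF h that refl] by blast
    show "0 \<le> hline_norm h x \<and> hline_norm h x \<le> K" if "- p < x" "x < p" for x
      using h that by (auto simp: hardy_strip_def hline_norm_def abs_less_iff)
  qed (rule p)
  have K: "K \<ge> 0" using M.bounds[of 0] p by auto
  \<comment> \<open>Solves \<open>32 * (K + 1) * \<epsilon> = e^2\<close>; \<open>K + 1\<close>
    instead of \<open>K\<close> covers \<open>K = 0\<close> and makes the inequality strict.\<close>
  define \<epsilon> where "\<epsilon> = e\<^sup>2 / (32 * (K + 1))"
  have \<epsilon>: "\<epsilon> > 0" using e K by (simp add: \<epsilon>_def)
  obtain d where d: "d > 0" "\<And>x y. x \<in> {- p<..<p} \<Longrightarrow> y \<in> {- p<..<p} \<Longrightarrow> dist y x < d \<Longrightarrow> dist (hline_norm h y) (hline_norm h x) < \<epsilon>"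
    using M.uniformly_continuous \<epsilon> unfolding uniformly_continuous_on_def by blast
  have lt: "(\<integral>x. cmod (h (Complex x y) - h (Complex x z)) \<partial>lborel) < e"
    if yz: "- p < y" "y < z" "z < p" "z - y < d" for y z
  proof -
    define A where "A = (hline_norm h y + hline_norm h z) / 2"
    define m where "m = (y + z) / 2"
    have m: "m \<in> {- p<..<p}" "dist y m < d" "dist z m < d" using yz by (auto simp: m_def dist_real_def field_simps)
    note X = hardy_midpoint[OF h yz(1-3) A_def, folded m_def]
    have "\<bar>hline_norm h y - hline_norm h m\<bar> < \<epsilon>" "\<bar>hline_norm h z - hline_norm h m\<bar> < \<epsilon>"
      using d(2)[OF m(1), of y] d(2)[OF m(1), of z] m yz by (auto simp: dist_real_def)
    then have Am: "A - hline_norm h m < \<epsilon>" by (simp add: A_def field_simps abs_less_iff)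
    have AK: "0 \<le> A" "A \<le> K" using M.bounds[of y] M.bounds[of z] yz by (auto simp: A_def field_simps)
    have "(\<integral>x. cmod (h (Complex x y) - h (Complex x z)) \<partial>lborel)\<^sup>2 \<le> 32 * A * (A - hline_norm h m)" using X by blast
    also have "\<dots> \<le> 32 * K * \<epsilon>" using AK Am X by (intro mult_mono) auto
    also have "\<dots> < 32 * (K + 1) * \<epsilon>" using \<epsilon> by simp
    also have "\<dots> = e\<^sup>2" using K by (simp add: \<epsilon>_def)
    finally show ?thesis using e power_less_imp_less_base[of _ 2 e] by simp
  qed
  show ?thesis
  proof (rule that[OF d(1)])
    fix y z assume yz: "\<bar>y\<bar> < p" "\<bar>z\<bar> < p" "\<bar>y - z\<bar> < d"
    consider "y < z" | "y = z" | "z < y" by linarith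
    then show "(\<integral>x. cmod (h (Complex x y) - h (Complex x z)) \<partial>lborel) < e"
    proof cases
      case 1 then show ?thesis using lt[of y z] yz by auto
    next
      case 3 then show ?thesis using lt[of z y] yz by (auto simp: norm_minus_commute)
    qed (use e in simp)
  qed
qed

section \<open>Approximation in L^1 by dilation and Gaussian damping\<close>

lemma cmod_exp_minus_1_le:
  assumes "Re z \<le> r" "0 \<le> r"
  shows "cmod (exp z - 1) \<le> exp r * cmod z"
proof -
  have "cmod (exp z - exp 0) \<le> exp r * cmod (z - 0)"
  proof (rule field_differentiable_bound[of "closed_segment 0 z"])
    fix w assume "w \<in> closed_segment 0 z"
    then obtain u where u: "0 \<le> u" "u \<le> 1" "w = u *\<^sub>R z" by (auto simp: in_segment)
    have "u * Re z \<le> u * r" using u assms by (intro mult_left_mono) auto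
    also have "\<dots> \<le> 1 * r" using u assms by (intro mult_right_mono) auto
    finally show "cmod (exp w) \<le> exp r" using u by simp
  qed (auto intro!: derivative_eq_intros)
  then show ?thesis by simp
qed

text \<open>With the prefactor \<open>a n\<close> every dilate has the same L^1 norm as
  \<open>u\<close>. Pointwise convergence, which continuity provides, then implies convergence in
  norm by Scheffe's lemma, without a dominating function.\<close>

lemma dilation_tendsto_L1:
  fixes u :: "real \<Rightarrow> complex"
  assumes cont: "continuous_on UNIV u" and int: "integrable lborel u"
    and a: "\<And>n. 0 < a n" "a \<longlonglongrightarrow> (1::real)"
  shows "(\<lambda>n. \<integral>x. cmod (of_real (a n) * u (a n * x) - u x) \<partial>lborel) \<longlonglongrightarrow> 0"
proof -
  have m[measurable]: "u \<in> borel_measurable borel" using cont by (rule borel_measurable_continuous_onI)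
  define F where "F = (\<lambda>n x. of_real (a n) * u (a n * x))"
  have Fint: "integrable lborel (F n)" for n
    using lborel_integrable_real_affine[OF int, of "a n" 0] a(1)[of n] by (simp add: F_def)
  have Fm[measurable]: "F n \<in> borel_measurable borel" for n using Fint by auto
  have eqn: "(\<integral>\<^sup>+x. norm (F n x) \<partial>lborel) = (\<integral>\<^sup>+x. norm (u x) \<partial>lborel)" for n
  proof -
    have "(\<integral>\<^sup>+x. ennreal (norm (u x)) \<partial>lborel) = \<bar>a n\<bar> * (\<integral>\<^sup>+x. ennreal (norm (u (0 + a n * x))) \<partial>lborel)"
      using a(1)[of n] by (intro nn_integral_real_affine) auto
    also have "\<dots> = (\<integral>\<^sup>+x. ennreal \<bar>a n\<bar> * ennreal (norm (u (0 + a n * x))) \<partial>lborel)"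
      by (rule nn_integral_cmult[symmetric]) simp
    also have "\<dots> = (\<integral>\<^sup>+x. norm (F n x) \<partial>lborel)"
      by (simp add: F_def norm_mult ennreal_mult')
    finally show ?thesis by simp
  qed
  have "(\<lambda>n. \<integral>\<^sup>+x. norm (F n x - u x) \<partial>lborel) \<longlonglongrightarrow> 0"
  proof (rule Scheffe_lemma2)
    show "AE x in lborel. (\<lambda>n. F n x) \<longlonglongrightarrow> u x"
    proof (rule AE_I2)
      fix x
      have "(\<lambda>n. a n * x) \<longlonglongrightarrow> 1 * x" by (intro tendsto_intros a)
      then have "(\<lambda>n. u (a n * x)) \<longlonglongrightarrow> u (1 * x)"
        using cont by (intro isCont_tendsto_compose[of "1 * x" u]) (auto simp: continuous_on_eq_continuous_at)
      then have "(\<lambda>n. of_real (a n) * u (a n * x)) \<longlonglongrightarrow> of_real 1 * u (1 * x)"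
        by (intro tendsto_intros a)
      then show "(\<lambda>n. F n x) \<longlonglongrightarrow> u x" by (simp add: F_def)
    qed
  qed (use int eqn in auto)
  then have "(\<lambda>n. ennreal (\<integral>x. norm (F n x - u x) \<partial>lborel)) \<longlonglongrightarrow> ennreal 0"
    using int Fint by (subst nn_integral_eq_integral[symmetric]) auto
  then show ?thesis unfolding F_def
    by (subst (asm) tendsto_ennreal_iff) auto
qed

text \<open>At a fixed height both operations converge by standard limit theorems. Uniformity in the
  height comes from comparing the heights \<open>y\<close> and \<open>a * y\<close> with the points
  of a finite net, at which the fixed-height limits are used. The parameter \<open>a0\<close> allows
  a later demand that \<open>a\<close> be close to 1.\<close>

lemma hardy_dilation_gauss_approx:
  assumes h: "hardy_strip p h K" and p: "p > 0" and e: "e > 0" and a0: "a0 < 1"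
  obtains a \<delta> where "0 < a" "a0 < a" "a < 1" "0 < \<delta>"
    "\<And>y. \<bar>y\<bar> < p \<Longrightarrow> (\<integral>x. cmod (of_real a * h (of_real a * Complex x y) * exp (- (of_real \<delta> * (Complex x y)\<^sup>2)) - h (Complex x y)) \<partial>lborel) < e"
proof -
  have holo: "h holomorphic_on hstrip (- p) p" using h by (simp add: hardy_strip_def)
  note cont = holomorphic_on_imp_continuous_on[OF holo]
  have int: "integrable lborel (\<lambda>x. h (Complex x y))" if "\<bar>y\<bar> < p" for y
    using h that by (simp add: hardy_strip_def)
  have hc: "continuous_on UNIV (\<lambda>x. h (Complex x y))" if "\<bar>y\<bar> < p" for y
    using that by (intro continuous_on_hline[OF cont]) auto
  define Q where "Q = exp (p\<^sup>2)"
  have Q: "Q \<ge> 1" by (simp add: Q_def)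
  \<comment> \<open>The four errors at the end amount to less than
    \<open>2 * Q * \<epsilon> + 2 * \<epsilon>\<close>, which is at most
    \<open>(4 * Q + 1) * \<epsilon>\<close> because \<open>Q \<ge> 1\<close>.\<close>
  define \<epsilon> where "\<epsilon> = e / (4 * Q + 1)"
  have \<epsilon>: "\<epsilon> > 0" using e Q by (simp add: \<epsilon>_def)
  have e_eq: "(4 * Q + 1) * \<epsilon> = e" using Q by (simp add: \<epsilon>_def)
  define a where "a = (\<lambda>n. 1 - 1 / real (Suc (Suc n)))"
  define \<delta> where "\<delta> = (\<lambda>n. 1 / real (Suc n))"
  have a: "0 < a n" "a n < 1" for n by (auto simp: a_def field_simps)
  have \<delta>lim: "\<delta> \<longlonglongrightarrow> 0" unfolding \<delta>_def by (rule LIMSEQ_inverse_real_of_nat[unfolded inverse_eq_divide])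
  have "(\<lambda>n. 1 - \<delta> (Suc n)) \<longlonglongrightarrow> 1 - 0" by (intro tendsto_intros LIMSEQ_Suc \<delta>lim)
  then have alim: "a \<longlonglongrightarrow> 1" by (simp add: a_def \<delta>_def)
  have \<delta>: "0 < \<delta> n" "\<delta> n \<le> 1" for n by (auto simp: \<delta>_def)
  define E where "E = (\<lambda>n x y. exp (- (complex_of_real (\<delta> n) * (Complex x y)\<^sup>2)))"
  \<comment> \<open>A bound for \<open>cmod (E n x y - 1)\<close> free of \<open>y\<close>: the
    constant gives domination, the other entry gives pointwise convergence to 0.\<close>
  define B where "B = (\<lambda>n x. min (1 + Q) (Q * (\<delta> n * (x\<^sup>2 + p\<^sup>2))))"
  have B0: "0 \<le> B n x" "B n x \<le> 1 + Q" for n x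
    using Q \<delta>(1)[of n] by (auto simp: B_def intro!: mult_nonneg_nonneg add_nonneg_nonneg)
  have y2: "y\<^sup>2 \<le> p\<^sup>2" if "\<bar>y\<bar> < p" for y
    using that by (metis abs_ge_zero less_imp_le power2_abs power_mono)
  have Ebd: "cmod (E n x y) \<le> Q" and EB: "cmod (E n x y - 1) \<le> B n x" if y: "\<bar>y\<bar> < p" for n x y
  proof -
    have "\<delta> n * y\<^sup>2 \<le> 1 * p\<^sup>2" using y2[OF y] \<delta>[of n] by (intro mult_mono) auto
    moreover have "0 \<le> \<delta> n * x\<^sup>2" using \<delta>(1)[of n] by simp
    moreover have "Re (- (complex_of_real (\<delta> n) * (Complex x y)\<^sup>2)) = \<delta> n * y\<^sup>2 - \<delta> n * x\<^sup>2"
      by (simp add: power2_eq_square algebra_simps)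
    ultimately have R: "Re (- (complex_of_real (\<delta> n) * (Complex x y)\<^sup>2)) \<le> p\<^sup>2" by linarith
    then show 1: "cmod (E n x y) \<le> Q" unfolding E_def Q_def norm_exp_eq_Re by simp
    have "cmod (E n x y - 1) \<le> 1 + Q" using norm_triangle_ineq4[of "E n x y" 1] 1 by simp
    moreover have "cmod (E n x y - 1) \<le> Q * cmod (- (complex_of_real (\<delta> n) * (Complex x y)\<^sup>2))"
      unfolding E_def Q_def by (rule cmod_exp_minus_1_le[OF R]) simp
    moreover have "cmod (- (complex_of_real (\<delta> n) * (Complex x y)\<^sup>2)) \<le> \<delta> n * (x\<^sup>2 + p\<^sup>2)"
      using y2[OF y] \<delta>(1)[of n] by (simp add: norm_mult norm_power cmod_power2)
    then have "Q * cmod (- (complex_of_real (\<delta> n) * (Complex x y)\<^sup>2)) \<le> Q * (\<delta> n * (x\<^sup>2 + p\<^sup>2))"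
      using Q by (intro mult_left_mono) auto
    ultimately show "cmod (E n x y - 1) \<le> B n x" by (simp add: B_def)
  qed
  obtain d where d: "d > 0" "\<And>y z. \<bar>y\<bar> < p \<Longrightarrow> \<bar>z\<bar> < p \<Longrightarrow> \<bar>y - z\<bar> < d \<Longrightarrow>
    (\<integral>x. cmod (h (Complex x y) - h (Complex x z)) \<partial>lborel) < \<epsilon>"
    using hardy_uniform_continuity[OF h p \<epsilon>] by blast
  obtain Z where Z: "finite Z" "Z \<subseteq> {- p<..<p}" "{- p<..<p} \<subseteq> (\<Union>z\<in>Z. ball z (d / 2))"
  proof -
    \<comment> \<open>Compactness needs the closed interval, but the centres must be interior, since
      traces exist only there.\<close>
    have "{- p..p} \<subseteq> (\<Union>z\<in>{- p<..<p}. ball z (d / 2))"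
    proof
      fix x assume "x \<in> {- p..p}"
      then have "x \<in> closure {- p<..<p}" using p by (simp add: closure_greaterThanLessThan)
      then obtain z where "z \<in> {- p<..<p}" "dist z x < d / 2"
        using d(1) unfolding closure_approachable by (meson half_gt_zero)
      then show "x \<in> (\<Union>z\<in>{- p<..<p}. ball z (d / 2))" by auto
    qed
    then obtain Z where "Z \<subseteq> {- p<..<p}" "finite Z" "{- p..p} \<subseteq> (\<Union>z\<in>Z. ball z (d / 2))"
      using compactE_image[of "{- p..p}" "{- p<..<p}" "\<lambda>z. ball z (d / 2)"] by auto
    then show ?thesis by (intro that[of Z]) auto
  qed
  define E1 where "E1 = (\<lambda>n z. \<integral>x. cmod (of_real (a n) * h (Complex (a n * x) z) - h (Complex x z)) \<partial>lborel)"
  define E2 where "E2 = (\<lambda>n z. \<integral>x. B n x * cmod (h (Complex x z)) \<partial>lborel)"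
  have Bm[measurable]: "B n \<in> borel_measurable borel" for n unfolding B_def by measurable
  have hm: "(\<lambda>x. h (Complex x z)) \<in> borel_measurable borel" if "\<bar>z\<bar> < p" for z
    using int[OF that] by auto
  have intB: "integrable lborel (\<lambda>x. B n x * cmod (h (Complex x z)))" if "\<bar>z\<bar> < p" for n z
  proof (rule Bochner_Integration.integrable_bound[of _ "\<lambda>x. (1 + Q) * cmod (h (Complex x z))"])
    show "integrable lborel (\<lambda>x. (1 + Q) * cmod (h (Complex x z)))" using int[OF that] by simp
    show "AE x in lborel. norm (B n x * cmod (h (Complex x z))) \<le> norm ((1 + Q) * cmod (h (Complex x z)))"
      using B0 Q by (intro AE_I2) (auto simp: abs_mult intro!: mult_right_mono)
  qed (use hm[OF that] in measurable)
  have E1lim: "(\<lambda>n. E1 n z) \<longlonglongrightarrow> 0" if "\<bar>z\<bar> < p" for z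
    unfolding E1_def by (rule dilation_tendsto_L1[OF hc[OF that] int[OF that] a(1) alim])
  have E2lim: "(\<lambda>n. E2 n z) \<longlonglongrightarrow> 0" if z: "\<bar>z\<bar> < p" for z
  proof -
    have "(\<lambda>n. E2 n z) \<longlonglongrightarrow> integral\<^sup>L lborel (\<lambda>x::real. 0 :: real)" unfolding E2_def
    proof (rule integral_dominated_convergence[where w = "\<lambda>x. (1 + Q) * cmod (h (Complex x z))"])
      show "integrable lborel (\<lambda>x. (1 + Q) * cmod (h (Complex x z)))" using int[OF z] by simp
      show "AE x in lborel. norm (B n x * cmod (h (Complex x z))) \<le> (1 + Q) * cmod (h (Complex x z))" for n
        using B0 Q by (intro AE_I2) (auto simp: abs_mult intro!: mult_right_mono)
      show "AE x in lborel. (\<lambda>n. B n x * cmod (h (Complex x z))) \<longlonglongrightarrow> 0"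
      proof (rule AE_I2)
        fix x
        have "(\<lambda>n. B n x * cmod (h (Complex x z))) \<longlonglongrightarrow> min (1 + Q) (Q * (0 * (x\<^sup>2 + p\<^sup>2))) * cmod (h (Complex x z))"
          unfolding B_def by (intro tendsto_intros \<delta>lim)
        then show "(\<lambda>n. B n x * cmod (h (Complex x z))) \<longlonglongrightarrow> 0" using Q by simp
      qed
    qed (use hm[OF z] in measurable)
    then show ?thesis by simp
  qed
  \<comment> \<open>The last condition makes \<open>(1 - a n) * p < d / 2\<close>, so a net point
    within \<open>d / 2\<close> of \<open>y\<close> is within \<open>d\<close> of
    \<open>a n * y\<close>.\<close>
  have "eventually (\<lambda>n. (\<forall>z\<in>Z. E1 n z < \<epsilon> \<and> E2 n z < \<epsilon>) \<and> a0 < a n \<and> 1 - d / (2 * p) < a n) sequentially"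
  proof (intro eventually_conj eventually_ball_finite Z(1) ballI)
    fix z assume "z \<in> Z"
    then have "\<bar>z\<bar> < p" using Z(2) by (force simp: abs_less_iff)
    then show "eventually (\<lambda>n. E1 n z < \<epsilon>) sequentially" "eventually (\<lambda>n. E2 n z < \<epsilon>) sequentially"
      using order_tendstoD(2)[OF E1lim \<epsilon>] order_tendstoD(2)[OF E2lim \<epsilon>] by auto
  qed (use order_tendstoD(1)[OF alim] a0 d(1) p in auto)
  then obtain n where n: "\<And>z. z \<in> Z \<Longrightarrow> E1 n z < \<epsilon>" "\<And>z. z \<in> Z \<Longrightarrow> E2 n z < \<epsilon>" "a0 < a n" "1 - d / (2 * p) < a n"
    by (auto simp: eventually_sequentially)
  show ?thesis
  proof (rule that[of "a n" "\<delta> n"])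
    fix y assume y: "\<bar>y\<bar> < p"
    define b where "b = a n"
    have b: "0 < b" "b < 1" using a by (auto simp: b_def)
    have "y \<in> (\<Union>z\<in>Z. ball z (d / 2))" using Z(3) y by (force simp: abs_less_iff)
    then obtain z where z: "z \<in> Z" "\<bar>y - z\<bar> < d / 2" by (auto simp: dist_real_def abs_minus_commute)
    have zp: "\<bar>z\<bar> < p" using z Z(2) by (force simp: abs_less_iff)
    have byp: "\<bar>b * y\<bar> < p"
      using b y mult_strict_mono[of b 1 "\<bar>y\<bar>" p] p by (cases "y = 0") (auto simp: abs_mult)
    have "(1 - b) * \<bar>y\<bar> \<le> (1 - b) * p" using b y by (intro mult_left_mono) auto
    also have "\<dots> < d / (2 * p) * p" using n(4) p by (intro mult_strict_right_mono) (auto simp: b_def)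
    also have "\<dots> = d / 2" using p by simp
    finally have "(1 - b) * \<bar>y\<bar> < d / 2" .
    moreover have "\<bar>y - b * y\<bar> = (1 - b) * \<bar>y\<bar>"
    proof -
      have "y - b * y = (1 - b) * y" by (simp add: algebra_simps)
      then show ?thesis using b by (simp add: abs_mult)
    qed
    ultimately have "\<bar>y - b * y\<bar> < d / 2" by simp
    then have byz: "\<bar>b * y - z\<bar> < d" using z(2) by linarith
    define D1 where "D1 = (\<lambda>x. cmod (h (Complex x (b * y)) - h (Complex x z)))"
    have D1i: "integrable lborel D1" unfolding D1_def using int[OF byp] int[OF zp] by simp
    have D1b: "integrable lborel (\<lambda>x. D1 (b * x))"
      using lborel_integrable_real_affine[OF D1i, of b 0] b by simp
    have D1e: "b * (\<integral>x. D1 (b * x) \<partial>lborel) < \<epsilon>"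
      using lborel_integral_real_affine[of b D1 0] b d(2)[OF byp zp byz] by (simp add: D1_def)
    define D2 where "D2 = (\<lambda>x. cmod (of_real b * h (Complex (b * x) z) - h (Complex x z)))"
    have bz: "integrable lborel (\<lambda>x. h (Complex (b * x) z))"
      using lborel_integrable_real_affine[OF int[OF zp], of b 0] b by simp
    have D2i: "integrable lborel D2" unfolding D2_def using bz int[OF zp] by simp
    define D3 where "D3 = (\<lambda>x. cmod (h (Complex x y) - h (Complex x z)))"
    have D3i: "integrable lborel D3" unfolding D3_def using int[OF y] int[OF zp] by simp
    have D3e: "(\<integral>x. D3 x \<partial>lborel) < \<epsilon>" unfolding D3_def
      using d(2)[OF y zp] z(2) d(1) by simp
    have "(\<integral>x. cmod (of_real b * h (of_real b * Complex x y) * E n x y - h (Complex x y)) \<partial>lborel)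
      \<le> (\<integral>x. Q * (b * D1 (b * x)) + Q * D2 x + B n x * cmod (h (Complex x z)) + D3 x \<partial>lborel)"
    proof (rule integral_mono')
      show "integrable lborel (\<lambda>x. Q * (b * D1 (b * x)) + Q * D2 x + B n x * cmod (h (Complex x z)) + D3 x)"
        using D1b D2i intB[OF zp] D3i by simp
      fix x
      let ?E = "E n x y" and ?u = "h (Complex (b * x) (b * y))" and ?v = "h (Complex (b * x) z)" and ?z = "h (Complex x z)"
      have eq: "of_real b * Complex x y = Complex (b * x) (b * y)" by (simp add: complex_eq_iff)
      \<comment> \<open>In order: move from height \<open>b * y\<close> to the net height
        \<open>z\<close>, undo the dilation at \<open>z\<close>, remove the Gaussian at
        \<open>z\<close>, return from \<open>z\<close> to \<open>y\<close>.\<close>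
      have "of_real b * ?u * ?E - h (Complex x y)
        = ?E * (of_real b * (?u - ?v)) + ?E * (of_real b * ?v - ?z) + (?E - 1) * ?z + (?z - h (Complex x y))"
        by (simp add: algebra_simps)
      also have "cmod \<dots> \<le> cmod (?E * (of_real b * (?u - ?v))) + cmod (?E * (of_real b * ?v - ?z)) + cmod ((?E - 1) * ?z) + cmod (?z - h (Complex x y))"
        by (intro norm_triangle_mono order_refl)
      also have "\<dots> \<le> Q * (b * D1 (b * x)) + Q * D2 x + B n x * cmod (h (Complex x z)) + D3 x"
        unfolding norm_mult D1_def D2_def D3_def
        using Ebd[OF y, of n x] EB[OF y, of n x] b Q B0(1)[of n x]
        by (intro add_mono mult_mono) (auto simp: norm_minus_commute)
      finally show "cmod (of_real b * h (of_real b * Complex x y) * E n x y - h (Complex x y))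
         \<le> Q * (b * D1 (b * x)) + Q * D2 x + B n x * cmod (h (Complex x z)) + D3 x" unfolding eq .
    qed (use Q b B0 in \<open>auto simp: D1_def D2_def D3_def intro!: add_nonneg_nonneg\<close>)
    also have "\<dots> = Q * (b * (\<integral>x. D1 (b * x) \<partial>lborel)) + Q * E1 n z + E2 n z + (\<integral>x. D3 x \<partial>lborel)"
      using D1b D2i intB[OF zp] D3i by (simp add: E1_def E2_def D2_def b_def)
    also have "\<dots> < Q * \<epsilon> + Q * \<epsilon> + \<epsilon> + \<epsilon>"
      using D1e D3e n(1)[OF z(1)] n(2)[OF z(1)] Q
      by (intro add_strict_mono mult_strict_left_mono) auto
    also have "\<dots> \<le> (4 * Q + 1) * \<epsilon>"
    proof -
      have "1 * \<epsilon> \<le> Q * \<epsilon>" using Q \<epsilon> by (intro mult_right_mono) auto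
      moreover have "(4 * Q + 1) * \<epsilon> = 4 * (Q * \<epsilon>) + \<epsilon>" by (simp add: algebra_simps)
      moreover have "0 \<le> Q * \<epsilon>" using Q \<epsilon> by simp
      ultimately show ?thesis by simp
    qed
    finally show "(\<integral>x. cmod (of_real (a n) * h (of_real (a n) * Complex x y) * exp (- (of_real (\<delta> n) * (Complex x y)\<^sup>2)) - h (Complex x y)) \<partial>lborel) < e"
      unfolding e_eq by (simp add: b_def E_def)
  qed (use a \<delta> n in auto)
qed

section \<open>The resolvent kernel on the strip\<close>

text \<open>
  In the coordinate $z = e^w$ one has $e^w \frac{d}{dz} \frac{\lambda}{\lambda + z} = \kappa(\omega - w)$ for
  $\lambda = -e^\omega$, where $\kappa$ is the following kernel.
\<close>

definition kern :: "complex \<Rightarrow> complex" where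
  "kern u = exp u / (exp u - 1)\<^sup>2"

definition kern' :: "complex \<Rightarrow> complex" where
  "kern' u = - (exp u * (exp u + 1)) / (exp u - 1) ^ 3"

lemma has_field_derivative_kern:
  assumes "exp u \<noteq> 1"
  shows "(kern has_field_derivative kern' u) (at u)"
proof -
  define E where "E = exp u"
  have E: "E - 1 \<noteq> 0" using assms by (simp add: E_def)
  have "(kern has_field_derivative (exp u * (exp u - 1)\<^sup>2 - exp u * (2 * (exp u - 1) * exp u)) / ((exp u - 1)\<^sup>2 * (exp u - 1)\<^sup>2)) (at u)"
    unfolding kern_def using assms by (auto intro!: derivative_eq_intros simp: power2_eq_square)
  also have "(exp u * (exp u - 1)\<^sup>2 - exp u * (2 * (exp u - 1) * exp u)) / ((exp u - 1)\<^sup>2 * (exp u - 1)\<^sup>2) = kern' u"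
  proof -
    have "(E * (E - 1)\<^sup>2 - E * (2 * (E - 1) * E)) = - (E * (E + 1)) * (E - 1)"
      by (simp add: power2_eq_square algebra_simps)
    moreover have "(E - 1)\<^sup>2 * (E - 1)\<^sup>2 = (E - 1) ^ 3 * (E - 1)"
      by (simp add: power2_eq_square power3_eq_cube)
    ultimately show ?thesis using E unfolding kern'_def E_def[symmetric] by simp
  qed
  finally show ?thesis .
qed

lemma exp_eq_1_strip: "exp u = 1 \<Longrightarrow> \<bar>Im u\<bar> < 2 * pi \<Longrightarrow> u = 0"
proof -
  assume "exp u = 1" and I: "\<bar>Im u\<bar> < 2 * pi"
  then obtain n :: int where R: "Re u = 0" and n: "Im u = of_int (2 * n) * pi" unfolding exp_eq_1 by auto
  have "\<bar>of_int (2 * n) :: real\<bar> * pi < 2 * pi" using I unfolding n by (simp add: abs_mult)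
  then have "\<bar>of_int (2 * n) :: real\<bar> < 2" by (rule mult_right_less_imp_less) simp
  then have "n = 0" by simp
  then show "u = 0" using R n by (simp add: complex_eq_iff)
qed

text \<open>Extracting \<open>exp (Re u)\<close> leaves an expression even in \<open>Re u\<close>,
  in which the imaginary part enters only through its cosine. Decay in both directions can then be
  read off from \<open>cosh\<close>.\<close>

lemma cmod_exp_minus_1_sq: "(cmod (exp u - 1))\<^sup>2 = exp (Re u) * (2 * cosh (Re u) - 2 * cos (Im u))"
  and cmod_exp_plus_1_sq: "(cmod (exp u + 1))\<^sup>2 = exp (Re u) * (2 * cosh (Re u) + 2 * cos (Im u))"
proof -
  have e: "exp (Re u) * exp (- Re u) = 1" by (simp flip: exp_add)
  have sc: "(cos (Im u))\<^sup>2 = 1 - (sin (Im u))\<^sup>2" by (simp add: cos_squared_eq)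
  have "exp (Re u) * (2 * cosh (Re u)) = (exp (Re u))\<^sup>2 + 1"
    using e by (simp add: cosh_def field_simps power2_eq_square)
  then have "exp (Re u) * (2 * cosh (Re u) - 2 * cos (Im u)) = (exp (Re u))\<^sup>2 + 1 - 2 * exp (Re u) * cos (Im u)"
    "exp (Re u) * (2 * cosh (Re u) + 2 * cos (Im u)) = (exp (Re u))\<^sup>2 + 1 + 2 * exp (Re u) * cos (Im u)"
    by (simp_all add: algebra_simps)
  moreover have "(cmod (exp u - 1))\<^sup>2 = (exp (Re u))\<^sup>2 + 1 - 2 * exp (Re u) * cos (Im u)"
    "(cmod (exp u + 1))\<^sup>2 = (exp (Re u))\<^sup>2 + 1 + 2 * exp (Re u) * cos (Im u)"
    using sc by (simp_all add: cmod_power2 Re_exp Im_exp power2_diff power2_sum power_mult_distrib) (simp_all add: algebra_simps)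
  ultimately show "(cmod (exp u - 1))\<^sup>2 = exp (Re u) * (2 * cosh (Re u) - 2 * cos (Im u))"
    "(cmod (exp u + 1))\<^sup>2 = exp (Re u) * (2 * cosh (Re u) + 2 * cos (Im u))" by simp_all
qed

lemma cos_le_cos_abs:
  assumes "0 < \<theta>" "\<theta> \<le> \<bar>y\<bar>" "\<bar>y\<bar> \<le> 2 * pi - \<theta>"
  shows "cos y \<le> cos \<theta>"
proof (cases "\<bar>y\<bar> \<le> pi")
  case True
  then have "cos \<bar>y\<bar> \<le> cos \<theta>" using assms by (intro cos_monotone_0_pi_le) auto
  then show ?thesis by simp
next
  case False
  then have "cos (2 * pi - \<bar>y\<bar>) \<le> cos \<theta>" using assms by (intro cos_monotone_0_pi_le) auto
  then show ?thesis by (simp add: cos_diff)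
qed

text \<open>The poles of \<open>kern\<close> at imaginary parts 0 and 2 pi in modulus are at
  vertical distance at least \<open>\<theta>\<close>, so
  \<open>cos (Im u) \<le> cos \<theta> < 1\<close> and the squared denominator is at least
  \<open>(1 - cos \<theta>) * exp (Re u) * cosh (Re u)\<close>. The derivative is
  \<open>kern\<close> times a quotient bounded by \<open>s\<close>.\<close>

lemma kern_bounds:
  assumes \<theta>: "0 < \<theta>" "\<theta> \<le> pi"
  obtains C where "C > 0" "\<And>u. \<theta> \<le> \<bar>Im u\<bar> \<Longrightarrow> \<bar>Im u\<bar> \<le> 2 * pi - \<theta> \<Longrightarrow>
     exp u \<noteq> 1 \<and> cmod (kern u) \<le> C * exp (- \<bar>Re u\<bar>) \<and> cmod (kern' u) \<le> C * exp (- \<bar>Re u\<bar>)"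
proof -
  define c where "c = 1 - cos \<theta>"
  have "cos \<theta> < cos 0" using \<theta> by (intro cos_monotone_0_pi) auto
  then have c: "c > 0" by (simp add: c_def)
  define s where "s = sqrt (4 / c)"
  have s: "s > 0" using c by (simp add: s_def)
  define C where "C = 2 / c * (1 + s)"
  have main: "exp u \<noteq> 1 \<and> cmod (kern u) \<le> 2 / c * exp (- \<bar>Re u\<bar>) \<and> cmod (kern' u) \<le> 2 / c * exp (- \<bar>Re u\<bar>) * s"
    if u: "\<theta> \<le> \<bar>Im u\<bar>" "\<bar>Im u\<bar> \<le> 2 * pi - \<theta>" for u
  proof -
    have ch: "cosh (Re u) \<ge> 1" by (rule cosh_real_ge_1)
    have cosu: "cos (Im u) \<le> cos \<theta>" using cos_le_cos_abs[OF \<theta>(1) u] .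
    have low: "c * cosh (Re u) \<le> 2 * cosh (Re u) - 2 * cos (Im u)"
    proof -
      have "(1 + cos \<theta>) * 1 \<le> (1 + cos \<theta>) * cosh (Re u)" using ch cos_ge_minus_one[of \<theta>] by (intro mult_left_mono) linarith+
      then have "1 + cos \<theta> \<le> cosh (Re u) + cos \<theta> * cosh (Re u)" by (simp add: algebra_simps)
      moreover have "c * cosh (Re u) = cosh (Re u) - cos \<theta> * cosh (Re u)" by (simp add: c_def algebra_simps)
      ultimately show ?thesis using cosu cos_le_one[of \<theta>] by linarith
    qed
    have pos: "c * cosh (Re u) > 0" using c ch by simp
    have D: "(cmod (exp u - 1))\<^sup>2 \<ge> exp (Re u) * (c * cosh (Re u))"
      unfolding cmod_exp_minus_1_sq using low by simp
    have Dpos: "(cmod (exp u - 1))\<^sup>2 > 0" using D pos by (meson exp_gt_zero mult_pos_pos order_less_le_trans)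
    then have ne: "exp u \<noteq> 1" by auto
    have exp_ch: "exp \<bar>Re u\<bar> \<le> 2 * cosh (Re u)" by (cases "Re u \<ge> 0") (auto simp: cosh_def)
    have "cmod (kern u) = exp (Re u) / (cmod (exp u - 1))\<^sup>2"
      by (simp add: kern_def norm_divide norm_power)
    also have "\<dots> \<le> exp (Re u) / (exp (Re u) * (c * cosh (Re u)))"
      by (intro divide_left_mono D mult_pos_pos Dpos) (use c ch in auto)
    also have "\<dots> = 1 / (c * cosh (Re u))" by simp
    also have "\<dots> \<le> 1 / (c * (exp \<bar>Re u\<bar> / 2))"
      using exp_ch c pos by (intro divide_left_mono mult_left_mono mult_pos_pos) auto
    also have "\<dots> = 2 / c * exp (- \<bar>Re u\<bar>)" by (simp add: exp_minus field_simps)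
    finally have k: "cmod (kern u) \<le> 2 / c * exp (- \<bar>Re u\<bar>)" .
    have "(cmod ((exp u + 1) / (exp u - 1)))\<^sup>2 = (cmod (exp u + 1))\<^sup>2 / (cmod (exp u - 1))\<^sup>2"
      by (simp add: norm_divide power_divide)
    also have "\<dots> \<le> (exp (Re u) * (4 * cosh (Re u))) / (exp (Re u) * (c * cosh (Re u)))"
    proof (rule frac_le)
      have "2 * cosh (Re u) + 2 * cos (Im u) \<le> 4 * cosh (Re u)" using ch cos_le_one[of "Im u"] by linarith
      then show "(cmod (exp u + 1))\<^sup>2 \<le> exp (Re u) * (4 * cosh (Re u))"
        unfolding cmod_exp_plus_1_sq by (intro mult_left_mono) auto
    qed (use D pos ch in auto)
    also have "\<dots> = 4 / c" using ch by simp
    finally have "cmod ((exp u + 1) / (exp u - 1)) \<le> s" unfolding s_def by (rule real_le_rsqrt)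
    moreover have "kern' u = - (kern u * ((exp u + 1) / (exp u - 1)))"
      using ne by (simp add: kern_def kern'_def power2_eq_square power3_eq_cube)
    ultimately have "cmod (kern' u) \<le> (2 / c * exp (- \<bar>Re u\<bar>)) * s"
      using k c by (simp only: norm_minus_cancel norm_mult) (intro mult_mono, auto)
    with ne k show ?thesis by simp
  qed
  show ?thesis
  proof (rule that[of C])
    show "C > 0" using c s by (simp add: C_def add_pos_pos)
    fix u assume u: "\<theta> \<le> \<bar>Im u\<bar>" "\<bar>Im u\<bar> \<le> 2 * pi - \<theta>"
    have "2 / c * exp (- \<bar>Re u\<bar>) \<ge> 0" using c by simp
    moreover have "2 / c * exp (- \<bar>Re u\<bar>) * s \<ge> 0" using c s by simp
    moreover have "C * exp (- \<bar>Re u\<bar>) = 2 / c * exp (- \<bar>Re u\<bar>) + 2 / c * exp (- \<bar>Re u\<bar>) * s"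
      unfolding C_def by (simp only: distrib_left distrib_right mult_1_right mult.assoc mult.commute[of s])
    ultimately have "2 / c * exp (- \<bar>Re u\<bar>) \<le> C * exp (- \<bar>Re u\<bar>)" "2 / c * exp (- \<bar>Re u\<bar>) * s \<le> C * exp (- \<bar>Re u\<bar>)"
      by linarith+
    then show "exp u \<noteq> 1 \<and> cmod (kern u) \<le> C * exp (- \<bar>Re u\<bar>) \<and> cmod (kern' u) \<le> C * exp (- \<bar>Re u\<bar>)"
      using main[OF u] by force
  qed
qed

text \<open>For vertical segments, on which the imaginary part of the argument can cross 0 and only
  horizontal distance separates it from the pole.\<close>

lemma kern_bound_far:
  assumes "\<bar>Re u\<bar> \<ge> 1"
  shows "cmod (kern u) \<le> 4"
proof -
  have e2: "exp 1 \<ge> (2::real)" using exp_ge_add_one_self[of 1] by simp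
  define x where "x = Re u"
  have low: "\<bar>exp x - 1\<bar> \<le> cmod (exp u - 1)"
    using norm_triangle_ineq3[of "exp u" 1] by (simp add: x_def)
  have sq: "t \<le> 4 * (t - 1)\<^sup>2" if "t \<ge> 2 \<or> t \<le> 1/2" for t :: real
  proof -
    \<comment> \<open>The sum equals \<open>4 * (t - 1)^2 - t\<close>. Its first summand is
      nonnegative outside (1/2, 2), its second is \<open>2 * (t - 1)^2\<close>.\<close>
    have "0 \<le> (2 * t - 1) * (t - 2) + (2 * t\<^sup>2 - 4 * t + 2)"
    proof (rule add_nonneg_nonneg)
      show "0 \<le> (2 * t - 1) * (t - 2)" using that by (auto intro: mult_nonneg_nonneg mult_nonpos_nonpos)
      have "2 * t\<^sup>2 - 4 * t + 2 = 2 * (t - 1)\<^sup>2" by (simp add: power2_eq_square algebra_simps)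
      then show "0 \<le> 2 * t\<^sup>2 - 4 * t + 2" by simp
    qed
    then show ?thesis by (simp add: power2_eq_square algebra_simps)
  qed
  have key: "exp x \<le> 4 * (exp x - 1)\<^sup>2"
  proof (rule sq, cases "x \<ge> 0")
    case True
    then have "exp 1 \<le> exp x" using assms by (simp add: x_def)
    then show "exp x \<ge> 2 \<or> exp x \<le> 1/2" using e2 by linarith
  next
    case False
    then have "exp x \<le> exp (-1)" using assms by (simp add: x_def)
    also have "\<dots> \<le> 1/2" using e2 by (simp add: exp_minus divide_simps)
    finally show "exp x \<ge> 2 \<or> exp x \<le> 1/2" by blast
  qed
  have "(exp x - 1)\<^sup>2 \<le> (cmod (exp u - 1))\<^sup>2" using low by (metis abs_ge_zero power2_abs power_mono)
  then have "exp x \<le> 4 * (cmod (exp u - 1))\<^sup>2" using key by linarith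
  then have "exp x / (cmod (exp u - 1))\<^sup>2 \<le> 4" by (cases "exp u = 1") (auto simp: divide_le_eq)
  then show ?thesis by (simp add: kern_def norm_divide norm_power x_def)
qed

text \<open>Exponential decay of \<open>g\<close> gives any primitive a limit at plus infinity along
  the real axis, and \<open>mean\<close> says that the limit at minus infinity is the same.
  Subtracting it gives decay at both ends; integrating \<open>g\<close> vertically carries the bound
  to the other heights, which costs the term \<open>C * Y\<close>.\<close>

lemma zero_mean_primitive:
  assumes Y: "Y > 0" and holo: "g holomorphic_on hstrip (- Y) Y"
    and bd: "\<And>w. w \<in> hstrip (- Y) Y \<Longrightarrow> cmod (g w) \<le> C * exp (- \<bar>Re w\<bar>)"
    and mean: "(\<integral>x. g (Complex x 0) \<partial>lborel) = 0"
  obtains P D where "\<And>w. w \<in> hstrip (- Y) Y \<Longrightarrow> (P has_field_derivative g w) (at w)"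
    "\<And>w. w \<in> hstrip (- Y) Y \<Longrightarrow> cmod (P w) \<le> D * exp (- \<bar>Re w\<bar>)"
proof -
  obtain P0 where P0: "\<And>w. w \<in> hstrip (- Y) Y \<Longrightarrow> (P0 has_field_derivative g w) (at w)"
    using hstrip_primitive[OF holo] by blast
  note cont = holomorphic_on_imp_continuous_on[OF holo]
  define F where "F = (\<lambda>x. P0 (Complex x 0))"
  have F': "(F has_vector_derivative g (Complex x 0)) (at x)" for x
    unfolding F_def by (rule has_vector_derivative_hline[OF P0]) (use Y in auto)
  then have Fc: "continuous_on A F" for A
    by (meson continuous_at_imp_continuous_on has_vector_derivative_continuous)
  have bd0: "cmod (g (Complex x 0)) \<le> C * exp (- \<bar>x\<bar>)" for x using bd[of "Complex x 0"] Y by simp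
  have C0: "C \<ge> 0" using order_trans[OF norm_ge_zero bd0[of 0]] by simp
  have right: "cmod (F z - F x) \<le> C * exp (- x)" if "0 \<le> x" "x < z" for x z
  proof -
    have "cmod (F z - F x) \<le> - C * exp (- z) - (- C * exp (- x))"
      by (rule differentiable_bound_general[OF that(2) Fc _ F', where \<phi>' = "\<lambda>x. C * exp (- x)"])
         (use that bd0 in \<open>auto intro!: continuous_intros derivative_eq_intros simp flip: has_real_derivative_iff_has_vector_derivative\<close>,
          metis abs_of_nonneg bd0 less_imp_le order_trans)
    also have "\<dots> \<le> C * exp (- x)" using C0 by simp
    finally show ?thesis .
  qed
  have left: "cmod (F z - F x) \<le> C * exp z" if "x < z" "z \<le> 0" for x z
  proof -
    have "cmod (F z - F x) \<le> C * exp z - C * exp x"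
    proof (rule differentiable_bound_general[OF that(1) Fc _ F', where \<phi>' = "\<lambda>x. C * exp x"])
      show "cmod (g (Complex t 0)) \<le> C * exp t" if "x < t" "t < z" for t
        using bd0[of t] that \<open>z \<le> 0\<close> by simp
    qed (auto intro!: continuous_intros derivative_eq_intros simp flip: has_real_derivative_iff_has_vector_derivative)
    also have "\<dots> \<le> C * exp z" using C0 by simp
    finally show ?thesis .
  qed
  have Cexp: "(\<lambda>n. C * exp (- real n)) \<longlonglongrightarrow> 0"
    using tendsto_mult_right_zero[OF tendsto_exp_minus_nat] by simp
  have "Cauchy (\<lambda>n. F (real n))"
  proof (rule metric_CauchyI)
    fix e :: real assume e: "e > 0"
    obtain N where N: "\<And>n. n \<ge> N \<Longrightarrow> C * exp (- real n) < e"
      using order_tendstoD(2)[OF Cexp e] by (auto simp: eventually_sequentially)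
    have lt: "cmod (F (real n) - F (real m)) < e" if "N \<le> m" "m < n" for m n
      using right[of "real m" "real n"] N[OF that(1)] that by simp
    show "\<exists>M. \<forall>m\<ge>M. \<forall>n\<ge>M. dist (F (real m)) (F (real n)) < e"
    proof (intro exI[of _ N] allI impI)
      fix m n assume "N \<le> m" "N \<le> n"
      then show "dist (F (real m)) (F (real n)) < e"
        using lt[of m n] lt[of n m] e by (cases m n rule: linorder_cases) (auto simp: dist_norm norm_minus_commute)
    qed
  qed
  then obtain c where c: "(\<lambda>n. F (real n)) \<longlonglongrightarrow> c" using Cauchy_convergent convergent_def by blast
  have "(\<lambda>n. F (real n) - F (- real n)) \<longlonglongrightarrow> (\<integral>x. g (Complex x 0) \<partial>lborel)"
  proof (rule tendsto_primitive_diff_integral[OF F'])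
    show cg: "continuous_on UNIV (\<lambda>x. g (Complex x 0))" by (rule continuous_on_hline[OF cont]) (use Y in auto)
    show "integrable lborel (\<lambda>x. g (Complex x 0))"
      by (rule integrable_of_exp_bound[OF borel_measurable_continuous_onI[OF cg] bd0])
  qed
  then have "(\<lambda>n. F (real n) - F (- real n)) \<longlonglongrightarrow> 0" using mean by simp
  from tendsto_diff[OF c this] have c': "(\<lambda>n. F (- real n)) \<longlonglongrightarrow> c" by simp
  have Fbd: "cmod (F x - c) \<le> C * exp (- \<bar>x\<bar>)" for x
  proof (cases "x \<ge> 0")
    case True
    have "cmod (c - F x) \<le> C * exp (- x)"
    proof (rule LIMSEQ_le_const2[OF tendsto_norm[OF tendsto_diff[OF c tendsto_const]]])
      obtain N where N: "x < real N" using reals_Archimedean2 by blast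
      show "\<exists>N. \<forall>n\<ge>N. cmod (F (real n) - F x) \<le> C * exp (- x)"
        by (intro exI[of _ N] allI impI right) (use True N in auto)
    qed
    then show ?thesis using True by (simp add: norm_minus_commute)
  next
    case False
    have "cmod (F x - c) \<le> C * exp x"
    proof (rule LIMSEQ_le_const2[OF tendsto_norm[OF tendsto_diff[OF tendsto_const c']]])
      obtain N where N: "- x < real N" using reals_Archimedean2 by blast
      show "\<exists>N. \<forall>n\<ge>N. cmod (F x - F (- real n)) \<le> C * exp x"
        by (intro exI[of _ N] allI impI left) (use False N in auto)
    qed
    then show ?thesis using False by simp
  qed
  show ?thesis
  proof (rule that[of "\<lambda>w. P0 w - c" "C + C * Y"])
    fix w assume w: "w \<in> hstrip (- Y) Y"
    show "((\<lambda>w. P0 w - c) has_field_derivative g w) (at w)"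
      using DERIV_diff[OF P0[OF w] DERIV_const[of c]] by simp
    have wI: "- Y < Im w" "Im w < Y" using w by (auto simp: hstrip_def)
    have "cmod (P0 (Complex (Re w) (Im w)) - P0 (Complex (Re w) 0)) \<le> (C * exp (- \<bar>Re w\<bar>)) * \<bar>Im w - 0\<bar>"
    proof (rule vertical_difference_bound[OF P0])
      fix y assume "y \<in> closed_segment (Im w) 0"
      then have "- Y < y" "y < Y" using wI Y by (auto simp: closed_segment_eq_real_ivl split: if_splits)
      then show "cmod (g (Complex (Re w) y)) \<le> C * exp (- \<bar>Re w\<bar>)" using bd[of "Complex (Re w) y"] by simp
    qed (use wI Y in auto)
    also have "\<dots> \<le> (C * exp (- \<bar>Re w\<bar>)) * Y" using wI C0 by (intro mult_left_mono) auto
    finally have 1: "cmod (P0 w - F (Re w)) \<le> C * exp (- \<bar>Re w\<bar>) * Y" by (simp add: F_def)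
    have "cmod (P0 w - c) \<le> cmod (P0 w - F (Re w)) + cmod (F (Re w) - c)"
      using norm_triangle_ineq[of "P0 w - F (Re w)" "F (Re w) - c"] by simp
    also have "\<dots> \<le> C * exp (- \<bar>Re w\<bar>) * Y + C * exp (- \<bar>Re w\<bar>)" using 1 Fbd[of "Re w"] by (rule add_mono)
    finally show "cmod (P0 w - c) \<le> (C + C * Y) * exp (- \<bar>Re w\<bar>)" by (simp add: algebra_simps)
  qed
qed

section \<open>Cauchy's formula for the kernel on two horizontal lines\<close>

lemma integral_indicator_interval:
  fixes f :: "real \<Rightarrow> complex"
  assumes "continuous_on {a..b} f"
  shows "(\<integral>x. indicator {a..b} x *\<^sub>R f x \<partial>lborel) = integral {a..b} f"
proof -
  have "set_integrable lborel {a..b} f"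
    using borel_integrable_atLeastAtMost'[OF assms] .
  from set_borel_integral_eq_integral(2)[OF this] show ?thesis
    by (simp add: set_lebesgue_integral_def)
qed

lemma contour_integral_hline:
  assumes "a < b"
  shows "contour_integral (linepath (Complex a y) (Complex b y)) f = integral {a..b} (\<lambda>x. f (Complex x y))"
proof -
  have "contour_integral (linepath (Complex a y) (Complex b y)) f
      = contour_integral (linepath (of_real a) (of_real b)) (\<lambda>w. f (w + Complex 0 y))"
  proof -
    have 1: "linepath (Complex a y) (Complex b y) t = linepath (of_real a) (of_real b) t + Complex 0 y" for t
      by (simp add: linepath_def complex_eq_iff algebra_simps)
    have 2: "Complex b y - Complex a y = of_real b - of_real a" by (simp add: complex_eq_iff)
    show ?thesis unfolding contour_integral_integral vector_derivative_linepath_at 1 2 by simp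
  qed
  also have "\<dots> = integral {a..b} (\<lambda>x. f (of_real x + Complex 0 y))"
    using contour_integral_linepath_Reals_eq[of "of_real a" "of_real b"] assms by simp
  also have "(\<lambda>x. of_real x + Complex 0 y) = (\<lambda>x. Complex x y)"
    by (simp add: fun_eq_iff complex_eq_iff)
  then have "integral {a..b} (\<lambda>x. f (of_real x + Complex 0 y)) = integral {a..b} (\<lambda>x. f (Complex x y))"
    by (metis (no_types))
  finally show ?thesis .
qed

text \<open>
  Since $(-P/E)' = P\, \kappa(\omega - w) - g/E$ with $E = e^{\omega - w} - 1$, the double pole
  reduces to the simple pole of $g/E$.
\<close>

lemma rect_kernel_integral:
  assumes P: "\<And>w. w \<in> hstrip (- Y') Y' \<Longrightarrow> (P has_field_derivative g w) (at w)"
    and Y: "0 < Y" "Y < Y'" "Y' \<le> pi" and w: "\<bar>Im w\<bar> < Y" and R: "\<bar>Re w\<bar> < R"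
  shows "contour_integral (rectpath (Complex (- R) (- Y)) (Complex R Y)) (\<lambda>\<omega>. P \<omega> * kern (\<omega> - w)) = 2 * pi * \<i> * g w"
proof -
  define S where "S = hstrip (- Y') Y'"
  define E where "E = (\<lambda>\<omega>. exp (\<omega> - w) - 1)"
  define \<gamma> where "\<gamma> = rectpath (Complex (- R) (- Y)) (Complex R Y)"
  have S: "open S" "connected S" "convex S"
    by (auto simp: S_def open_hstrip convex_hstrip convex_connected)
  have wS: "w \<in> S" using w Y by (auto simp: S_def hstrip_def abs_less_iff)
  have Pholo: "P holomorphic_on S" using P by (auto simp: S_def holomorphic_on_open[OF open_hstrip])
  have gholo: "g holomorphic_on S"
  proof (rule holomorphic_cong[THEN iffD1, OF refl _ holomorphic_deriv[OF Pholo S(1)]])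
    show "deriv P x = g x" if "x \<in> S" for x using P[of x] that by (simp add: S_def DERIV_imp_deriv)
  qed
  have E0: "E \<omega> \<noteq> 0" if "\<omega> \<in> S - {w}" for \<omega>
  proof
    assume "E \<omega> = 0"
    then have "exp (\<omega> - w) = 1" by (simp add: E_def)
    moreover have "\<bar>Im (\<omega> - w)\<bar> < 2 * pi" using that wS Y by (auto simp: S_def hstrip_def abs_less_iff)
    ultimately have "\<omega> - w = 0" by (rule exp_eq_1_strip)
    then show False using that by simp
  qed
  have Eholo: "E holomorphic_on T" for T unfolding E_def by (intro holomorphic_intros)
  have E': "(E has_field_derivative exp (\<omega> - w)) (at \<omega>)" for \<omega>
    unfolding E_def by (auto intro!: derivative_eq_intros)
  have im: "path_image \<gamma> \<subseteq> S - {w}"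
    unfolding \<gamma>_def using Y R w by (subst path_image_rectpath) (auto simp: S_def hstrip_def abs_less_iff)
  have wn0: "winding_number \<gamma> z = 0" if "z \<notin> S" for z
    by (rule winding_number_zero_outside[of _ S]) (use S im that in \<open>auto simp: \<gamma>_def\<close>)
  have wn1: "winding_number \<gamma> w = 1"
    unfolding \<gamma>_def by (rule winding_number_rectpath) (use R w Y in \<open>auto simp: in_box_complex_iff abs_less_iff\<close>)
  have sub1: "S - {w} \<subseteq> S" by blast
  \<comment> \<open>The residue rule for simple poles asks for \<open>f w \<noteq> 0\<close>. When
    \<open>g w = 0\<close>, it is applied to \<open>g + 1\<close> and to 1, and the results are
    subtracted.\<close>
  have pole: "contour_integral \<gamma> (\<lambda>\<omega>. f \<omega> / E \<omega>) = 2 * pi * \<i> * f w"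
    if f: "f holomorphic_on S" "f w \<noteq> 0" for f
  proof -
    have "contour_integral \<gamma> (\<lambda>\<omega>. f \<omega> / E \<omega>) = 2 * pi * \<i> * (\<Sum>p\<in>{w}. winding_number \<gamma> p * residue (\<lambda>\<omega>. f \<omega> / E \<omega>) p)"
    proof (rule Residue_theorem[OF S(1,2)])
      show "(\<lambda>\<omega>. f \<omega> / E \<omega>) holomorphic_on S - {w}"
        using E0 by (intro holomorphic_intros Eholo holomorphic_on_subset[OF f(1) sub1]) auto
    qed (use im wn0 in \<open>auto simp: \<gamma>_def\<close>)
    moreover have "residue (\<lambda>\<omega>. f \<omega> / E \<omega>) w = f w / 1"
      by (rule residue_simple_pole_deriv[OF f(1) Eholo S(1,2) wS _ f(2)])
         (use E'[of w] in \<open>auto simp: E_def\<close>)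
    ultimately show ?thesis by (simp add: wn1)
  qed
  have ci: "f contour_integrable_on \<gamma>" if "f holomorphic_on S - {w}" for f
    by (rule contour_integrable_holomorphic_simple[OF that]) (use S im in \<open>auto simp: \<gamma>_def\<close>)
  have gE: "contour_integral \<gamma> (\<lambda>\<omega>. g \<omega> / E \<omega>) = 2 * pi * \<i> * g w"
  proof (cases "g w = 0")
    case False then show ?thesis using pole[OF gholo] by simp
  next
    case True
    have 1: "(\<lambda>\<omega>. (g \<omega> + 1) / E \<omega>) contour_integrable_on \<gamma>" "(\<lambda>\<omega>. 1 / E \<omega>) contour_integrable_on \<gamma>"
      using E0 by (intro ci holomorphic_intros Eholo holomorphic_on_subset[OF gholo sub1]; auto)+
    have "contour_integral \<gamma> (\<lambda>\<omega>. (g \<omega> + 1) / E \<omega>) = 2 * pi * \<i> * (g w + 1)"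
      by (rule pole) (use True in \<open>auto intro!: holomorphic_intros gholo\<close>)
    moreover have "contour_integral \<gamma> (\<lambda>\<omega>. 1 / E \<omega>) = 2 * pi * \<i> * 1"
      using pole[of "\<lambda>_. 1"] by simp
    ultimately have "contour_integral \<gamma> (\<lambda>\<omega>. (g \<omega> + 1) / E \<omega> - 1 / E \<omega>) = 0"
      using contour_integral_diff[OF 1] True by simp
    moreover have "(\<lambda>\<omega>. (g \<omega> + 1) / E \<omega> - 1 / E \<omega>) = (\<lambda>\<omega>. g \<omega> / E \<omega>)"
      by (simp add: fun_eq_iff add_divide_distrib)
    ultimately show ?thesis using True by simp
  qed
  \<comment> \<open>The primitive \<open>- P / E\<close> is single-valued on the punctured strip, so
    its increment around the closed rectangle is 0.\<close>
  have "((\<lambda>\<omega>. P \<omega> * kern (\<omega> - w) - g \<omega> / E \<omega>) has_contour_integral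
      (- P (pathfinish \<gamma>) / E (pathfinish \<gamma>) - (- P (pathstart \<gamma>) / E (pathstart \<gamma>)))) \<gamma>"
  proof (rule contour_integral_primitive[OF _ _ im])
    fix \<omega> assume \<omega>: "\<omega> \<in> S - {w}"
    have "((\<lambda>\<omega>. - P \<omega> / E \<omega>) has_field_derivative (- g \<omega> * E \<omega> - (- P \<omega>) * exp (\<omega> - w)) / (E \<omega> * E \<omega>)) (at \<omega>)"
      using P[of \<omega>] \<omega> E0[OF \<omega>] by (intro DERIV_divide DERIV_minus E') (auto simp: S_def)
    also have "(- g \<omega> * E \<omega> - (- P \<omega>) * exp (\<omega> - w)) / (E \<omega> * E \<omega>) = P \<omega> * kern (\<omega> - w) - g \<omega> / E \<omega>"
    proof -
      have "kern (\<omega> - w) = exp (\<omega> - w) / (E \<omega>)\<^sup>2" by (simp add: kern_def E_def)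
      then show ?thesis using E0[OF \<omega>] by (simp add: power2_eq_square diff_divide_distrib)
    qed
    finally show "((\<lambda>\<omega>. - P \<omega> / E \<omega>) has_field_derivative P \<omega> * kern (\<omega> - w) - g \<omega> / E \<omega>) (at \<omega> within S - {w})"
      by (rule has_field_derivative_at_within)
  qed (auto simp: \<gamma>_def)
  then have "contour_integral \<gamma> (\<lambda>\<omega>. P \<omega> * kern (\<omega> - w) - g \<omega> / E \<omega>) = 0"
    by (simp add: contour_integral_unique \<gamma>_def)
  moreover have kholo: "(\<lambda>\<omega>. P \<omega> * kern (\<omega> - w)) holomorphic_on S - {w}"
    unfolding kern_def using E0
    by (intro holomorphic_intros holomorphic_on_subset[OF Pholo sub1]) (auto simp: E_def)
  moreover have "(\<lambda>\<omega>. g \<omega> / E \<omega>) holomorphic_on S - {w}"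
    using E0 by (intro holomorphic_intros Eholo holomorphic_on_subset[OF gholo sub1]) auto
  ultimately have "contour_integral \<gamma> (\<lambda>\<omega>. P \<omega> * kern (\<omega> - w)) = contour_integral \<gamma> (\<lambda>\<omega>. g \<omega> / E \<omega>)"
    using contour_integral_diff[OF ci ci] by fastforce
  then show ?thesis using gE by (simp add: \<gamma>_def)
qed

text \<open>Limit of the rectangle formula. The vertical sides vanish because \<open>P\<close>
  decays while the kernel is at most 4 there; the minus sign comes from traversing the upper side to
  the left.\<close>

lemma strip_kernel_representation:
  assumes P: "\<And>w. w \<in> hstrip (- Y') Y' \<Longrightarrow> (P has_field_derivative g w) (at w)"
    and Pbd: "\<And>w. w \<in> hstrip (- Y') Y' \<Longrightarrow> cmod (P w) \<le> D * exp (- \<bar>Re w\<bar>)"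
    and Y: "0 < Y" "Y < Y'" "Y' \<le> pi" and w: "\<bar>Im w\<bar> < Y"
  shows "2 * pi * \<i> * g w = (\<integral>s. P (Complex s (- Y)) * kern (Complex s (- Y) - w) \<partial>lborel)
      - (\<integral>s. P (Complex s Y) * kern (Complex s Y - w) \<partial>lborel)"
proof -
  define f where "f = (\<lambda>\<omega>. P \<omega> * kern (\<omega> - w))"
  define S where "S = hstrip (- Y') Y'"
  have Pcont: "continuous_on S P" using P unfolding S_def
    by (meson DERIV_isCont continuous_at_imp_continuous_on)
  have e1: "exp (\<omega> - w) \<noteq> 1" if "\<omega> \<in> S" "\<omega> \<noteq> w" for \<omega>
  proof
    assume "exp (\<omega> - w) = 1"
    moreover have "\<bar>Im (\<omega> - w)\<bar> < 2 * pi" using that w Y by (auto simp: S_def hstrip_def abs_less_iff)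
    ultimately have "\<omega> - w = 0" by (rule exp_eq_1_strip)
    then show False using that by simp
  qed
  have fcont: "continuous_on (S - {w}) f"
    unfolding f_def kern_def using e1 by (intro continuous_intros continuous_on_subset[OF Pcont]) auto
  have D0: "D \<ge> 0" using order_trans[OF norm_ge_zero Pbd[of "Complex 0 0"]] Y by simp
  \<comment> \<open>The vertical distance from \<open>w\<close> to the two lines. The upper limit in
    \<open>kern_bounds\<close> holds as well, since the imaginary parts differ by at most
    \<open>Y + \<bar>Im w\<bar> = 2 * Y - \<theta>\<close> and \<open>Y < pi\<close>.\<close>
  define \<theta> where "\<theta> = Y - \<bar>Im w\<bar>"
  have \<theta>: "0 < \<theta>" "\<theta> \<le> pi" using w Y by (auto simp: \<theta>_def)
  obtain C where C: "C > 0" "\<And>u. \<theta> \<le> \<bar>Im u\<bar> \<Longrightarrow> \<bar>Im u\<bar> \<le> 2 * pi - \<theta> \<Longrightarrow>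
     exp u \<noteq> 1 \<and> cmod (kern u) \<le> C * exp (- \<bar>Re u\<bar>) \<and> cmod (kern' u) \<le> C * exp (- \<bar>Re u\<bar>)"
    using kern_bounds[OF \<theta>] by blast
  have lineS: "Complex s \<sigma> \<in> S - {w}" if "\<bar>\<sigma>\<bar> = Y" for s \<sigma>
    using that w Y by (auto simp: S_def)
  have line: "cmod (f (Complex s \<sigma>)) \<le> (D * C) * exp (- \<bar>s\<bar>)" if \<sigma>: "\<bar>\<sigma>\<bar> = Y" for s \<sigma>
  proof -
    have "\<bar>\<sigma> - Im w\<bar> \<ge> \<theta>" "\<bar>\<sigma> - Im w\<bar> \<le> 2 * pi - \<theta>" using \<sigma> w Y by (auto simp: \<theta>_def)
    then have "cmod (kern (Complex s \<sigma> - w)) \<le> C * exp (- \<bar>s - Re w\<bar>)" using C(2)[of "Complex s \<sigma> - w"] by simp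
    also have "\<dots> \<le> C" using C(1) by simp
    finally have "cmod (f (Complex s \<sigma>)) \<le> (D * exp (- \<bar>s\<bar>)) * C"
      unfolding f_def norm_mult using Pbd[of "Complex s \<sigma>"] lineS[OF \<sigma>, of s] D0 by (intro mult_mono) (auto simp: S_def)
    then show ?thesis by (simp add: algebra_simps)
  qed
  have contl: "continuous_on A (\<lambda>s. f (Complex s \<sigma>))" if "\<bar>\<sigma>\<bar> = Y" for A \<sigma>
    by (rule continuous_on_compose2[OF fcont])
       (use lineS[OF that] in \<open>auto intro!: continuous_intros simp: Complex_eq\<close>)
  have intl: "integrable lborel (\<lambda>s. f (Complex s \<sigma>))" if "\<bar>\<sigma>\<bar> = Y" for \<sigma>
    by (rule integrable_of_exp_bound[OF borel_measurable_continuous_onI[OF contl[OF that]] line[OF that]])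
  have lim: "(\<lambda>n. integral {- real n..real n} (\<lambda>s. f (Complex s \<sigma>))) \<longlonglongrightarrow> (\<integral>s. f (Complex s \<sigma>) \<partial>lborel)"
    if \<sigma>: "\<bar>\<sigma>\<bar> = Y" for \<sigma>
    using tendsto_integral_symmetric_interval[OF intl[OF \<sigma>]]
    by (simp add: integral_indicator_interval[OF contl[OF \<sigma>]])
  define V where "V = (\<lambda>n. contour_integral (linepath (Complex (real n) (- Y)) (Complex (real n) Y)) f
     + contour_integral (linepath (Complex (- real n) Y) (Complex (- real n) (- Y))) f)"
  \<comment> \<open>From \<open>N\<close> on, the vertical sides keep horizontal distance at least 1
    from \<open>w\<close>, as \<open>kern_bound_far\<close> requires.\<close>
  obtain N where N: "\<bar>Re w\<bar> + 1 \<le> real N" using real_arch_simple by blast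
  have seg: "\<omega> \<in> S - {w} \<and> cmod (f \<omega>) \<le> D * exp (- real n) * 4"
    if "n \<ge> N" "\<bar>r\<bar> = real n" "\<omega> \<in> closed_segment (Complex r a) (Complex r b)" "{a, b} = {Y, - Y}" for n r \<omega> a b
  proof -
    have "Re \<omega> = r" "\<bar>Im \<omega>\<bar> \<le> Y"
      using that(3,4) Y by (auto simp: closed_segment_same_Re closed_segment_eq_real_ivl doubleton_eq_iff split: if_splits)
    then have 1: "\<omega> \<in> S - {w}" "\<bar>Re (\<omega> - w)\<bar> \<ge> 1" using that(1,2) N Y by (auto simp: S_def hstrip_def)
    have "cmod (f \<omega>) \<le> D * exp (- real n) * 4" unfolding f_def norm_mult
      using Pbd[of \<omega>] 1 kern_bound_far[OF 1(2)] \<open>Re \<omega> = r\<close> that(2) D0 by (intro mult_mono) (auto simp: S_def)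
    with 1 show ?thesis by simp
  qed
  have rect: "integral {- real n..real n} (\<lambda>s. f (Complex s (- Y))) - integral {- real n..real n} (\<lambda>s. f (Complex s Y)) + V n
     = 2 * pi * \<i> * g w" if n: "n \<ge> N" for n
  proof -
    have Rn: "\<bar>Re w\<bar> < real n" using N n by linarith
    have n0: "- real n < real n" using Rn by linarith
    have ci: "f contour_integrable_on linepath a b" if "closed_segment a b \<subseteq> S - {w}" for a b
      by (rule contour_integrable_continuous_linepath) (rule continuous_on_subset[OF fcont that])
    have hsub: "closed_segment (Complex a \<sigma>) (Complex b \<sigma>) \<subseteq> S - {w}" if "\<bar>\<sigma>\<bar> = Y" for a b \<sigma>
    proof
      fix z assume "z \<in> closed_segment (Complex a \<sigma>) (Complex b \<sigma>)"
      then have "z = Complex (Re z) \<sigma>" by (auto simp: closed_segment_same_Im complex_eq_iff)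
      then show "z \<in> S - {w}" using lineS[OF that, of "Re z"] by simp
    qed
    have vsub: "closed_segment (Complex r a) (Complex r b) \<subseteq> S - {w}" if "\<bar>r\<bar> = real n" "{a, b} = {Y, - Y}" for r a b
      using seg[OF n that(1) _ that(2)] by blast
    have cis: "f contour_integrable_on linepath (Complex (- real n) (- Y)) (Complex (real n) (- Y))"
      "f contour_integrable_on linepath (Complex (real n) (- Y)) (Complex (real n) Y)"
      "f contour_integrable_on linepath (Complex (real n) Y) (Complex (- real n) Y)"
      "f contour_integrable_on linepath (Complex (- real n) Y) (Complex (- real n) (- Y))"
      by (intro ci hsub vsub; use Y in force)+
    have "2 * pi * \<i> * g w = contour_integral (rectpath (Complex (- real n) (- Y)) (Complex (real n) Y)) f"
      unfolding f_def by (rule rect_kernel_integral[OF P Y w Rn, symmetric])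
    also have "\<dots> = contour_integral (linepath (Complex (- real n) (- Y)) (Complex (real n) (- Y))) f
       + contour_integral (linepath (Complex (real n) (- Y)) (Complex (real n) Y)) f
       + contour_integral (linepath (Complex (real n) Y) (Complex (- real n) Y)) f
       + contour_integral (linepath (Complex (- real n) Y) (Complex (- real n) (- Y))) f"
      unfolding rectpath_def Let_def using cis by (simp add: valid_path_join contour_integrable_joinI)
    also have "contour_integral (linepath (Complex (real n) Y) (Complex (- real n) Y)) f
       = - contour_integral (linepath (Complex (- real n) Y) (Complex (real n) Y)) f"
      by (rule contour_integral_reverse_linepath)
         (rule continuous_on_subset[OF fcont hsub], use Y in auto)
    finally show ?thesis
      by (simp add: V_def contour_integral_hline[OF n0])
  qed
  have "V \<longlonglongrightarrow> 0"
  proof (rule Lim_null_comparison)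
    show "eventually (\<lambda>n. cmod (V n) \<le> (16 * D * Y) * exp (- real n)) sequentially"
    proof (rule eventually_sequentiallyI[of N])
      fix n assume n: "N \<le> n"
      have side: "cmod (contour_integral (linepath (Complex r a) (Complex r b)) f) \<le> (8 * D * Y) * exp (- real n)"
        if r: "\<bar>r\<bar> = real n" and ab: "{a, b} = {Y, - Y}" for r a b
      proof -
        have "cmod (contour_integral (linepath (Complex r a) (Complex r b)) f) \<le> (D * exp (- real n) * 4) * cmod (Complex r b - Complex r a)"
        proof (rule contour_integral_bound_linepath)
          show "f contour_integrable_on linepath (Complex r a) (Complex r b)"
            by (rule contour_integrable_continuous_linepath, rule continuous_on_subset[OF fcont])
               (use seg[OF n r _ ab] in blast)
        qed (use seg[OF n r _ ab] D0 in auto)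
        also have "cmod (Complex r b - Complex r a) = 2 * Y"
          using ab Y by (auto simp: doubleton_eq_iff cmod_def)
        finally show ?thesis by (simp add: algebra_simps)
      qed
      have "cmod (V n) \<le> (8 * D * Y) * exp (- real n) + (8 * D * Y) * exp (- real n)"
        unfolding V_def by (rule order_trans[OF norm_triangle_ineq]) (intro add_mono side, auto)
      then show "cmod (V n) \<le> (16 * D * Y) * exp (- real n)" by (simp add: algebra_simps)
    qed
    show "(\<lambda>n. (16 * D * Y) * exp (- real n)) \<longlonglongrightarrow> 0"
      using tendsto_mult_right_zero[OF tendsto_exp_minus_nat] by simp
  qed
  then have "(\<lambda>n. integral {- real n..real n} (\<lambda>s. f (Complex s (- Y))) - integral {- real n..real n} (\<lambda>s. f (Complex s Y)) + V n)
     \<longlonglongrightarrow> (\<integral>s. f (Complex s (- Y)) \<partial>lborel) - (\<integral>s. f (Complex s Y) \<partial>lborel) + 0"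
    by (intro tendsto_add tendsto_diff lim) (use Y in auto)
  moreover have "(\<lambda>n. integral {- real n..real n} (\<lambda>s. f (Complex s (- Y))) - integral {- real n..real n} (\<lambda>s. f (Complex s Y)) + V n)
     \<longlonglongrightarrow> 2 * pi * \<i> * g w"
    by (rule tendsto_eventually, rule eventually_sequentiallyI[of N], rule rect)
  ultimately show ?thesis unfolding f_def using LIMSEQ_unique by fastforce
qed

section \<open>Density of the kernels\<close>

text \<open>On \<open>[-N, N]\<close> the Lipschitz constant \<open>D\<close> gives an error
  \<open>D / n\<close> per point; outside, the step function is 0 and the tail of \<open>Q\<close>
  remains, half of whose exponent is spent on smallness in \<open>N\<close>. The bound is linear in
  \<open>D\<close>, so a weight depending on a further parameter can be carried in
  \<open>D\<close>.\<close>

lemma riemann_sum_bound: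
  fixes Q Q' :: "real \<Rightarrow> complex"
  assumes der: "\<And>s. (Q has_vector_derivative Q' s) (at s)"
    and bd: "\<And>s. cmod (Q s) \<le> D * exp (- (\<bar>s\<bar> / 2))" and bd': "\<And>s. cmod (Q' s) \<le> D"
    and n: "n > 0"
  shows "cmod ((\<integral>s. Q s \<partial>lborel) - (\<Sum>j\<in>{- int (N * n)..<int (N * n)}. Q (of_int j / real n) / of_nat n))
    \<le> D * (2 * real N / real n + (\<integral>s. exp (- (\<bar>s :: real\<bar> / 4)) \<partial>lborel) * exp (- (real N / 4)))"
proof -
  define I where "I = {- int (N * n)..<int (N * n)}"
  have D0: "D \<ge> 0" using order_trans[OF norm_ge_zero bd'[of 0]] .
  have Qc: "continuous_on A Q" for A
    using der by (meson continuous_at_imp_continuous_on has_vector_derivative_continuous)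
  have m[measurable]: "Q \<in> borel_measurable borel" using Qc by (rule borel_measurable_continuous_onI)
  have lip: "cmod (Q t - Q s) \<le> D * (t - s)" if "s \<le> t" for s t
  proof (cases "s = t")
    case False
    then have "s < t" using that by simp
    then have "cmod (Q t - Q s) \<le> D * t - D * s"
      by (rule differentiable_bound_general[OF _ Qc _ der, where \<phi>' = "\<lambda>_. D"])
         (auto intro!: continuous_intros derivative_eq_intros bd' simp flip: has_real_derivative_iff_has_vector_derivative)
    then show ?thesis by (simp add: algebra_simps)
  qed simp
  have e4: "integrable lborel (\<lambda>s::real. exp (- (\<bar>s\<bar> / 4)))" and e2: "integrable lborel (\<lambda>s::real. exp (- (\<bar>s\<bar> / 2)))"
    using integrable_exp_abs[of "1/4"] integrable_exp_abs[of "1/2"] by simp_all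
  have Qint: "integrable lborel Q"
    by (rule Bochner_Integration.integrable_bound[OF integrable_mult_right[OF e2, of D]])
       (use bd D0 in \<open>auto simp: abs_mult\<close>)
  define A where "A = (\<lambda>j::int. {of_int j / real n..<of_int (j + 1) / real n})"
  define step where "step = (\<lambda>s. \<Sum>j\<in>I. indicator (A j) s *\<^sub>R Q (of_int j / real n))"
  have le: "real_of_int j / real n \<le> real_of_int (j + 1) / real n" for j by (intro divide_right_mono) auto
  have ind_int: "integrable lborel (\<lambda>s. indicator (A j) s *\<^sub>R Q (of_int j / real n))" for j
    by (rule integrable_scaleR_left, rule integrable_real_indicator)
       (simp_all only: A_def emeasure_lborel_Ico[OF le], simp_all)
  have step_int: "integrable lborel step" unfolding step_def by (intro Bochner_Integration.integrable_sum ind_int)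
  have step_val: "(\<integral>s. step s \<partial>lborel) = (\<Sum>j\<in>I. Q (of_int j / real n) / of_nat n)"
  proof -
    have "(\<integral>s. step s \<partial>lborel) = (\<Sum>j\<in>I. \<integral>s. indicator (A j) s *\<^sub>R Q (of_int j / real n) \<partial>lborel)"
      unfolding step_def by (rule Bochner_Integration.integral_sum) (rule ind_int)
    also have "\<dots> = (\<Sum>j\<in>I. Q (of_int j / real n) / of_nat n)"
    proof (rule sum.cong[OF refl])
      fix j
      have "real_of_int (j + 1) / real n - of_int j / real n = 1 / real n" by (simp add: add_divide_distrib)
      moreover have "real_of_int j / real n \<le> real_of_int (j + 1) / real n" by (intro divide_right_mono) auto
      ultimately have "measure lborel (A j) = 1 / real n" by (simp add: A_def)
      then show "(\<integral>s. indicator (A j) s *\<^sub>R Q (of_int j / real n) \<partial>lborel) = Q (of_int j / real n) / of_nat n"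
        by (simp add: A_def scaleR_conv_of_real)
    qed
    finally show ?thesis .
  qed
  \<comment> \<open>A single integrable majorant: the first term serves the points whose cell occurs
    in the sum, the second all others.\<close>
  define B where "B = (\<lambda>s. (D / real n) * indicator {- real N..real N} s + (D * exp (- (real N / 4))) * exp (- (\<bar>s\<bar> / 4)))"
  have Bint: "integrable lborel B" unfolding B_def using e4 by simp
  have point: "cmod (Q s - step s) \<le> B s" for s
  proof -
    define j where "j = \<lfloor>real n * s\<rfloor>"
    have j: "of_int j \<le> real n * s" "real n * s < of_int j + 1" by (auto simp: j_def)
    have mem: "s \<in> A i \<longleftrightarrow> i = j" for i
    proof -
      have "s \<in> A i \<longleftrightarrow> of_int i \<le> real n * s \<and> real n * s < of_int i + 1"
        using n by (simp add: A_def divide_le_eq less_divide_eq mult.commute)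
      also have "\<dots> \<longleftrightarrow> i = j" unfolding j_def by (metis floor_unique floor_correct of_int_1 of_int_add)
      finally show ?thesis .
    qed
    have step_s: "step s = (if j \<in> I then Q (of_int j / real n) else 0)"
    proof -
      have "step s = (\<Sum>i\<in>I. if i = j then Q (of_int j / real n) else 0)"
        unfolding step_def by (intro sum.cong) (auto simp: mem indicator_def)
      then show ?thesis by (simp add: I_def)
    qed
    have pos: "0 \<le> (D / real n) * indicator {- real N..real N} s" "0 \<le> (D * exp (- (real N / 4))) * exp (- (\<bar>s\<bar> / 4))"
      using D0 by auto
    show ?thesis
    proof (cases "j \<in> I")
      case True
      have "cmod (Q s - Q (of_int j / real n)) \<le> D * (s - of_int j / real n)"
        using j n by (intro lip) (simp add: divide_le_eq mult.commute)
      also have "\<dots> \<le> D * (1 / real n)"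
      proof (intro mult_left_mono D0)
        have "s - of_int j / real n = (real n * s - of_int j) / real n" using n by (simp add: diff_divide_distrib)
        also have "\<dots> \<le> 1 / real n" using j by (intro divide_right_mono) auto
        finally show "s - of_int j / real n \<le> 1 / real n" .
      qed
      finally have 1: "cmod (Q s - step s) \<le> D / real n" using True by (simp add: step_s)
      have "- int (N * n) \<le> j" "j + 1 \<le> int (N * n)" using True by (auto simp: I_def)
      then have "real_of_int (- int (N * n)) \<le> real_of_int j" "real_of_int (j + 1) \<le> real_of_int (int (N * n))"
        by (simp_all only: of_int_le_iff)
      then have "- (real n * real N) \<le> real n * s" "real n * s \<le> real n * real N"
        using j by (simp_all add: mult.commute)
      then have "real n * (- real N) \<le> real n * s" "real n * s \<le> real n * real N" by simp_all
      then have "- real N \<le> s" "s \<le> real N" using n by (simp_all only: mult_le_cancel_left_pos of_nat_0_less_iff)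
      then have "(D / real n) * indicator {- real N..real N} s = D / real n" by simp
      then show ?thesis using 1 pos unfolding B_def by linarith
    next
      case False
      then have "j < - int (N * n) \<or> j \<ge> int (N * n)" by (auto simp: I_def)
      then have "j + 1 \<le> - int (N * n) \<or> j \<ge> int (N * n)" by linarith
      then have "real_of_int (j + 1) \<le> real_of_int (- int (N * n)) \<or> real_of_int j \<ge> real_of_int (int (N * n))"
        by (simp only: of_int_le_iff)
      then have "real n * s \<le> - (real n * real N) \<or> real n * s \<ge> real n * real N"
        using j by (auto simp: mult.commute)
      then have "real n * s \<le> real n * (- real N) \<or> real n * real N \<le> real n * s" by simp
      then have "s \<le> - real N \<or> real N \<le> s" using n by (simp only: mult_le_cancel_left_pos of_nat_0_less_iff)
      then have sN: "real N \<le> \<bar>s\<bar>" by linarith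
      have "cmod (Q s - step s) \<le> D * exp (- (\<bar>s\<bar> / 2))" using bd[of s] False by (simp add: step_s)
      also have "\<dots> \<le> D * (exp (- (real N / 4)) * exp (- (\<bar>s\<bar> / 4)))"
        unfolding exp_add[symmetric] using sN D0 by (intro mult_left_mono) auto
      finally show ?thesis using pos unfolding B_def by (simp add: mult.assoc)
    qed
  qed
  have "cmod ((\<integral>s. Q s \<partial>lborel) - (\<integral>s. step s \<partial>lborel)) = cmod (\<integral>s. Q s - step s \<partial>lborel)"
    using Qint step_int by simp
  also have "\<dots> \<le> (\<integral>s. cmod (Q s - step s) \<partial>lborel)" by (rule integral_norm_bound)
  also have "\<dots> \<le> (\<integral>s. B s \<partial>lborel)" using point Qint step_int Bint by (intro integral_mono) auto
  also have "\<dots> = (D / real n) * (2 * real N) + (D * exp (- (real N / 4))) * (\<integral>s. exp (- (\<bar>s :: real\<bar> / 4)) \<partial>lborel)"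
    unfolding B_def using e4 by simp
  also have "\<dots> = D * (2 * real N / real n + (\<integral>s. exp (- (\<bar>s :: real\<bar> / 4)) \<partial>lborel) * exp (- (real N / 4)))"
    by (simp add: algebra_simps)
  finally show ?thesis unfolding step_val I_def .
qed

text \<open>The restriction on \<open>\<omega>\<close> means that \<open>- exp \<omega>\<close> has
  argument of modulus \<open>pi - \<bar>Im \<omega>\<bar>\<close>, below \<open>pi - p\<close>:
  these are exactly the admissible resolvent parameters. Lists make sums a matter of
  concatenation.\<close>

definition kernel_span :: "real \<Rightarrow> (complex \<Rightarrow> complex) set" where
  "kernel_span p = {q. \<exists>xs. (\<forall>(c, \<omega>)\<in>set xs. p < \<bar>Im \<omega>\<bar> \<and> \<bar>Im \<omega>\<bar> \<le> pi) \<and>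
     q = (\<lambda>w. \<Sum>(c, \<omega>)\<leftarrow>xs. c * kern (\<omega> - w))}"

lemma kernel_span_single: "p < \<bar>Im \<omega>\<bar> \<Longrightarrow> \<bar>Im \<omega>\<bar> \<le> pi \<Longrightarrow> (\<lambda>w. c * kern (\<omega> - w)) \<in> kernel_span p"
  unfolding kernel_span_def by (intro CollectI exI[of _ "[(c, \<omega>)]"]) simp

lemma kernel_span_add:
  assumes "q \<in> kernel_span p" "q' \<in> kernel_span p"
  shows "(\<lambda>w. q w + q' w) \<in> kernel_span p"
proof -
  obtain xs where xs: "\<forall>(c, \<omega>)\<in>set xs. p < \<bar>Im \<omega>\<bar> \<and> \<bar>Im \<omega>\<bar> \<le> pi" "q = (\<lambda>w. \<Sum>(c, \<omega>)\<leftarrow>xs. c * kern (\<omega> - w))"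
    using assms(1) by (auto simp: kernel_span_def)
  obtain ys where ys: "\<forall>(c, \<omega>)\<in>set ys. p < \<bar>Im \<omega>\<bar> \<and> \<bar>Im \<omega>\<bar> \<le> pi" "q' = (\<lambda>w. \<Sum>(c, \<omega>)\<leftarrow>ys. c * kern (\<omega> - w))"
    using assms(2) by (auto simp: kernel_span_def)
  show ?thesis unfolding kernel_span_def
    by (intro CollectI exI[of _ "xs @ ys"]) (use xs ys in auto)
qed

lemma kernel_span_sum:
  assumes "finite J" "\<And>j. j \<in> J \<Longrightarrow> q j \<in> kernel_span p"
  shows "(\<lambda>w. \<Sum>j\<in>J. q j w) \<in> kernel_span p"
  using assms
proof (induction J rule: finite_induct)
  case empty
  show ?case unfolding kernel_span_def by (intro CollectI exI[of _ "[]"]) simp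
next
  case (insert j J)
  then show ?case using kernel_span_add[of "q j" p "\<lambda>w. \<Sum>j\<in>J. q j w"] by simp
qed

text \<open>The integrand is the derivative of \<open>- 1 / (1 + exp (- x))\<close>, which runs from
  0 to -1. Only that the value is not 0 matters: it lets this kernel cancel the mean of any
  function.\<close>

lemma integral_kern_pi:
  assumes "integrable lborel (\<lambda>x. kern (Complex 0 pi - Complex x 0))"
  shows "(\<integral>x. kern (Complex 0 pi - Complex x 0) \<partial>lborel) = -1"
proof -
  have e: "exp (Complex 0 pi - w) = - exp (- w)" for w
    by (simp add: exp_diff exp_minus Complex_eq divide_inverse)
  have ne: "1 + exp (- complex_of_real x) \<noteq> 0" for x
  proof -
    have "1 + exp (- complex_of_real x) = of_real (1 + exp (- x))" by (simp add: exp_of_real[symmetric])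
    moreover have "1 + exp (- x) > 0" by (simp add: add_pos_pos)
    ultimately show ?thesis by (metis less_irrefl of_real_eq_0_iff)
  qed
  have cx: "Complex x 0 = of_real x" for x by (simp add: complex_eq_iff)
  have k: "kern (Complex 0 pi - Complex x 0) = - exp (- of_real x) / (1 + exp (- of_real x))\<^sup>2" for x
    unfolding kern_def e cx by (simp add: power2_eq_square algebra_simps)
  define F where "F = (\<lambda>x::real. - 1 / (1 + exp (- complex_of_real x)))"
  have F': "(F has_vector_derivative kern (Complex 0 pi - Complex x 0)) (at x)" for x
  proof -
    have "((\<lambda>w. - 1 / (1 + exp (- w))) has_field_derivative - exp (- complex_of_real x) / (1 + exp (- of_real x))\<^sup>2) (at (of_real x))"
      using ne[of x] by (auto intro!: derivative_eq_intros simp: power2_eq_square)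
    then show ?thesis unfolding F_def k
      by (rule has_vector_derivative_real_field)
  qed
  have cont: "continuous_on UNIV (\<lambda>x. kern (Complex 0 pi - Complex x 0))"
    unfolding k using ne by (intro continuous_intros) auto
  have 1: "(\<lambda>n. F (real n)) \<longlonglongrightarrow> - 1 / (1 + of_real 0)"
  proof -
    have "(\<lambda>n. - 1 / (1 + complex_of_real (exp (- real n)))) \<longlonglongrightarrow> - 1 / (1 + of_real 0)"
      by (intro tendsto_intros tendsto_exp_minus_nat) simp
    then show ?thesis by (simp add: F_def exp_of_real[symmetric])
  qed
  have 2: "(\<lambda>n. F (- real n)) \<longlonglongrightarrow> - of_real 0 / (1 + of_real 0)"
  proof -
    have "F (- real n) = - complex_of_real (exp (- real n)) / (1 + complex_of_real (exp (- real n)))" for n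
    proof -
      have "F (- real n) = of_real (- 1 / (1 + exp (real n)))" by (simp add: F_def exp_of_real[symmetric])
      also have "- 1 / (1 + exp (real n)) = - exp (- real n) / (1 + exp (- real n))"
        by (simp add: exp_minus divide_simps add_pos_pos add_eq_0_iff)
      finally show ?thesis by simp
    qed
    moreover have "(\<lambda>n. - complex_of_real (exp (- real n)) / (1 + complex_of_real (exp (- real n)))) \<longlonglongrightarrow> - of_real 0 / (1 + of_real 0)"
      by (intro tendsto_intros tendsto_exp_minus_nat) simp
    ultimately show ?thesis by simp
  qed
  have "(\<lambda>n. F (real n) - F (- real n)) \<longlonglongrightarrow> -1" using tendsto_diff[OF 1 2] by simp
  moreover have "(\<lambda>n. F (real n) - F (- real n)) \<longlonglongrightarrow> (\<integral>x. kern (Complex 0 pi - Complex x 0) \<partial>lborel)"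
    by (rule tendsto_primitive_diff_integral[OF F' cont assms])
  ultimately show ?thesis using LIMSEQ_unique by blast
qed

text \<open>After the correction to mean zero, the representation writes the function as two line
  integrals of kernels with poles at heights \<open>Y\<close> and \<open>- Y\<close>, outside the
  strip of half-width \<open>p\<close>. Their Riemann sums belong to the span.\<close>

lemma kernel_span_approx_decaying:
  assumes p: "0 < p" "p < Y'" "Y' < pi" and holo: "f holomorphic_on hstrip (- Y') Y'"
    and bd: "\<And>w. w \<in> hstrip (- Y') Y' \<Longrightarrow> cmod (f w) \<le> C * exp (- \<bar>Re w\<bar>)" and e: "e > 0"
  obtains q where "q \<in> kernel_span p" "\<And>w. \<bar>Im w\<bar> < p \<Longrightarrow> cmod (f w - q w) \<le> e * exp (- (\<bar>Re w\<bar> / 2))"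
proof -
  have fin: "\<bar>Im w\<bar> < Y'" if "w \<in> hstrip (- Y') Y'" for w using that by (auto simp: hstrip_def)
  have Y'0: "Y' > 0" using p by simp
  have C0: "C \<ge> 0" using order_trans[OF norm_ge_zero bd[of "Complex 0 0"]] p by simp
  define \<theta>1 where "\<theta>1 = pi - Y'"
  have \<theta>1: "0 < \<theta>1" "\<theta>1 \<le> pi" using p by (auto simp: \<theta>1_def)
  obtain C1 where C1: "C1 > 0" "\<And>u. \<theta>1 \<le> \<bar>Im u\<bar> \<Longrightarrow> \<bar>Im u\<bar> \<le> 2 * pi - \<theta>1 \<Longrightarrow>
     exp u \<noteq> 1 \<and> cmod (kern u) \<le> C1 * exp (- \<bar>Re u\<bar>) \<and> cmod (kern' u) \<le> C1 * exp (- \<bar>Re u\<bar>)"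
    using kern_bounds[OF \<theta>1] by blast
  define k where "k = (\<lambda>w. kern (Complex 0 pi - w))"
  have kI: "\<theta>1 \<le> \<bar>Im (Complex 0 pi - w)\<bar>" "\<bar>Im (Complex 0 pi - w)\<bar> \<le> 2 * pi - \<theta>1" if "w \<in> hstrip (- Y') Y'" for w
    using fin[OF that] p by (auto simp: \<theta>1_def)
  have kbd: "cmod (k w) \<le> C1 * exp (- \<bar>Re w\<bar>)" if "w \<in> hstrip (- Y') Y'" for w
    using C1(2)[OF kI[OF that]] by (simp add: k_def)
  have kholo: "k holomorphic_on hstrip (- Y') Y'" unfolding k_def kern_def
    using C1(2)[OF kI] by (intro holomorphic_intros) auto
  have kint: "integrable lborel (\<lambda>x. k (Complex x 0))"
    using kbd[of "Complex _ 0"] p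
    by (intro integrable_of_exp_bound[where C = C1] measurable_hline[OF holomorphic_on_imp_continuous_on[OF kholo]]) auto
  have k1: "(\<integral>x. k (Complex x 0) \<partial>lborel) = -1"
    using integral_kern_pi kint unfolding k_def by simp
  have fint: "integrable lborel (\<lambda>x. f (Complex x 0))"
    using bd[of "Complex _ 0"] p
    by (intro integrable_of_exp_bound[where C = C] measurable_hline[OF holomorphic_on_imp_continuous_on[OF holo]]) auto
  define c where "c = (\<integral>x. f (Complex x 0) \<partial>lborel)"
  \<comment> \<open>The plus sign is right because \<open>k\<close> has integral -1.\<close>
  define g where "g = (\<lambda>w. f w + c * k w)"
  define Cg where "Cg = C + cmod c * C1"
  have gholo: "g holomorphic_on hstrip (- Y') Y'" unfolding g_def by (intro holomorphic_intros holo kholo)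
  have gbd: "cmod (g w) \<le> Cg * exp (- \<bar>Re w\<bar>)" if "w \<in> hstrip (- Y') Y'" for w
  proof -
    have "cmod (g w) \<le> cmod (f w) + cmod c * cmod (k w)" unfolding g_def
      by (metis norm_mult norm_triangle_ineq)
    also have "\<dots> \<le> C * exp (- \<bar>Re w\<bar>) + cmod c * (C1 * exp (- \<bar>Re w\<bar>))"
      by (intro add_mono mult_left_mono bd kbd that) auto
    finally show ?thesis by (simp add: Cg_def algebra_simps)
  qed
  have mean: "(\<integral>x. g (Complex x 0) \<partial>lborel) = 0"
    unfolding g_def using fint kint k1 by (simp add: c_def)
  obtain P D where P: "\<And>w. w \<in> hstrip (- Y') Y' \<Longrightarrow> (P has_field_derivative g w) (at w)"
    and Pbd: "\<And>w. w \<in> hstrip (- Y') Y' \<Longrightarrow> cmod (P w) \<le> D * exp (- \<bar>Re w\<bar>)"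
    using zero_mean_primitive[OF Y'0 gholo gbd mean] by blast
  have Cg0: "Cg \<ge> 0" using C0 C1(1) by (simp add: Cg_def)
  have D0: "D \<ge> 0" using order_trans[OF norm_ge_zero Pbd[of "Complex 0 0"]] Y'0 by simp
  \<comment> \<open>Strictly between: \<open>Y < Y'\<close> keeps the lines inside the domain of
    \<open>P\<close>, and the gap \<open>\<theta> = Y - p\<close> makes the kernel bounds uniform
    over all \<open>w\<close> in the smaller strip.\<close>
  define Y where "Y = (p + Y') / 2"
  have Y: "p < Y" "Y < Y'" using p by (auto simp: Y_def)
  define \<theta> where "\<theta> = Y - p"
  have \<theta>: "0 < \<theta>" "\<theta> \<le> pi" using p Y by (auto simp: \<theta>_def)
  obtain C2 where C2: "C2 > 0" "\<And>u. \<theta> \<le> \<bar>Im u\<bar> \<Longrightarrow> \<bar>Im u\<bar> \<le> 2 * pi - \<theta> \<Longrightarrow>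
     exp u \<noteq> 1 \<and> cmod (kern u) \<le> C2 * exp (- \<bar>Re u\<bar>) \<and> cmod (kern' u) \<le> C2 * exp (- \<bar>Re u\<bar>)"
    using kern_bounds[OF \<theta>] by blast
  define B where "B = (Cg + D) * C2"
  have B0: "B \<ge> 0" using Cg0 D0 C2(1) by (simp add: B_def)
  define J where "J = (\<integral>s. exp (- (\<bar>s :: real\<bar> / 4)) \<partial>lborel)"
  have J0: "J \<ge> 0" by (simp add: J_def)
  \<comment> \<open>Each line contributes an error of at most \<open>B * \<eta>\<close> times the
    weight; the two together, divided by \<open>2 * pi\<close>, stay below
    \<open>B * \<eta> \<le> e\<close>.\<close>
  define \<eta> where "\<eta> = e / (B + 1)"
  have \<eta>: "\<eta> > 0" using e B0 by (simp add: \<eta>_def)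
  obtain N :: nat where N: "J * exp (- (real N / 4)) < \<eta> / 2"
  proof -
    have "(\<lambda>N. exp (- (real N / 4))) \<longlonglongrightarrow> 0"
      by (rule filterlim_compose[OF exp_at_bot])
         (simp add: filterlim_uminus_at_bot filterlim_real_sequentially filterlim_at_top_mult_tendsto_pos[OF tendsto_const _ filterlim_real_sequentially, of "1/4", simplified])
    then have "(\<lambda>N. J * exp (- (real N / 4))) \<longlonglongrightarrow> 0" using tendsto_mult_right_zero by blast
    then show ?thesis using order_tendstoD(2)[of _ 0 sequentially "\<eta> / 2"] \<eta> that
      by (auto simp: eventually_sequentially)
  qed
  obtain n :: nat where n: "4 * real N / \<eta> < real n" using reals_Archimedean2 by blast
  have n0: "n > 0"
  proof (rule ccontr)
    assume "\<not> n > 0"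
    moreover have "4 * real N / \<eta> \<ge> 0" using \<eta> by simp
    ultimately show False using n by simp
  qed
  have nN: "2 * real N / real n < \<eta> / 2" using n n0 \<eta> by (simp add: field_simps)
  define S where "S = (\<lambda>\<sigma> w. \<Sum>j\<in>{- int (N * n)..<int (N * n)}. P (Complex (of_int j / real n) \<sigma>) * kern (Complex (of_int j / real n) \<sigma> - w) / of_nat n)"
  define q where "q = (\<lambda>w. - c * kern (Complex 0 pi - w)
     + ((\<Sum>j\<in>{- int (N * n)..<int (N * n)}. (P (Complex (of_int j / real n) (- Y)) / of_nat n / (2 * pi * \<i>)) * kern (Complex (of_int j / real n) (- Y) - w))
     + (\<Sum>j\<in>{- int (N * n)..<int (N * n)}. (- P (Complex (of_int j / real n) Y) / of_nat n / (2 * pi * \<i>)) * kern (Complex (of_int j / real n) Y - w))))"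
  have q_eq: "q w = - c * k w + (S (- Y) w - S Y w) / (2 * pi * \<i>)" for w
  proof -
    have "S \<sigma> w / (2 * pi * \<i>) = (\<Sum>j\<in>{- int (N * n)..<int (N * n)}. (P (Complex (of_int j / real n) \<sigma>) / of_nat n / (2 * pi * \<i>)) * kern (Complex (of_int j / real n) \<sigma> - w))" for \<sigma>
      unfolding S_def sum_divide_distrib by (intro sum.cong) auto
    moreover have "(\<Sum>j\<in>{- int (N * n)..<int (N * n)}. (- P (Complex (of_int j / real n) Y) / of_nat n / (2 * pi * \<i>)) * kern (Complex (of_int j / real n) Y - w))
       = - (\<Sum>j\<in>{- int (N * n)..<int (N * n)}. (P (Complex (of_int j / real n) Y) / of_nat n / (2 * pi * \<i>)) * kern (Complex (of_int j / real n) Y - w))"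
      unfolding sum_negf[symmetric] by (intro sum.cong) auto
    ultimately show ?thesis unfolding q_def k_def by (simp add: diff_divide_distrib)
  qed
  have span: "q \<in> kernel_span p"
    unfolding q_def by (intro kernel_span_add kernel_span_sum kernel_span_single) (use p Y in auto)
  show ?thesis
  proof (rule that[OF span])
    fix w assume w: "\<bar>Im w\<bar> < p"
    define x where "x = Re w"
    have wS: "w \<in> hstrip (- Y') Y'" using w p by (auto simp: hstrip_def abs_less_iff)
    have sum_err: "cmod ((\<integral>s. P (Complex s \<sigma>) * kern (Complex s \<sigma> - w) \<partial>lborel) - S \<sigma> w) \<le> (B * exp (- (\<bar>x\<bar> / 2))) * \<eta>"
      if \<sigma>: "\<bar>\<sigma>\<bar> = Y" for \<sigma>
    proof -
      define Q where "Q = (\<lambda>s. P (Complex s \<sigma>) * kern (Complex s \<sigma> - w))"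
      define Q' where "Q' = (\<lambda>s. g (Complex s \<sigma>) * kern (Complex s \<sigma> - w) + P (Complex s \<sigma>) * kern' (Complex s \<sigma> - w))"
      have sS: "Complex s \<sigma> \<in> hstrip (- Y') Y'" for s using \<sigma> Y p by auto
      have I: "\<theta> \<le> \<bar>Im (Complex s \<sigma> - w)\<bar>" "\<bar>Im (Complex s \<sigma> - w)\<bar> \<le> 2 * pi - \<theta>" for s
        using \<sigma> w Y p by (auto simp: \<theta>_def)
      note kb = C2(2)[OF I]
      have der: "(Q has_vector_derivative Q' s) (at s)" for s
      proof -
        have "((\<lambda>\<omega>. P \<omega> * kern (\<omega> - w)) has_field_derivative (g \<omega> * kern (\<omega> - w) + P \<omega> * kern' (\<omega> - w))) (at \<omega>)"
          if "\<omega> = Complex s \<sigma>" for \<omega>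
        proof -
          have "(kern has_field_derivative kern' (\<omega> - w)) (at (\<omega> - w))"
            using kb[of s] that by (intro has_field_derivative_kern) auto
          then have "((\<lambda>\<omega>. kern (\<omega> + - w)) has_field_derivative kern' (\<omega> - w)) (at \<omega>)"
            using DERIV_shift[of kern "kern' (\<omega> - w)" \<omega> "- w"] by simp
          then have "((\<lambda>\<omega>. kern (\<omega> - w)) has_field_derivative kern' (\<omega> - w)) (at \<omega>)" by simp
          from DERIV_mult[OF P[OF sS[of s, folded that]] this] show ?thesis by (simp add: algebra_simps)
        qed
        moreover have "((\<lambda>s. Complex s \<sigma>) has_vector_derivative 1) (at s)"
          unfolding Complex_eq by (auto intro!: derivative_eq_intros)
        ultimately show ?thesis unfolding Q_def Q'_def
          using field_vector_diff_chain_at[of "\<lambda>s. Complex s \<sigma>" 1 s "\<lambda>\<omega>. P \<omega> * kern (\<omega> - w)"] by (auto simp: o_def)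
      qed
      \<comment> \<open>The decay of \<open>P\<close> in \<open>s\<close> and of the kernel in
        \<open>s - x\<close> is shared out: half of it becomes the weight in \<open>x\<close>, half
        remains for integrability in \<open>s\<close>.\<close>
      have ee: "exp (- \<bar>s\<bar>) * exp (- \<bar>s - x\<bar>) \<le> exp (- (\<bar>x\<bar> / 2)) * exp (- (\<bar>s\<bar> / 2))" for s
      proof -
        have "\<bar>x\<bar> \<le> \<bar>s\<bar> + \<bar>s - x\<bar>" "0 \<le> \<bar>s - x\<bar>" by linarith+
        then have "- \<bar>s\<bar> + - \<bar>s - x\<bar> \<le> - (\<bar>x\<bar> / 2) + - (\<bar>s\<bar> / 2)" by linarith
        then show ?thesis unfolding exp_add[symmetric] by simp
      qed
      have prod: "cmod (u * v) \<le> (a * C2) * (exp (- (\<bar>x\<bar> / 2)) * exp (- (\<bar>s\<bar> / 2)))"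
        if "cmod u \<le> a * exp (- \<bar>s\<bar>)" "cmod v \<le> C2 * exp (- \<bar>s - x\<bar>)" "a \<ge> 0" for u v a s
      proof -
        have "cmod (u * v) \<le> (a * exp (- \<bar>s\<bar>)) * (C2 * exp (- \<bar>s - x\<bar>))"
          unfolding norm_mult using that by (intro mult_mono) auto
        also have "\<dots> = (a * C2) * (exp (- \<bar>s\<bar>) * exp (- \<bar>s - x\<bar>))" by (simp add: algebra_simps)
        also have "\<dots> \<le> (a * C2) * (exp (- (\<bar>x\<bar> / 2)) * exp (- (\<bar>s\<bar> / 2)))"
          using ee[of s] that C2(1) by (intro mult_left_mono) auto
        finally show ?thesis .
      qed
      have kx: "cmod (kern (Complex s \<sigma> - w)) \<le> C2 * exp (- \<bar>s - x\<bar>)" "cmod (kern' (Complex s \<sigma> - w)) \<le> C2 * exp (- \<bar>s - x\<bar>)" for s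
        using kb[of s] by (simp_all add: x_def)
      have Px: "cmod (P (Complex s \<sigma>)) \<le> D * exp (- \<bar>s\<bar>)" and gx: "cmod (g (Complex s \<sigma>)) \<le> Cg * exp (- \<bar>s\<bar>)" for s
        using Pbd[OF sS[of s]] gbd[OF sS[of s]] by simp_all
      have Xe: "0 \<le> exp (- (\<bar>x\<bar> / 2)) * exp (- (\<bar>s\<bar> / 2))" for s by simp
      have bdQ: "cmod (Q s) \<le> (B * exp (- (\<bar>x\<bar> / 2))) * exp (- (\<bar>s\<bar> / 2))" for s
      proof -
        have "cmod (Q s) \<le> (D * C2) * (exp (- (\<bar>x\<bar> / 2)) * exp (- (\<bar>s\<bar> / 2)))"
          unfolding Q_def by (rule prod[OF Px kx(1) D0])
        also have "\<dots> \<le> B * (exp (- (\<bar>x\<bar> / 2)) * exp (- (\<bar>s\<bar> / 2)))"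
          unfolding B_def using Cg0 C2(1) by (intro mult_right_mono Xe) auto
        finally show ?thesis by (simp add: mult.assoc)
      qed
      have bdQ': "cmod (Q' s) \<le> B * exp (- (\<bar>x\<bar> / 2))" for s
      proof -
        have "cmod (Q' s) \<le> (Cg * C2) * (exp (- (\<bar>x\<bar> / 2)) * exp (- (\<bar>s\<bar> / 2))) + (D * C2) * (exp (- (\<bar>x\<bar> / 2)) * exp (- (\<bar>s\<bar> / 2)))"
          unfolding Q'_def by (rule order_trans[OF norm_triangle_ineq]) (intro add_mono prod gx Px kx Cg0 D0)
        also have "\<dots> = B * exp (- (\<bar>x\<bar> / 2)) * exp (- (\<bar>s\<bar> / 2))" by (simp add: B_def algebra_simps)
        also have "\<dots> \<le> B * exp (- (\<bar>x\<bar> / 2)) * 1" using B0 by (intro mult_left_mono) auto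
        finally show ?thesis by simp
      qed
      have "cmod ((\<integral>s. Q s \<partial>lborel) - (\<Sum>j\<in>{- int (N * n)..<int (N * n)}. Q (of_int j / real n) / of_nat n))
        \<le> (B * exp (- (\<bar>x\<bar> / 2))) * (2 * real N / real n + J * exp (- (real N / 4)))"
        unfolding J_def by (rule riemann_sum_bound[OF der bdQ bdQ' n0])
      also have "\<dots> \<le> (B * exp (- (\<bar>x\<bar> / 2))) * \<eta>"
        by (intro mult_left_mono) (use N nN in linarith, use B0 in simp)
      finally show ?thesis unfolding Q_def S_def .
    qed
    have "2 * pi * \<i> * g w = (\<integral>s. P (Complex s (- Y)) * kern (Complex s (- Y) - w) \<partial>lborel)
      - (\<integral>s. P (Complex s Y) * kern (Complex s Y - w) \<partial>lborel)"
      by (rule strip_kernel_representation[OF P Pbd]) (use p Y w in auto)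
    then have gw: "g w = ((\<integral>s. P (Complex s (- Y)) * kern (Complex s (- Y) - w) \<partial>lborel)
      - (\<integral>s. P (Complex s Y) * kern (Complex s Y - w) \<partial>lborel)) / (2 * pi * \<i>)"
      by (simp add: field_simps)
    have "f w - q w = g w - (S (- Y) w - S Y w) / (2 * pi * \<i>)"
      unfolding q_eq by (simp add: g_def)
    also have "\<dots> = (((\<integral>s. P (Complex s (- Y)) * kern (Complex s (- Y) - w) \<partial>lborel) - S (- Y) w)
        - ((\<integral>s. P (Complex s Y) * kern (Complex s Y - w) \<partial>lborel) - S Y w)) / (2 * pi * \<i>)"
      unfolding gw by (simp add: diff_divide_distrib)
    finally have fq: "f w - q w = (((\<integral>s. P (Complex s (- Y)) * kern (Complex s (- Y) - w) \<partial>lborel) - S (- Y) w)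
        - ((\<integral>s. P (Complex s Y) * kern (Complex s Y - w) \<partial>lborel) - S Y w)) / (2 * pi * \<i>)" .
    have n2pi: "cmod (2 * pi * \<i>) = 2 * pi" by (simp add: norm_mult)
    have "cmod ((((\<integral>s. P (Complex s (- Y)) * kern (Complex s (- Y) - w) \<partial>lborel) - S (- Y) w)
        - ((\<integral>s. P (Complex s Y) * kern (Complex s Y - w) \<partial>lborel) - S Y w)) / (2 * pi * \<i>)) \<le> ((B * exp (- (\<bar>x\<bar> / 2))) * \<eta> + (B * exp (- (\<bar>x\<bar> / 2))) * \<eta>) / (2 * pi)"
      unfolding norm_divide n2pi
      by (intro divide_right_mono order_trans[OF norm_triangle_ineq4] add_mono sum_err) (use Y p in auto)
    also have "\<dots> = (B * \<eta> * exp (- (\<bar>x\<bar> / 2))) / pi" by (simp add: field_simps)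
    also have "\<dots> \<le> (B * \<eta> * exp (- (\<bar>x\<bar> / 2))) / 1"
      using B0 \<eta> pi_gt3 by (intro divide_left_mono) auto
    also have "\<dots> \<le> e * exp (- (\<bar>x\<bar> / 2))"
    proof -
      have "B * \<eta> \<le> (B + 1) * \<eta>" using \<eta> by simp
      also have "\<dots> = e" using B0 by (simp add: \<eta>_def)
      finally show ?thesis by simp
    qed
    finally show "cmod (f w - q w) \<le> e * exp (- (\<bar>Re w\<bar> / 2))" unfolding fq x_def .
  qed
qed

text \<open>Half of \<open>e\<close> pays for dilation and damping, half for replacing the damped
  function by kernels. The second error is a pointwise one whose weight has the integral
  \<open>J\<close> on every line.\<close>

lemma hardy_kernel_span_dense:
  assumes p: "0 < p" "p < pi" and h: "hardy_strip p h K" and e: "e > 0"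
  obtains q where "q \<in> kernel_span p"
    "\<And>y. \<bar>y\<bar> < p \<Longrightarrow> (\<integral>\<^sup>+x. ennreal (cmod (h (Complex x y) - q (Complex x y))) \<partial>lborel) < ennreal e"
proof -
  have holo: "h holomorphic_on hstrip (- p) p" using h by (simp add: hardy_strip_def)
  have int: "integrable lborel (\<lambda>x. h (Complex x y))" and K: "hline_norm h y \<le> K" if "\<bar>y\<bar> < p" for y
    using h that by (auto simp: hardy_strip_def)
  \<comment> \<open>The lower bound \<open>p / pi\<close> on the dilation factor ensures
    \<open>p / a < pi\<close>, so that the larger strip can be chosen of half-width
    \<open>Y'\<close> between \<open>p\<close> and \<open>p / a\<close> and still below pi.\<close>
  have "p / pi < 1" using p by simp
  then obtain a \<delta> where a: "0 < a" "p / pi < a" "a < 1" and \<delta>: "0 < \<delta>"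
    and err: "\<And>y. \<bar>y\<bar> < p \<Longrightarrow> (\<integral>x. cmod (of_real a * h (of_real a * Complex x y) * exp (- (of_real \<delta> * (Complex x y)\<^sup>2)) - h (Complex x y)) \<partial>lborel) < e / 2"
    using hardy_dilation_gauss_approx[OF h p(1), of "e / 2" "p / pi"] e by auto
  define Y' where "Y' = (p + p / a) / 2"
  have pa: "p < p / a" "p / a < pi" using a p by (auto simp: field_simps)
  have "p < (p + t) / 2 \<and> (p + t) / 2 < t" if "p < t" for t using that by (simp add: field_simps)
  from this[OF pa(1)] have Y': "p < Y'" "Y' < p / a" "Y' < pi" using pa(2) by (auto simp: Y'_def)
  have aY: "a * Y' < p" using Y'(2) a by (simp add: field_simps)
  \<comment> \<open>Half of the room between the dilated strip and the boundary of the domain of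
    \<open>h\<close>, serving as the radius in the pointwise bound.\<close>
  define r where "r = (p - a * Y') / 2"
  have r: "r > 0" "a * Y' + r < p" using aY by (auto simp: r_def field_simps)
  define f where "f = (\<lambda>w. of_real a * h (of_real a * w) * exp (- (of_real \<delta> * w\<^sup>2)))"
  have Ima: "\<bar>Im (of_real a * w)\<bar> < a * Y'" if "w \<in> hstrip (- Y') Y'" for w
  proof -
    have "\<bar>Im w\<bar> < Y'" using that by (auto simp: hstrip_def)
    then show ?thesis using a by (simp add: abs_mult)
  qed
  have fholo: "f holomorphic_on hstrip (- Y') Y'"
  proof -
    have "(h \<circ> (\<lambda>w. of_real a * w)) holomorphic_on hstrip (- Y') Y'"
    proof (rule holomorphic_on_compose_gen[OF _ holo])
      show "(*) (complex_of_real a) ` hstrip (- Y') Y' \<subseteq> hstrip (- p) p"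
        using Ima aY by (force simp: hstrip_def abs_less_iff)
    qed (intro holomorphic_intros)
    then show ?thesis unfolding f_def by (intro holomorphic_intros) (simp add: o_def)
  qed
  have K0: "K \<ge> 0" using K[of 0] p by (simp add: hline_norm_def order_trans[OF _ K[of 0]])
  define C where "C = K / r * exp (\<delta> * Y'\<^sup>2) * exp (1 / (4 * \<delta>))"
  have fbd: "cmod (f w) \<le> C * exp (- \<bar>Re w\<bar>)" if w: "w \<in> hstrip (- Y') Y'" for w
  proof -
    have hb: "cmod (h (of_real a * w)) \<le> K / r"
      by (rule hardy_pointwise_bound[OF holo int K r(1)]) (use Ima[OF w] r(2) in \<open>auto simp: abs_less_iff\<close>)
    have "(Im w)\<^sup>2 \<le> Y'\<^sup>2" using w by (intro power2_le_iff_abs_le[THEN iffD2]) (auto simp: hstrip_def)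
    then have "exp (\<delta> * (Im w)\<^sup>2) \<le> exp (\<delta> * Y'\<^sup>2)" using \<delta> by simp
    then have "cmod (exp (- (of_real \<delta> * w\<^sup>2))) \<le> exp (\<delta> * Y'\<^sup>2) * (exp (1 / (4 * \<delta>)) * exp (- \<bar>Re w\<bar>))"
      unfolding cmod_exp_gauss using gauss_le_exp_abs[OF \<delta>] by (intro mult_mono) auto
    moreover have "cmod (of_real a * h (of_real a * w)) \<le> 1 * (K / r)"
      unfolding norm_mult using a hb by (intro mult_mono) auto
    ultimately have "cmod (f w) \<le> (1 * (K / r)) * (exp (\<delta> * Y'\<^sup>2) * (exp (1 / (4 * \<delta>)) * exp (- \<bar>Re w\<bar>)))"
      unfolding f_def norm_mult[of "_ * _" "exp _"] using K0 r by (intro mult_mono) auto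
    then show ?thesis by (simp add: C_def mult.assoc)
  qed
  define J where "J = (\<integral>x. exp (- (\<bar>x :: real\<bar> / 2)) \<partial>lborel)"
  have J0: "J \<ge> 0" by (simp add: J_def)
  have e2: "integrable lborel (\<lambda>s::real. exp (- (\<bar>s\<bar> / 2)))" using integrable_exp_abs[of "1/2"] by simp
  define \<epsilon> where "\<epsilon> = (e / 2) / (J + 1)"
  have \<epsilon>: "\<epsilon> > 0" using e J0 by (simp add: \<epsilon>_def)
  obtain q where q: "q \<in> kernel_span p" "\<And>w. \<bar>Im w\<bar> < p \<Longrightarrow> cmod (f w - q w) \<le> \<epsilon> * exp (- (\<bar>Re w\<bar> / 2))"
    using kernel_span_approx_decaying[OF p(1) Y'(1,3) fholo fbd \<epsilon>] by blast
  show ?thesis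
  proof (rule that[OF q(1)])
    fix y assume y: "\<bar>y\<bar> < p"
    have yY: "- Y' < y" "y < Y'" using y Y' by auto
    have fint: "integrable lborel (\<lambda>x. f (Complex x y))"
      using fbd[of "Complex _ y"] yY
      by (intro integrable_of_exp_bound[where C = C] measurable_hline[OF holomorphic_on_imp_continuous_on[OF fholo]]) auto
    have bint: "integrable lborel (\<lambda>x. cmod (f (Complex x y) - h (Complex x y)) + \<epsilon> * exp (- (\<bar>x\<bar> / 2)))"
      using fint int[OF y] e2 by simp
    have "(\<integral>\<^sup>+x. ennreal (cmod (h (Complex x y) - q (Complex x y))) \<partial>lborel)
      \<le> (\<integral>\<^sup>+x. ennreal (cmod (f (Complex x y) - h (Complex x y)) + \<epsilon> * exp (- (\<bar>x\<bar> / 2))) \<partial>lborel)"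
    proof (intro nn_integral_mono ennreal_leI)
      fix x
      have "cmod (h (Complex x y) - q (Complex x y)) \<le> cmod (h (Complex x y) - f (Complex x y)) + cmod (f (Complex x y) - q (Complex x y))"
        using norm_triangle_ineq[of "h (Complex x y) - f (Complex x y)" "f (Complex x y) - q (Complex x y)"] by simp
      then show "cmod (h (Complex x y) - q (Complex x y)) \<le> cmod (f (Complex x y) - h (Complex x y)) + \<epsilon> * exp (- (\<bar>x\<bar> / 2))"
        using q(2)[of "Complex x y"] y by (simp add: norm_minus_commute)
    qed
    also have "\<dots> = ennreal (\<integral>x. cmod (f (Complex x y) - h (Complex x y)) + \<epsilon> * exp (- (\<bar>x\<bar> / 2)) \<partial>lborel)"
      using \<epsilon> by (intro nn_integral_eq_integral bint) auto
    also have "(\<integral>x. cmod (f (Complex x y) - h (Complex x y)) + \<epsilon> * exp (- (\<bar>x\<bar> / 2)) \<partial>lborel)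
       = (\<integral>x. cmod (f (Complex x y) - h (Complex x y)) \<partial>lborel) + \<epsilon> * J"
      using fint int[OF y] e2 by (simp add: J_def)
    also have "ennreal \<dots> < ennreal e"
    proof (rule ennreal_lessI[OF e])
      have "\<epsilon> * J \<le> \<epsilon> * (J + 1)" using \<epsilon> by simp
      also have "\<dots> = e / 2"
      proof -
        have "J + 1 \<noteq> 0" using J0 by linarith
        from nonzero_eq_divide_eq[OF this, of \<epsilon> "e / 2"] \<epsilon>_def show ?thesis by blast
      qed
      finally show "(\<integral>x. cmod (f (Complex x y) - h (Complex x y)) \<partial>lborel) + \<epsilon> * J < e"
        using err[OF y] unfolding f_def by (simp add: field_simps)
    qed
    finally show "(\<integral>\<^sup>+x. ennreal (cmod (h (Complex x y) - q (Complex x y))) \<partial>lborel) < ennreal e" .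
  qed
qed

section \<open>Transfer to the sector\<close>

lemma exp_in_sector: "\<bar>Im w\<bar> < \<psi> \<Longrightarrow> \<psi> \<le> pi \<Longrightarrow> exp w \<in> sector \<psi>"
  by (simp add: sector_def Arg_exp abs_less_iff)

lemma sector_exp:
  assumes "z \<in> sector \<psi>"
  obtains w where "z = exp w" "\<bar>Im w\<bar> < \<psi>"
  using assms that[of "Ln z"] by (auto simp: sector_def Arg_eq_Im_Ln)

text \<open>Because of \<open>\<psi> < pi\<close> the sector avoids the negative real axis, off
  which the imaginary part of \<open>Ln\<close> is continuous.\<close>

lemma open_sector:
  assumes "\<psi> < pi"
  shows "open (sector \<psi>)"
proof -
  have "sector \<psi> = (- \<real>\<^sub>\<le>\<^sub>0) \<inter> (\<lambda>z. Im (Ln z)) -` {- \<psi><..<\<psi>}"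
  proof (intro equalityI subsetI)
    fix z assume z: "z \<in> sector \<psi>"
    then have z0: "z \<noteq> 0" "\<bar>Im (Ln z)\<bar> < \<psi>" by (auto simp: sector_def Arg_eq_Im_Ln)
    then have "\<bar>Im (Ln z)\<bar> < pi" using assms by simp
    then have "z \<notin> \<real>\<^sub>\<le>\<^sub>0" using z0 Im_Ln_eq_pi complex_nonpos_Reals_iff
      by (metis abs_of_pos less_irrefl order_le_less pi_gt_zero complex_eq_iff zero_complex.sel)
    then show "z \<in> (- \<real>\<^sub>\<le>\<^sub>0) \<inter> (\<lambda>z. Im (Ln z)) -` {- \<psi><..<\<psi>}" using z0 by auto
  next
    fix z assume z: "z \<in> (- \<real>\<^sub>\<le>\<^sub>0) \<inter> (\<lambda>z. Im (Ln z)) -` {- \<psi><..<\<psi>}"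
    then have "z \<noteq> 0" by auto
    then show "z \<in> sector \<psi>" using z by (auto simp: sector_def Arg_eq_Im_Ln)
  qed
  moreover have "continuous_on (- \<real>\<^sub>\<le>\<^sub>0) (\<lambda>z. Im (Ln z))"
    by (intro continuous_intros) auto
  ultimately show ?thesis
    by (metis closed_nonpos_Reals_complex continuous_open_preimage open_Compl open_greaterThanLessThan)
qed

text \<open>\<open>l = - z\<close> would make the arguments differ by an odd multiple of pi, while
  their moduli add up to less than pi.\<close>

lemma sector_add_ne_0:
  assumes "0 < \<psi>" "\<psi> < pi" "l \<in> sector (pi - \<psi>)" "z \<in> sector \<psi>"
  shows "l + z \<noteq> 0"
proof
  assume 0: "l + z = 0"
  obtain v where v: "l = exp v" "\<bar>Im v\<bar> < pi - \<psi>" using assms(3) by (rule sector_exp)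
  obtain w where w: "z = exp w" "\<bar>Im w\<bar> < \<psi>" using assms(4) by (rule sector_exp)
  have "exp v = - exp w" using 0 by (simp add: v w add_eq_0_iff2)
  then have "exp (v - w - \<i> * pi) = 1" by (simp add: exp_diff)
  moreover have "\<bar>Im (v - w - \<i> * pi)\<bar> < 2 * pi" using v(2) w(2) by auto
  ultimately have "v - w - \<i> * pi = 0" by (rule exp_eq_1_strip)
  then have "Im v - Im w = pi" by (simp add: complex_eq_iff)
  then show False using v(2) w(2) by auto
qed

text \<open>The substitution \<open>t = exp x\<close> on the compact intervals \<open>A n\<close>
  and \<open>B n\<close>, followed by monotone convergence on both sides; integrability is not
  assumed, so the identity also covers infinite values.\<close>

lemma nn_integral_exp_substitution:
  fixes u :: "real \<Rightarrow> real"
  assumes cont: "continuous_on {0<..} u" and nn: "\<And>t. 0 < t \<Longrightarrow> 0 \<le> u t"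
  shows "(\<integral>\<^sup>+t. ennreal (u t * indicator {0<..} t) \<partial>lborel) = (\<integral>\<^sup>+x. ennreal (exp x * u (exp x)) \<partial>lborel)"
proof -
  have m[measurable]: "(\<lambda>t. u t * indicator {0<..} t) \<in> borel_measurable borel"
    using borel_measurable_continuous_on_indicator[OF _ cont] by (simp add: mult.commute)
  have m2[measurable]: "(\<lambda>x. exp x * u (exp x)) \<in> borel_measurable borel"
    by (intro borel_measurable_continuous_onI continuous_intros continuous_on_compose2[OF cont]) auto
  define A where "A = (\<lambda>n. {exp (- real n)..exp (real n)})"
  define B where "B = (\<lambda>n. {- real n..real n})"
  have step: "(\<integral>\<^sup>+t. ennreal (u t * indicator {0<..} t) * indicator (A n) t \<partial>lborel)
     = (\<integral>\<^sup>+x. ennreal (exp x * u (exp x)) * indicator (B n) x \<partial>lborel)" for n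
  proof -
    have sub: "A n \<subseteq> {0<..}" unfolding A_def by (auto intro: less_le_trans[OF exp_gt_zero])
    have "(\<integral>\<^sup>+t. ennreal (u t * indicator (A n) t) \<partial>lborel) = (\<integral>\<^sup>+x. ennreal (u (exp x) * exp x * indicator (B n) x) \<partial>lborel)"
      unfolding A_def B_def
    proof (rule nn_integral_substitution)
      show "set_borel_measurable borel {exp (- real n)..exp (real n)} u"
        unfolding set_borel_measurable_def
        using borel_measurable_continuous_on_indicator[OF _ continuous_on_subset[OF cont sub]] by (simp add: A_def)
    qed (auto intro!: continuous_intros derivative_eq_intros)
    moreover have "ennreal (u t * indicator {0<..} t) * indicator (A n) t = ennreal (u t * indicator (A n) t)" for t
      using sub by (auto split: split_indicator)
    moreover have "ennreal (exp x * u (exp x)) * indicator (B n) x = ennreal (u (exp x) * exp x * indicator (B n) x)" for x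
      by (auto split: split_indicator simp: mult.commute)
    ultimately show ?thesis by simp
  qed
  have mono: "indicator (A m) x \<le> (indicator (A n) x :: ennreal)" "indicator (B m) x \<le> (indicator (B n) x :: ennreal)"
    if "m \<le> n" for m n x
  proof -
    have "exp (- real n) \<le> exp (- real m)" "exp (real m) \<le> exp (real n)" using that by simp_all
    then have "A m \<subseteq> A n" "B m \<subseteq> B n" unfolding A_def B_def using that by auto
    then show "indicator (A m) x \<le> (indicator (A n) x :: ennreal)" "indicator (B m) x \<le> (indicator (B n) x :: ennreal)"
      by (auto split: split_indicator)
  qed
  have UB: "(SUP n. indicator (B n) x) = (1::ennreal)" for x :: real
  proof -
    obtain N where N: "\<bar>x\<bar> \<le> real N" using real_arch_simple by blast
    then have ind: "indicator (B N) x = (1::ennreal)" by (simp add: B_def indicator_def abs_le_iff)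
    show ?thesis
    proof (rule antisym)
      show "(SUP n. indicator (B n) x) \<le> (1::ennreal)" by (rule SUP_least) (simp add: indicator_def)
      show "1 \<le> (SUP n. indicator (B n) x :: ennreal)" by (rule SUP_upper2[of N]) (simp_all add: ind)
    qed
  qed
  have UA: "(SUP n. indicator (A n) t) = (1::ennreal)" if "t > 0" for t :: real
  proof -
    obtain N where N: "\<bar>ln t\<bar> \<le> real N" using real_arch_simple by blast
    then have "exp (- real N) \<le> exp (ln t)" "exp (ln t) \<le> exp (real N)"
      unfolding exp_le_cancel_iff by linarith+
    then have "exp (- real N) \<le> t" "t \<le> exp (real N)" using that by simp_all
    then have ind: "indicator (A N) t = (1::ennreal)" by (simp add: A_def)
    show ?thesis
    proof (rule antisym)
      show "(SUP n. indicator (A n) t) \<le> (1::ennreal)" by (rule SUP_least) (simp add: indicator_def)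
      show "1 \<le> (SUP n. indicator (A n) t :: ennreal)" by (rule SUP_upper2[of N]) (simp_all add: ind)
    qed
  qed
  have mA[measurable]: "A n \<in> sets borel" "B n \<in> sets borel" for n by (auto simp: A_def B_def)
  have "(\<integral>\<^sup>+t. ennreal (u t * indicator {0<..} t) \<partial>lborel) = (\<integral>\<^sup>+t. (SUP n. ennreal (u t * indicator {0<..} t) * indicator (A n) t) \<partial>lborel)"
  proof (intro nn_integral_cong)
    fix t :: real
    show "ennreal (u t * indicator {0<..} t) = (SUP n. ennreal (u t * indicator {0<..} t) * indicator (A n) t)"
      by (cases "t > 0") (simp_all add: SUP_mult_left_ennreal[symmetric] UA)
  qed
  also have "\<dots> = (SUP n. \<integral>\<^sup>+t. ennreal (u t * indicator {0<..} t) * indicator (A n) t \<partial>lborel)"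
    by (rule nn_integral_monotone_convergence_SUP)
       (auto simp: incseq_def le_fun_def intro!: mult_left_mono mono)
  also have "\<dots> = (SUP n. \<integral>\<^sup>+x. ennreal (exp x * u (exp x)) * indicator (B n) x \<partial>lborel)"
    by (simp only: step)
  also have "\<dots> = (\<integral>\<^sup>+x. (SUP n. ennreal (exp x * u (exp x)) * indicator (B n) x) \<partial>lborel)"
    by (rule nn_integral_monotone_convergence_SUP[symmetric])
       (auto simp: incseq_def le_fun_def intro!: mult_left_mono mono)
  also have "\<dots> = (\<integral>\<^sup>+x. ennreal (exp x * u (exp x)) \<partial>lborel)"
    by (intro nn_integral_cong) (simp add: SUP_mult_left_ennreal[symmetric] UB)
  finally show ?thesis .
qed

lemma exp_Complex_eq_cis: "exp (Complex x \<phi>) = of_real (exp x) * cis \<phi>"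
  by (simp add: exp_eq_polar)

text \<open>The Jacobian \<open>exp x\<close> is the modulus of
  \<open>exp (Complex x \<phi>)\<close>, which turns each ray integral into the L^1 norm of a
  horizontal trace. Continuity of \<open>g\<close> supplies the measurability for splitting the
  integral over the two rays.\<close>

lemma H1norm_eq_strip:
  assumes \<psi>: "\<psi> < pi" and g: "continuous_on (sector \<psi>) g"
  shows "H1norm \<psi> g = (SUP \<phi>\<in>{- \<psi><..<\<psi>}.
      (\<integral>\<^sup>+x. ennreal (cmod (exp (Complex x \<phi>) * g (exp (Complex x \<phi>)))) \<partial>lborel)
    + (\<integral>\<^sup>+x. ennreal (cmod (exp (Complex x (- \<phi>)) * g (exp (Complex x (- \<phi>))))) \<partial>lborel))"
  unfolding H1norm_def
proof (rule SUP_cong[OF refl])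
  fix \<phi> assume \<phi>: "\<phi> \<in> {- \<psi><..<\<psi>}"
  have ray: "of_real t * cis \<theta> \<in> sector \<psi>" if "t > 0" "\<bar>\<theta>\<bar> < \<psi>" for t \<theta>
    using exp_in_sector[of "Complex (ln t) \<theta>" \<psi>] that \<psi> by (simp add: exp_Complex_eq_cis)
  have cont: "continuous_on {0<..} (\<lambda>t. cmod (g (of_real t * cis \<theta>)))" if "\<bar>\<theta>\<bar> < \<psi>" for \<theta>
    by (intro continuous_intros continuous_on_compose2[OF g]) (use ray that in auto)
  have m: "(\<lambda>t. ennreal (cmod (g (of_real t * cis \<theta>)) * indicator {0<..} t)) \<in> borel_measurable lborel" if "\<bar>\<theta>\<bar> < \<psi>" for \<theta>
    using borel_measurable_continuous_on_indicator[OF _ cont[OF that]] by (simp add: mult.commute)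
  have eq: "(\<integral>\<^sup>+t. ennreal (cmod (g (of_real t * cis \<theta>)) * indicator {0<..} t) \<partial>lborel)
     = (\<integral>\<^sup>+x. ennreal (cmod (exp (Complex x \<theta>) * g (exp (Complex x \<theta>)))) \<partial>lborel)" if "\<bar>\<theta>\<bar> < \<psi>" for \<theta>
    using nn_integral_exp_substitution[OF cont[OF that]] by (simp add: norm_mult exp_Complex_eq_cis)
  have \<phi>': "\<bar>\<phi>\<bar> < \<psi>" "\<bar>- \<phi>\<bar> < \<psi>" using \<phi> by auto
  have "(\<integral>\<^sup>+t. ennreal ((cmod (g (of_real t * cis \<phi>)) + cmod (g (of_real t * cis (- \<phi>)))) * indicator {0<..} t) \<partial>lborel)
    = (\<integral>\<^sup>+t. ennreal (cmod (g (of_real t * cis \<phi>)) * indicator {0<..} t) + ennreal (cmod (g (of_real t * cis (- \<phi>))) * indicator {0<..} t) \<partial>lborel)"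
    by (intro nn_integral_cong) (simp add: distrib_right ennreal_plus[symmetric] del: ennreal_plus)
  also have "\<dots> = (\<integral>\<^sup>+t. ennreal (cmod (g (of_real t * cis \<phi>)) * indicator {0<..} t) \<partial>lborel)
     + (\<integral>\<^sup>+t. ennreal (cmod (g (of_real t * cis (- \<phi>))) * indicator {0<..} t) \<partial>lborel)"
    by (intro nn_integral_add m \<phi>')
  finally show "(\<integral>\<^sup>+t. ennreal ((cmod (g (of_real t * cis \<phi>)) + cmod (g (of_real t * cis (- \<phi>)))) * indicator {0<..} t) \<partial>lborel)
    = (\<integral>\<^sup>+x. ennreal (cmod (exp (Complex x \<phi>) * g (exp (Complex x \<phi>)))) \<partial>lborel)
    + (\<integral>\<^sup>+x. ennreal (cmod (exp (Complex x (- \<phi>)) * g (exp (Complex x (- \<phi>))))) \<partial>lborel)"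
    unfolding eq[OF \<phi>'(1)] eq[OF \<phi>'(2)] .
qed

text \<open>The factor 2 is there because the norm adds the rays at \<open>\<phi>\<close> and at
  \<open>- \<phi>\<close>.\<close>

lemma H1norm_le:
  assumes \<psi>: "\<psi> < pi" and g: "continuous_on (sector \<psi>) g" and B: "B \<ge> 0"
    and bd: "\<And>y. \<bar>y\<bar> < \<psi> \<Longrightarrow> (\<integral>\<^sup>+x. ennreal (cmod (exp (Complex x y) * g (exp (Complex x y)))) \<partial>lborel) \<le> ennreal B"
  shows "H1norm \<psi> g \<le> ennreal (2 * B)"
  unfolding H1norm_eq_strip[OF \<psi> g]
proof (rule SUP_least)
  fix \<phi> assume "\<phi> \<in> {- \<psi><..<\<psi>}"
  then have "\<bar>\<phi>\<bar> < \<psi>" "\<bar>- \<phi>\<bar> < \<psi>" by auto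
  from add_mono[OF bd[OF this(1)] bd[OF this(2)]]
  show "(\<integral>\<^sup>+x. ennreal (cmod (exp (Complex x \<phi>) * g (exp (Complex x \<phi>)))) \<partial>lborel)
    + (\<integral>\<^sup>+x. ennreal (cmod (exp (Complex x (- \<phi>)) * g (exp (Complex x (- \<phi>))))) \<partial>lborel) \<le> ennreal (2 * B)"
    using B by (simp add: ennreal_plus[symmetric] del: ennreal_plus)
qed

lemma kern_resolvent:
  assumes "l = - exp \<omega>"
  shows "exp w * (- l / (l + exp w)\<^sup>2) = kern (\<omega> - w)"
proof -
  have "exp \<omega> - exp w = exp w * (exp (\<omega> - w) - 1)" by (simp add: exp_diff algebra_simps)
  moreover have "exp \<omega> = exp w * exp (\<omega> - w)" by (simp add: exp_diff)
  moreover have "(l + exp w)\<^sup>2 = (exp \<omega> - exp w)\<^sup>2" by (simp add: assms power2_commute)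
  ultimately show ?thesis using assms by (simp add: kern_def power2_eq_square)
qed

lemma deriv_resolvent:
  assumes "l + z \<noteq> 0"
  shows "((\<lambda>z. c / (l + z)) has_field_derivative - c / (l + z)\<^sup>2) (at z)"
  using assms by (auto intro!: derivative_eq_intros simp: power2_eq_square)

text \<open>In the strip coordinate the derivative is a constant multiple of one kernel whose pole
  stays away from the strip, so it decays exponentially, uniformly in the height.\<close>

lemma Hpsi0_resolvent:
  assumes \<psi>: "0 < \<psi>" "\<psi> < pi" and l: "l \<in> sector (pi - \<psi>)"
  shows "Hpsi0 \<psi> (\<lambda>z. 1 / (l + z))"
proof -
  let ?f = "\<lambda>z. 1 / (l + z)"
  note ne = sector_add_ne_0[OF \<psi> l]
  have holo: "?f holomorphic_on sector \<psi>" using ne by (intro holomorphic_intros) auto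
  have dholo: "deriv ?f holomorphic_on sector \<psi>" by (rule holomorphic_deriv[OF holo open_sector[OF \<psi>(2)]])
  have d: "deriv ?f z = - 1 / (l + z)\<^sup>2" if "z \<in> sector \<psi>" for z
    by (rule DERIV_imp_deriv[OF deriv_resolvent[OF ne[OF that]]])
  obtain v where v: "l = exp v" "\<bar>Im v\<bar> < pi - \<psi>" using l by (rule sector_exp)
  \<comment> \<open>For \<open>w\<close> in the strip, \<open>Im (\<omega> - w)\<close> differs from
    pi by less than \<open>\<bar>Im v\<bar> + \<psi> = pi - \<theta>\<close>, with
    \<open>\<theta>\<close> as chosen next; this is the range that \<open>kern_bounds\<close> asks
    for.\<close>
  define \<omega> where "\<omega> = v + \<i> * pi"
  have l\<omega>: "l = - exp \<omega>" by (simp add: v \<omega>_def exp_add)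
  define \<theta> where "\<theta> = pi - \<psi> - \<bar>Im v\<bar>"
  have \<theta>: "0 < \<theta>" "\<theta> \<le> pi" using v \<psi> by (auto simp: \<theta>_def)
  obtain C where C: "C > 0" "\<And>u. \<theta> \<le> \<bar>Im u\<bar> \<Longrightarrow> \<bar>Im u\<bar> \<le> 2 * pi - \<theta> \<Longrightarrow>
     exp u \<noteq> 1 \<and> cmod (kern u) \<le> C * exp (- \<bar>Re u\<bar>) \<and> cmod (kern' u) \<le> C * exp (- \<bar>Re u\<bar>)"
    using kern_bounds[OF \<theta>] by blast
  \<comment> \<open>The exponential recentres the decay from \<open>Re \<omega>\<close> to 0; the
    division by \<open>cmod l\<close> occurs because the kernel belongs to
    \<open>l / (l + z)\<close>.\<close>
  define D where "D = C * exp \<bar>Re \<omega>\<bar> / cmod l"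
  have D0: "D \<ge> 0" using C by (simp add: D_def)
  define J where "J = (\<integral>x. exp (- \<bar>x :: real\<bar>) \<partial>lborel)"
  have Ji: "integrable lborel (\<lambda>x::real. exp (- \<bar>x\<bar>))" using integrable_exp_abs[of 1] by simp
  have point: "cmod (exp (Complex x y) * deriv ?f (exp (Complex x y))) \<le> D * exp (- \<bar>x\<bar>)" if y: "\<bar>y\<bar> < \<psi>" for x y
  proof -
    let ?w = "Complex x y"
    have "exp ?w * deriv ?f (exp ?w) = exp ?w * (- l / (l + exp ?w)\<^sup>2) / l"
      using d[OF exp_in_sector[of ?w]] y \<psi> v(1) by simp
    then have eq: "exp ?w * deriv ?f (exp ?w) = kern (\<omega> - ?w) / l" by (simp only: kern_resolvent[OF l\<omega>])
    have "cmod (kern (\<omega> - ?w)) \<le> C * exp (- \<bar>Re \<omega> - x\<bar>)"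
    proof -
      have "\<theta> \<le> \<bar>Im (\<omega> - ?w)\<bar>" "\<bar>Im (\<omega> - ?w)\<bar> \<le> 2 * pi - \<theta>" using v(2) y by (auto simp: \<theta>_def \<omega>_def)
      from C(2)[OF this] show ?thesis by simp
    qed
    also have "\<dots> \<le> C * (exp \<bar>Re \<omega>\<bar> * exp (- \<bar>x\<bar>))"
      unfolding exp_add[symmetric] using C(1) by (intro mult_left_mono) auto
    finally show ?thesis unfolding eq by (simp add: norm_divide D_def divide_right_mono mult.assoc)
  qed
  have "H1norm \<psi> (deriv ?f) \<le> ennreal (2 * (D * J))"
  proof (rule H1norm_le[OF \<psi>(2) holomorphic_on_imp_continuous_on[OF dholo]])
    show "D * J \<ge> 0" using D0 by (simp add: J_def)
    fix y assume y: "\<bar>y\<bar> < \<psi>"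
    have "(\<integral>\<^sup>+x. ennreal (cmod (exp (Complex x y) * deriv ?f (exp (Complex x y)))) \<partial>lborel) \<le> (\<integral>\<^sup>+x. ennreal (D * exp (- \<bar>x\<bar>)) \<partial>lborel)"
      by (intro nn_integral_mono ennreal_leI point y)
    also have "\<dots> = ennreal (\<integral>x. D * exp (- \<bar>x\<bar>) \<partial>lborel)"
      using Ji D0 by (intro nn_integral_eq_integral) auto
    finally show "(\<integral>\<^sup>+x. ennreal (cmod (exp (Complex x y) * deriv ?f (exp (Complex x y)))) \<partial>lborel) \<le> ennreal (D * J)"
      by (simp add: J_def)
  qed
  then have fin: "H1norm \<psi> (deriv ?f) < \<infinity>" by (metis ennreal_less_top infinity_ennreal_def order_le_less_trans)
  have "filterlim (\<lambda>z. l + z) at_infinity at_infinity"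
    by (rule tendsto_add_filterlim_at_infinity[OF tendsto_const filterlim_ident])
  then have "(?f \<longlongrightarrow> 0) at_infinity" by (rule tendsto_divide_0[OF tendsto_const])
  then have "(?f \<longlongrightarrow> 0) (inf at_infinity (principal (sector \<psi>)))" by (rule tendsto_mono[rotated]) simp
  then show ?thesis using holo dholo fin by (simp add: Hpsi0_def Hpsi_def H1_def)
qed

text \<open>A kernel is the transformed derivative of \<open>lam / (lam + z)\<close>, which accounts
  for the coefficients \<open>c i * lam i\<close>. Lists become indexed sums to match
  \<open>resolvent_span\<close>.\<close>

lemma resolvent_span_of_kernel_span:
  assumes \<psi>: "0 < \<psi>" "\<psi> < pi" and q: "q \<in> kernel_span \<psi>"
  obtains G where "G \<in> resolvent_span \<psi>" "G holomorphic_on sector \<psi>"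
    "\<And>w. \<bar>Im w\<bar> < \<psi> \<Longrightarrow> exp w * deriv G (exp w) = q w"
proof -
  obtain xs where xs: "\<forall>(c, \<omega>)\<in>set xs. \<psi> < \<bar>Im \<omega>\<bar> \<and> \<bar>Im \<omega>\<bar> \<le> pi" "q = (\<lambda>w. \<Sum>(c, \<omega>)\<leftarrow>xs. c * kern (\<omega> - w))"
    using q by (auto simp: kernel_span_def)
  define n where "n = length xs"
  define om where "om = (\<lambda>i. snd (xs ! i))"
  define c where "c = (\<lambda>i. fst (xs ! i))"
  define lam where "lam = (\<lambda>i. - exp (om i))"
  define G where "G = (\<lambda>z. \<Sum>i<n. (c i * lam i) / (lam i + z))"
  have om: "\<psi> < \<bar>Im (om i)\<bar>" "\<bar>Im (om i)\<bar> \<le> pi" if "i < n" for i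
    using xs(1) that nth_mem[of i xs] by (auto simp: om_def n_def split_beta)
  \<comment> \<open>The minus sign is absorbed as a shift by pi towards the real axis, leaving an
    imaginary part of modulus \<open>pi - \<bar>Im (om i)\<bar>\<close>.\<close>
  have lam: "lam i \<in> sector (pi - \<psi>)" if "i < n" for i
  proof (cases "Im (om i) > 0")
    case True
    have "lam i = exp (om i - \<i> * pi)" by (simp add: lam_def exp_diff)
    moreover have "\<bar>Im (om i - \<i> * pi)\<bar> < pi - \<psi>" using om[OF that] True by auto
    ultimately show ?thesis using exp_in_sector[of "om i - \<i> * pi" "pi - \<psi>"] \<psi> by simp
  next
    case False
    have "lam i = exp (om i + \<i> * pi)" by (simp add: lam_def exp_add)
    moreover have "\<bar>Im (om i + \<i> * pi)\<bar> < pi - \<psi>" using om[OF that] False \<psi> by auto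
    ultimately show ?thesis using exp_in_sector[of "om i + \<i> * pi" "pi - \<psi>"] \<psi> by simp
  qed
  note ne = sector_add_ne_0[OF \<psi> lam]
  have G': "(G has_field_derivative (\<Sum>i<n. - (c i * lam i) / (lam i + z)\<^sup>2)) (at z)" if "z \<in> sector \<psi>" for z
    unfolding G_def by (intro DERIV_sum deriv_resolvent ne that) auto
  show ?thesis
  proof (rule that[of G])
    show "G \<in> resolvent_span \<psi>" unfolding resolvent_span_def G_def
      by (intro CollectI exI[of _ n] exI[of _ "\<lambda>i. c i * lam i"] exI[of _ lam]) (use lam in auto)
    show "G holomorphic_on sector \<psi>" using G' holomorphic_on_open[OF open_sector[OF \<psi>(2)]] by blast
    fix w :: complex assume w: "\<bar>Im w\<bar> < \<psi>"
    have "deriv G (exp w) = (\<Sum>i<n. - (c i * lam i) / (lam i + exp w)\<^sup>2)"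
      using w \<psi> by (intro DERIV_imp_deriv G' exp_in_sector) auto
    then have "exp w * deriv G (exp w) = (\<Sum>i<n. c i * (exp w * (- lam i / (lam i + exp w)\<^sup>2)))"
      by (simp add: sum_distrib_left algebra_simps)
    also have "\<dots> = (\<Sum>i<n. c i * kern (om i - w))" by (simp only: kern_resolvent[OF lam_def[THEN fun_cong]])
    also have "\<dots> = q w" unfolding xs(2)
      by (simp add: sum_list_sum_nth n_def c_def om_def split_beta atLeast0LessThan)
    finally show "exp w * deriv G (exp w) = q w" .
  qed
qed

text \<open>Each trace is one of the two nonnegative terms under the supremum, so it is bounded by
  the norm; finiteness makes \<open>enn2real\<close> faithful.\<close>

lemma hardy_strip_of_H1:
  assumes \<psi>: "0 < \<psi>" "\<psi> < pi" and g: "H1 \<psi> g"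
  shows "hardy_strip \<psi> (\<lambda>w. exp w * g (exp w)) (enn2real (H1norm \<psi> g))"
proof -
  have holo: "g holomorphic_on sector \<psi>" and fin: "H1norm \<psi> g < \<infinity>" using g by (auto simp: H1_def)
  define h where "h = (\<lambda>w. exp w * g (exp w))"
  have hh: "h holomorphic_on hstrip (- \<psi>) \<psi>"
  proof -
    have "(g \<circ> exp) holomorphic_on hstrip (- \<psi>) \<psi>"
      by (rule holomorphic_on_compose_gen[OF _ holo])
         (use \<psi> in \<open>auto intro!: exp_in_sector holomorphic_intros simp: hstrip_def\<close>)
    then show ?thesis unfolding h_def by (intro holomorphic_intros) (simp add: o_def)
  qed
  have le: "(\<integral>\<^sup>+x. ennreal (cmod (h (Complex x y))) \<partial>lborel) \<le> H1norm \<psi> g" if "\<bar>y\<bar> < \<psi>" for y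
  proof -
    have "y \<in> {- \<psi><..<\<psi>}" using that by auto
    then show ?thesis unfolding H1norm_eq_strip[OF \<psi>(2) holomorphic_on_imp_continuous_on[OF holo]] h_def
      by (rule SUP_upper2) (simp add: add_increasing2)
  qed
  have "integrable lborel (\<lambda>x. h (Complex x y)) \<and> hline_norm h y \<le> enn2real (H1norm \<psi> g)" if y: "\<bar>y\<bar> < \<psi>" for y
  proof
    have m: "(\<lambda>x. h (Complex x y)) \<in> borel_measurable borel"
      using measurable_hline[OF holomorphic_on_imp_continuous_on[OF hh]] y by (simp add: abs_less_iff)
    show "integrable lborel (\<lambda>x. h (Complex x y))"
      using le[OF y] fin m by (intro integrableI_bounded) (auto intro: le_less_trans)
    have "hline_norm h y = enn2real (\<integral>\<^sup>+x. ennreal (cmod (h (Complex x y))) \<partial>lborel)"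
      unfolding hline_norm_def using m by (intro integral_eq_nn_integral) auto
    also have "\<dots> \<le> enn2real (H1norm \<psi> g)" using le[OF y] fin by (intro enn2real_mono) auto
    finally show "hline_norm h y \<le> enn2real (H1norm \<psi> g)" .
  qed
  then show ?thesis using hh by (simp add: hardy_strip_def h_def)
qed

lemma resolvent_span_dense:
  assumes \<psi>: "0 < \<psi>" "\<psi> < pi" and f: "Hpsi \<psi> f" and \<epsilon>: "\<epsilon> > 0"
  shows "\<exists>G\<in>resolvent_span \<psi>. Hpsi0norm \<psi> (\<lambda>z. f z - G z) < ennreal \<epsilon>"
proof -
  have fh: "f holomorphic_on sector \<psi>" and H: "H1 \<psi> (deriv f)" using f by (auto simp: Hpsi_def)
  \<comment> \<open>The two rays double the error, and \<open>2 * \<epsilon> / 3\<close> is still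
    strictly below \<open>\<epsilon>\<close>.\<close>
  have e3: "\<epsilon> / 3 > 0" using \<epsilon> by simp
  obtain q where q: "q \<in> kernel_span \<psi>"
    "\<And>y. \<bar>y\<bar> < \<psi> \<Longrightarrow> (\<integral>\<^sup>+x. ennreal (cmod (exp (Complex x y) * deriv f (exp (Complex x y)) - q (Complex x y))) \<partial>lborel) < ennreal (\<epsilon> / 3)"
    by (rule hardy_kernel_span_dense[OF \<psi> hardy_strip_of_H1[OF \<psi> H] e3]) blast
  obtain G where G: "G \<in> resolvent_span \<psi>" "G holomorphic_on sector \<psi>"
    "\<And>w. \<bar>Im w\<bar> < \<psi> \<Longrightarrow> exp w * deriv G (exp w) = q w"
    using resolvent_span_of_kernel_span[OF \<psi> q(1)] by blast
  note os = open_sector[OF \<psi>(2)]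
  let ?d = "\<lambda>z. f z - G z"
  have dd: "deriv ?d z = deriv f z - deriv G z" if "z \<in> sector \<psi>" for z
    using that fh G(2) os by (intro deriv_diff) (auto intro: holomorphic_on_imp_differentiable_at)
  have "H1norm \<psi> (deriv ?d) \<le> ennreal (2 * (\<epsilon> / 3))"
  proof (rule H1norm_le[OF \<psi>(2)])
    show "continuous_on (sector \<psi>) (deriv ?d)"
      using fh G(2) by (intro holomorphic_on_imp_continuous_on holomorphic_deriv[OF _ os] holomorphic_intros)
    fix y assume y: "\<bar>y\<bar> < \<psi>"
    have "exp (Complex x y) * deriv ?d (exp (Complex x y)) = exp (Complex x y) * deriv f (exp (Complex x y)) - q (Complex x y)" for x
      using dd[OF exp_in_sector[of "Complex x y"]] G(3)[of "Complex x y"] y \<psi> by (simp add: right_diff_distrib)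
    then show "(\<integral>\<^sup>+x. ennreal (cmod (exp (Complex x y) * deriv ?d (exp (Complex x y)))) \<partial>lborel) \<le> ennreal (\<epsilon> / 3)"
      using q(2)[OF y] by simp
  qed (use \<epsilon> in simp)
  also have "\<dots> < ennreal \<epsilon>" using \<epsilon> by (intro ennreal_lessI) auto
  finally show ?thesis using G(1) by (auto simp: Hpsi0norm_def)
qed

text \<open>The first conjunct places the generators inside the space, so that the closure is taken
  there. In the equality the content is density; the reverse inclusion holds by the form of the
  right-hand set.\<close>

theorem theorem5p10:
  fixes \<psi> :: real
  assumes "0 < \<psi>" and "\<psi> < pi"
  shows "(\<forall>l\<in>sector (pi - \<psi>). Hpsi0 \<psi> (\<lambda>z. 1 / (l + z)))
    \<and> {f. Hpsi0 \<psi> f} =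
      {f. Hpsi0 \<psi> f \<and> (\<forall>\<epsilon>>0. \<exists>g\<in>resolvent_span \<psi>.
            Hpsi0norm \<psi> (\<lambda>z. f z - g z) < ennreal \<epsilon>)}"
  using Hpsi0_resolvent[OF assms] resolvent_span_dense[OF assms]
  by (auto simp: Hpsi0_def)

end
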